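(* For any $p\in(-\infty,1]$ there is a polynomial-time algorithm that, given any fair division instance $\mathcal{I} = \langle [m],[n],\{v_i\}_{i=1}^n\rangle$ in which the valuation function $v_i$ of each agent $i\in[n]$ is nonnegative, normalized, monotone, and subadditive, and given value oracle access to the functions $v_i$, computes an $8n$-approximation to the optimal $p$-mean welfare; that is, it computes an allocation $\mathcal{B}$ with $$\mathrm{M}_p(\mathcal{B}) \;\ge\; \frac{1}{8n}\,\max_{\mathcal{A}} \mathrm{M}_p(\mathcal{A}),$$ where the maximum is over all allocations $\mathcal{A}$ of $[m]$ among the $n$ agents.
   Context: A fair division instance $\langle [m],[n],\{v_i\}_{i=1}^n\rangle$ consists of a set $[m]=\{1,\ldots,m\}$ of indivisible goods, a set $[n]=\{1,\ldots,n\}$ of agents, and for each agent $i$ a valuation function $v_i:2^{[m]}\to\mathbb{R}_+$. A valuation $v$ is normalized if $v(\emptyset)=0$, monotone if $v(A)\le v(B)$ whenever $A\subseteq B$, and subadditive if $v(A\cup B)\le v(A)+v(B)$ for all $A,B\subseteq[m]$. An allocation is a partition $\mathcal{A}=(A_1,\ldots,A_n)$ of $[m]$ into $n$ (possibly empty) bundles, agent $i$ receiving $A_i$. The $p$-mean welfare of $\mathcal{A}$ is $\mathrm{M}_p(\mathcal{A})=\left(\frac1n\sum_{i=1}^n v_i(A_i)^p\right)^{1/p}$ for $p\ne 0$; for $p=0$ it is the limit $p\to0$, i.e. the geometric mean $\left(\prod_{i} v_i(A_i)\right)^{1/n}$ (Nash social welfare); for $p<0$ it is taken to be $0$ if some $v_i(A_i)=0$.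 Value oracle access: a query consists of an agent $i$ and a set $S\subseteq[m]$ and returns $v_i(S)$. Polynomial time means that the number of value queries and elementary operations is polynomial in $n$, $m$, and the bit length of the values. *)

theory Defs
  imports
    Complex_Main
    "HOL-Library.FuncSet"
    "HOL-Library.Disjoint_Sets"
    "HOL-Library.Log_Nat"
    "HOL-Computational_Algebra.Polynomial"
begin

section \<open>Fair division\<close>

definition nonneg_val :: "nat \<Rightarrow> (nat set \<Rightarrow> real) \<Rightarrow> bool" where
  "nonneg_val m f \<longleftrightarrow> (\<forall>A. A \<subseteq> {1..m} \<longrightarrow> 0 \<le> f A)"

definition normalized_val :: "(nat set \<Rightarrow> real) \<Rightarrow> bool" where
  "normalized_val f \<longleftrightarrow> f {} = 0"

definition monotone_val :: "nat \<Rightarrow> (nat set \<Rightarrow> real) \<Rightarrow> bool" where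
  "monotone_val m f \<longleftrightarrow> (\<forall>A B. A \<subseteq> B \<and> B \<subseteq> {1..m} \<longrightarrow> f A \<le> f B)"

definition subadditive_val :: "nat \<Rightarrow> (nat set \<Rightarrow> real) \<Rightarrow> bool" where
  "subadditive_val m f \<longleftrightarrow>
     (\<forall>A B. A \<subseteq> {1..m} \<and> B \<subseteq> {1..m} \<longrightarrow> f (A \<union> B) \<le> f A + f B)"

definition allocations :: "nat \<Rightarrow> nat \<Rightarrow> (nat \<Rightarrow> nat set) set" where
  "allocations n m =
     {A \<in> {1..n} \<rightarrow>\<^sub>E Pow {1..m}. disjoint_family_on A {1..n} \<and> (\<Union>i\<in>{1..n}. A i) = {1..m}}"

text \<open>
  The case split is needed since \<open>0 powr x = 0\<close> for every \<open>x\<close>: for negative \<open>p\<close>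
  a bundle of value \<open>0\<close> would otherwise just drop out of the sum.
\<close>

definition pmean :: "real \<Rightarrow> nat \<Rightarrow> (nat \<Rightarrow> nat set \<Rightarrow> real) \<Rightarrow> (nat \<Rightarrow> nat set) \<Rightarrow> real" where
  "pmean p n v A =
     (if p = 0 then (\<Prod>i = 1..n. v i (A i)) powr (1 / real n)
      else if p < 0 \<and> (\<exists>i\<in>{1..n}. v i (A i) = 0) then 0
      else (1 / real n * (\<Sum>i = 1..n. v i (A i) powr p)) powr (1 / p))"

lemma finite_allocations: "finite (allocations n m)"
  unfolding allocations_def by (simp add: finite_PiE)

lemma allocations_nonempty:
  assumes "n \<ge> 1"
  shows "allocations n m \<noteq> {}"
proof -
  have "(\<lambda>i\<in>{1..n}. if i = 1 then {1..m} else {}) \<in> allocations n m"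
    using assms by (auto simp: allocations_def disjoint_family_on_def split: if_splits)
  then show ?thesis by blast
qed


section \<open>Bit length\<close>

definition rat_size :: "rat \<Rightarrow> nat" where
  "rat_size q = 1 + nat (bitlen \<bar>fst (quotient_of q)\<bar>) + nat (bitlen (snd (quotient_of q)))"

text \<open>
  The maximum, not the sum, over the (exponentially many) values of an instance.
\<close>

definition value_bits :: "nat \<Rightarrow> nat \<Rightarrow> (nat \<Rightarrow> nat set \<Rightarrow> rat) \<Rightarrow> nat" where
  "value_bits n m v = Max ((\<lambda>(i, S). rat_size (v i S)) ` ({1..n} \<times> Pow {1..m}))"


section \<open>Value oracle programs with bit cost\<close>

text \<open>
  A program is a finite imperative program over arrays of rationals, independent of the
  instance. The indices of an array are the integers, an index expression being rounded
  down; the cell with index 0 serves as a plain variable. Every value that is computed is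
  charged its bit length, so that costs are polynomially related to Turing machine time;
  charging 1 per operation would not be, in the presence of multiplication and rounding.

  The valuations are visible to a program only through \<open>Query\<close>, and the exponent \<open>p\<close> only
  through \<open>Approx\<close>: \<open>p\<close> is an arbitrary real number, so a program cannot contain it as a
  constant. \<open>Approx x e\<close> returns \<open>p\<close> truncated to as many binary digits as the value of \<open>e\<close>
  says and charges for that number in unary.
\<close>

type_synonym vname = string
type_synonym store = "vname \<Rightarrow> int \<Rightarrow> rat"

datatype aexp =
    Const rat
  | Cell vname aexp
  | Plus aexp aexp
  | Minus aexp aexp
  | Times aexp aexp
  | Divide aexp aexp
  | Floor aexp

datatype bexp =
    Less aexp aexp
  | Not bexp
  | And bexp bexp

datatype com =
    Skip
  | Assign vname aexp aexp
  | Query vname aexp vname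
  | Approx vname aexp
  | Seq com com
  | If bexp com com
  | While bexp com

fun aval :: "aexp \<Rightarrow> store \<Rightarrow> rat" where
  "aval (Const q) s = q"
| "aval (Cell x e) s = s x \<lfloor>aval e s\<rfloor>"
| "aval (Plus a b) s = aval a s + aval b s"
| "aval (Minus a b) s = aval a s - aval b s"
| "aval (Times a b) s = aval a s * aval b s"
| "aval (Divide a b) s = aval a s / aval b s"
| "aval (Floor a) s = of_int \<lfloor>aval a s\<rfloor>"

fun acost :: "aexp \<Rightarrow> store \<Rightarrow> nat" where
  "acost (Const q) s = rat_size q"
| "acost (Cell x e) s = acost e s + rat_size (aval (Cell x e) s)"
| "acost (Plus a b) s = acost a s + acost b s + rat_size (aval (Plus a b) s)"
| "acost (Minus a b) s = acost a s + acost b s + rat_size (aval (Minus a b) s)"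
| "acost (Times a b) s = acost a s + acost b s + rat_size (aval (Times a b) s)"
| "acost (Divide a b) s = acost a s + acost b s + rat_size (aval (Divide a b) s)"
| "acost (Floor a) s = acost a s + rat_size (aval (Floor a) s)"

fun bval :: "bexp \<Rightarrow> store \<Rightarrow> bool" where
  "bval (Less a b) s \<longleftrightarrow> aval a s < aval b s"
| "bval (Not b) s \<longleftrightarrow> \<not> bval b s"
| "bval (And b c) s \<longleftrightarrow> bval b s \<and> bval c s"

fun bcost :: "bexp \<Rightarrow> store \<Rightarrow> nat" where
  "bcost (Less a b) s = 1 + acost a s + acost b s"
| "bcost (Not b) s = 1 + bcost b s"
| "bcost (And b c) s = 1 + bcost b s + bcost c s"

definition store_update :: "store \<Rightarrow> vname \<Rightarrow> int \<Rightarrow> rat \<Rightarrow> store" where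
  "store_update s x k q = s(x := (s x)(k := q))"

text \<open>The set of goods passed to the oracle is given by its characteristic array.\<close>

definition goods_of :: "nat \<Rightarrow> (int \<Rightarrow> rat) \<Rightarrow> nat set" where
  "goods_of m a = {g \<in> {1..m}. a (int g) \<noteq> 0}"

definition answer ::
  "nat \<Rightarrow> (nat \<Rightarrow> nat set \<Rightarrow> rat) \<Rightarrow> int \<Rightarrow> nat set \<Rightarrow> rat" where
  "answer n v k S = (if 1 \<le> k \<and> k \<le> int n then v (nat k) S else 0)"

definition truncated :: "real \<Rightarrow> nat \<Rightarrow> rat" where
  "truncated p k = of_int \<lfloor>p * 2 ^ k\<rfloor> / 2 ^ k"

text \<open>\<open>exec p n m v c s t s'\<close>: started in \<open>s\<close>, program \<open>c\<close> halts in \<open>s'\<close> at total cost \<open>t\<close>.\<close>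

inductive exec ::
  "real \<Rightarrow> nat \<Rightarrow> nat \<Rightarrow> (nat \<Rightarrow> nat set \<Rightarrow> rat) \<Rightarrow> com \<Rightarrow> store \<Rightarrow> nat \<Rightarrow> store \<Rightarrow> bool"
  for p :: real and n m :: nat and v :: "nat \<Rightarrow> nat set \<Rightarrow> rat"
where
  Skip: "exec p n m v Skip s 1 s"
| Assign: "exec p n m v (Assign x i e) s (1 + acost i s + acost e s)
     (store_update s x \<lfloor>aval i s\<rfloor> (aval e s))"
| Query: "q = answer n v \<lfloor>aval i s\<rfloor> (goods_of m (s a)) \<Longrightarrow>
     exec p n m v (Query x i a) s (1 + acost i s + m + rat_size q) (store_update s x 0 q)"
| Approx: "k = nat \<lfloor>aval e s\<rfloor> \<Longrightarrow> q = truncated p k \<Longrightarrow>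
     exec p n m v (Approx x e) s (1 + acost e s + k + rat_size q) (store_update s x 0 q)"
| Seq: "exec p n m v c s t s' \<Longrightarrow> exec p n m v d s' t' s'' \<Longrightarrow>
     exec p n m v (Seq c d) s (1 + t + t') s''"
| IfTrue: "bval b s \<Longrightarrow> exec p n m v c s t s' \<Longrightarrow>
     exec p n m v (If b c d) s (1 + bcost b s + t) s'"
| IfFalse: "\<not> bval b s \<Longrightarrow> exec p n m v d s t s' \<Longrightarrow>
     exec p n m v (If b c d) s (1 + bcost b s + t) s'"
| WhileFalse: "\<not> bval b s \<Longrightarrow> exec p n m v (While b c) s (1 + bcost b s) s"
| WhileTrue: "bval b s \<Longrightarrow> exec p n m v c s t s' \<Longrightarrow> exec p n m v (While b c) s' t' s'' \<Longrightarrow>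
     exec p n m v (While b c) s (1 + bcost b s + t + t') s''"

inductive_cases exec_SkipE: "exec p n m v Skip s t s'"
inductive_cases exec_AssignE: "exec p n m v (Assign x i e) s t s'"
inductive_cases exec_QueryE: "exec p n m v (Query x i a) s t s'"
inductive_cases exec_ApproxE: "exec p n m v (Approx x e) s t s'"
inductive_cases exec_SeqE: "exec p n m v (Seq c d) s t s'"
inductive_cases exec_IfE: "exec p n m v (If b c d) s t s'"
inductive_cases exec_WhileE: "exec p n m v (While b c) s t s'"

lemma exec_deterministic:
  "exec p n m v c s t s' \<Longrightarrow> exec p n m v c s u r \<Longrightarrow> t = u \<and> s' = r"
proof (induction arbitrary: u r rule: exec.induct)
  case (Skip s)
  from Skip.prems show ?case by (rule exec_SkipE) simp
next
  case (Assign x i e s)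
  from Assign.prems show ?case by (rule exec_AssignE) simp
next
  case (Query q i s a x)
  from Query.prems show ?case by (rule exec_QueryE) (use Query.hyps in simp)
next
  case (Approx k e s q x)
  from Approx.prems show ?case by (rule exec_ApproxE) (use Approx.hyps in simp)
next
  case (Seq c s t s' d t' s'')
  from Seq.prems show ?case
  proof (rule exec_SeqE)
    fix t1 s1 t2
    assume "u = Suc (t1 + t2)" "exec p n m v c s t1 s1" "exec p n m v d s1 t2 r"
    with Seq.IH show ?thesis by (metis Suc_eq_plus1_left add.assoc)
  qed
next
  case (IfTrue b s c t s' d)
  from IfTrue.prems show ?case
  proof (rule exec_IfE)
    fix t1 assume "u = Suc (bcost b s + t1)" "exec p n m v c s t1 r"
    with IfTrue.IH show ?thesis by (metis Suc_eq_plus1_left add.assoc)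
  qed (use IfTrue.hyps in simp_all)
next
  case (IfFalse b s d t s' c)
  from IfFalse.prems show ?case
  proof (rule exec_IfE)
    fix t1 assume "u = Suc (bcost b s + t1)" "exec p n m v d s t1 r"
    with IfFalse.IH show ?thesis by (metis Suc_eq_plus1_left add.assoc)
  qed (use IfFalse.hyps in simp_all)
next
  case (WhileFalse b s c)
  from WhileFalse.prems show ?case
    by (rule exec_WhileE) (use WhileFalse.hyps in simp_all)
next
  case (WhileTrue b s c t s' t' s'')
  from WhileTrue.prems show ?case
  proof (rule exec_WhileE)
    fix t1 s1 t2
    assume "u = Suc (bcost b s + t1 + t2)" "exec p n m v c s t1 s1" "exec p n m v (While b c) s1 t2 r"
    with WhileTrue.IH show ?thesis by (metis Suc_eq_plus1_left add.assoc)
  qed (use WhileTrue.hyps in simp_all)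
qed

definition initial_store :: "nat \<Rightarrow> nat \<Rightarrow> store" where
  "initial_store n m =
     store_update (store_update (\<lambda>_ _. 0) ''n'' 0 (of_nat n)) ''m'' 0 (of_nat m)"

text \<open>A program outputs an allocation as the array that maps each good to its owner.\<close>

definition output_bundles :: "nat \<Rightarrow> nat \<Rightarrow> store \<Rightarrow> nat \<Rightarrow> nat set" where
  "output_bundles n m s = (\<lambda>i\<in>{1..n}. {g \<in> {1..m}. s ''owner'' (int g) = of_nat i})"

end

theory Submission
  imports Defs
begin

text \<open>
  Let \<open>V\<^sub>i\<close> be the value of agent \<open>i\<close> for all goods except her \<open>n\<close> favourite ones. By subadditivity, a bundle is
  worth at most \<open>u\<^sub>i g = n * v\<^sub>i {g} + V\<^sub>i\<close> to \<open>i\<close>, where \<open>g\<close> is its best good. As bundles are disjoint, the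
  optimum is bounded by the best \<open>p\<close>-mean of the potentials \<open>u\<close> over all matchings of agents to goods.

  Conversely, start with a matching and let agents swap to unmatched goods they prefer, so that finally every agent
  values her own good at least as much as any unmatched one. Bag filling on the set \<open>R\<close> of unmatched goods
  gives \<open>v\<^sub>i R / (2 * n)\<close> to every agent whose own good is worth less than that. If an agent's low good is matched, then
  one of her \<open>n\<close> favourite goods is not, so \<open>V\<^sub>i\<close> exceeds \<open>v\<^sub>i R\<close> by at most \<open>n\<close> times her own good, and
  she ends up with at least \<open>u\<^sub>i g / (4 * n)\<close>, where \<open>g\<close> is the good that she was matched to.

  It remains to lose only a factor \<open>2\<close> in the matching. The powers \<open>u powr p\<close> are approximated by integer powers of a
  rational \<open>\<gamma> = 1 + 1 / G\<close>, where \<open>G\<close> depends on \<open>p\<close>, and scaled to polynomially bounded integer weights;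
  an auction with unit price increments then finds a matching of weight within \<open>n\<close> of the maximum in polynomial
  time. For \<open>p > 0\<close> the weights are scaled by the largest power. For \<open>p \<le> 0\<close> costs are subtracted from a threshold,
  which is raised until the auction serves every agent; failure at the previous threshold bounds the optimum.
\<close>

section \<open>Bit lengths and a cost calculus for programs\<close>

text \<open>The cost model charges bit length, and \<open>p\<close> is an arbitrary real, so powers
  with exponent \<open>p\<close> are never computed. Rounding them is affordable because a positive
  number of \<open>bits\<close> bits has a logarithm to base \<open>gam G\<close> of absolute value
  at most \<open>G * bits\<close>: logarithms can be found by counting, the exact rational powers of
  \<open>gam G\<close> stay polynomially long, and polynomially many digits of \<open>p\<close>
  determine the exponent up to a constant. As \<open>gam G\<close> is close to 1, constant errors in
  the exponent are small factors.

  A single number \<open>Y\<close>, polynomial in the input, bounds the size of all cells of the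
  store and the number of iterations of each loop; the running time is then a polynomial in
  \<open>Y\<close> that can be read off the syntax of the program.

  Auction and rounding together lose \<open>2 * n\<close>, against weights of scale
  \<open>H * n\<close>. This is a relative error of at most \<open>8 / H\<close> once the quantity
  to which it is added is at least \<open>1 / 4\<close> in units of that scale. For
  \<open>p > 0\<close> the scaling by the largest power ensures this, and for \<open>p < 0\<close>
  the failure just below the final threshold.\<close>

lemma rat_size_ge_2: "rat_size q \<ge> 2"
proof -
  have "snd (quotient_of q) > 0" by (rule quotient_of_denom_pos')
  then have "bitlen (snd (quotient_of q)) \<ge> 1"
    by (simp add: bitlen_ge_iff_power)
  then show ?thesis unfolding rat_size_def by linarith
qed

lemma nat_bitlen_le: "a < 2 ^ k \<Longrightarrow> nat (bitlen a) \<le> k"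
  using bitlen_le_iff_power[of a "int k"] by simp

lemma less_power_bitlen: "0 \<le> a \<Longrightarrow> a < 2 ^ nat (bitlen a)"
  using bitlen_le_iff_power[of a "bitlen a"] by simp

text \<open>Lowest terms arise by cancelling a common factor \<open>e\<close>, so every fraction
  that represents \<open>q\<close> bounds its size. The estimates for sums, products and floors only
  have to exhibit one.\<close>

lemma rat_size_fraction:
  fixes a b :: int
  assumes b: "b > 0" and a_lt: "\<bar>a\<bar> < 2 ^ j" and b_lt: "b < 2 ^ k" and q: "q = of_int a / of_int b"
  shows "rat_size q \<le> 1 + j + k"
proof -
  obtain c d where cd: "quotient_of q = (c, d)" by fastforce
  have d: "d > 0" using cd by (rule quotient_of_denom_pos)
  have cop: "coprime c d" using cd by (rule quotient_of_coprime)
  have "q = of_int c / of_int d" using cd by (rule quotient_of_div)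
  then have "rat_of_int (c * b) = of_int (a * d)" using q b d by (simp add: field_simps)
  then have eq: "c * b = a * d" by (simp only: of_int_eq_iff)
  have "d dvd c * b" using eq by simp
  then have "d dvd b" using cop by (simp add: coprime_dvd_mult_right_iff coprime_commute)
  then obtain e where e: "b = d * e" by auto
  have e1: "e > 0" using e b d by (simp add: zero_less_mult_iff)
  have "a = c * e" using eq e d by simp
  then have "\<bar>c\<bar> \<le> \<bar>a\<bar>" using e1 by (simp add: abs_mult mult_le_cancel_left1)
  moreover have "d \<le> b" using e e1 d by simp
  ultimately have "\<bar>c\<bar> < 2 ^ j" "d < 2 ^ k" using a_lt b_lt by linarith+
  then show ?thesis unfolding rat_size_def cd by (simp add: nat_bitlen_le add_mono)
qed

lemma rat_sizeE:
  obtains a b :: int and j k where "q = of_int a / of_int b" "b > 0" "\<bar>a\<bar> < 2 ^ j" "b < 2 ^ k"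
    "rat_size q = 1 + j + k" "k \<ge> 1"
proof -
  obtain a b where ab: "quotient_of q = (a, b)" by fastforce
  have b: "b > 0" using ab by (rule quotient_of_denom_pos)
  have "nat (bitlen b) \<ge> 1" using b by (simp add: bitlen_ge_iff_power nat_le_iff le_nat_iff)
  show ?thesis
  proof (rule that)
    show "q = of_int a / of_int b" using ab by (rule quotient_of_div)
    show "\<bar>a\<bar> < 2 ^ nat (bitlen \<bar>a\<bar>)" "b < 2 ^ nat (bitlen b)"
      using b by (simp_all add: less_power_bitlen)
  qed (use b \<open>nat (bitlen b) \<ge> 1\<close> in \<open>simp_all add: rat_size_def ab\<close>)
qed

lemma rat_size_mult: "rat_size (q * r) \<le> rat_size q + rat_size r"
proof -
  obtain a b j k where q: "q = of_int a / of_int b" "b > 0" "\<bar>a\<bar> < 2 ^ j" "b < 2 ^ k"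
    "rat_size q = 1 + j + k" by (rule rat_sizeE)
  obtain c d i l where r: "r = of_int c / of_int d" "d > 0" "\<bar>c\<bar> < 2 ^ i" "d < 2 ^ l"
    "rat_size r = 1 + i + l" by (rule rat_sizeE)
  have "\<bar>a * c\<bar> < 2 ^ (j + i)" using q(3) r(3) by (simp add: abs_mult power_add mult_strict_mono')
  moreover have "b * d < 2 ^ (k + l)" using q r by (simp add: power_add mult_strict_mono')
  ultimately have "rat_size (q * r) \<le> 1 + (j + i) + (k + l)"
    by (intro rat_size_fraction[of "b * d" "a * c"]) (use q r in auto)
  then show ?thesis using q r by simp
qed

lemma rat_size_uminus: "rat_size (- q) = rat_size q"
  by (simp add: rat_size_def rat_uminus_code split: prod.split)

lemma rat_size_inverse: "rat_size (inverse q) \<le> rat_size q"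
proof (cases "q = 0")
  case False
  obtain a b j k where q: "q = of_int a / of_int b" "b > 0" "\<bar>a\<bar> < 2 ^ j" "b < 2 ^ k"
    "rat_size q = 1 + j + k" by (rule rat_sizeE)
  have a: "a \<noteq> 0" using False q by auto
  have "rat_size (inverse q) \<le> 1 + k + j"
    by (intro rat_size_fraction[of "\<bar>a\<bar>" "sgn a * b"])
       (use q a in \<open>auto simp: abs_mult sgn_if\<close>)
  then show ?thesis using q by simp
qed simp

lemma rat_size_divide: "rat_size (q / r) \<le> rat_size q + rat_size r"
  using rat_size_mult[of q "inverse r"] rat_size_inverse[of r] by (simp add: divide_inverse)

lemma rat_size_add: "rat_size (q + r) \<le> 2 * (rat_size q + rat_size r)"
proof -
  obtain a b j k where q: "q = of_int a / of_int b" "b > 0" "\<bar>a\<bar> < 2 ^ j" "b < 2 ^ k"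
    "rat_size q = 1 + j + k" by (rule rat_sizeE)
  obtain c d i l where r: "r = of_int c / of_int d" "d > 0" "\<bar>c\<bar> < 2 ^ i" "d < 2 ^ l"
    "rat_size r = 1 + i + l" by (rule rat_sizeE)
  have "\<bar>a * d\<bar> < 2 ^ (j + l)"
    using q(3) r by (simp add: abs_mult power_add mult_strict_mono')
  also have "\<dots> \<le> 2 ^ (i + j + k + l)" by (intro power_increasing) auto
  finally have 1: "\<bar>a * d\<bar> < 2 ^ (i + j + k + l)" .
  have "\<bar>c * b\<bar> < 2 ^ (i + k)"
    using q r by (simp add: abs_mult power_add mult_strict_mono')
  also have "\<dots> \<le> 2 ^ (i + j + k + l)" by (intro power_increasing) auto
  finally have "\<bar>a * d + c * b\<bar> < 2 ^ (i + j + k + l + 1)" using 1 by simp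
  moreover have "b * d < 2 ^ (k + l)" using q r by (simp add: power_add mult_strict_mono')
  ultimately have "rat_size (q + r) \<le> 1 + (i + j + k + l + 1) + (k + l)"
    by (intro rat_size_fraction[of "b * d" "a * d + c * b"]) (use q r in \<open>auto simp: field_simps\<close>)
  then show ?thesis using q r by simp
qed

lemma rat_size_diff: "rat_size (q - r) \<le> 2 * (rat_size q + rat_size r)"
  using rat_size_add[of q "- r"] by (simp add: rat_size_uminus)

lemma int_less_two_power_nat: "z < 2 ^ nat z" for z :: int
proof (cases "z \<ge> 0")
  case True
  have "nat z < 2 ^ nat z" by (rule less_exp)
  then have "int (nat z) < int (2 ^ nat z)" by (simp only: of_nat_less_iff)
  then show ?thesis using True by simp
next
  case False
  have "0 < (2::int) ^ nat z" by simp
  then show ?thesis using False by linarith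
qed

text \<open>Linear instead of logarithmic in the absolute value, which suffices: the integers in the
  store are counters, prices, weights and exponents, all polynomially bounded themselves.\<close>

lemma rat_size_of_int: "rat_size (of_int z) \<le> nat \<bar>z\<bar> + 2"
  using rat_size_fraction[of 1 z "nat \<bar>z\<bar>" 1 "of_int z"] int_less_two_power_nat[of "\<bar>z\<bar>"] by simp

lemma rat_size_of_nat: "rat_size (of_nat k) \<le> k + 2"
  using rat_size_of_int[of "int k"] by simp

lemma rat_size_floor: "rat_size (of_int \<lfloor>q\<rfloor>) \<le> 2 * rat_size q"
proof -
  obtain a b j k where q: "q = of_int a / of_int b" "b > 0" "\<bar>a\<bar> < 2 ^ j" "b < 2 ^ k"
    "rat_size q = 1 + j + k" "k \<ge> 1" by (rule rat_sizeE)
  have "\<lfloor>q\<rfloor> = a div b" using q by (simp add: floor_divide_of_int_eq)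
  moreover have "\<bar>a div b\<bar> \<le> \<bar>a\<bar> + 1"
  proof (cases "a \<ge> 0")
    case True
    then show ?thesis using q zdiv_mono2[of a 1 b] pos_imp_zdiv_nonneg_iff[of b a] by simp
  next
    case False
    then show ?thesis using q zdiv_mono2_neg[of a 1 b] pos_imp_zdiv_nonneg_iff[of b a] by simp
  qed
  ultimately have "\<bar>\<lfloor>q\<rfloor>\<bar> < 2 ^ (j + 1)" using q(3) by simp
  then have "rat_size (of_int \<lfloor>q\<rfloor>) \<le> 1 + (j + 1) + 1"
    by (intro rat_size_fraction[of 1 "\<lfloor>q\<rfloor>" "j + 1" 1]) auto
  then show ?thesis using q by simp
qed

lemma rat_size_power: "rat_size (q ^ k) \<le> 3 + k * rat_size q"
proof (induction k)
  case 0
  show ?case by (simp add: rat_size_def bitlen_alt_def)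
next
  case (Suc k)
  then show ?case using rat_size_mult[of q "q ^ k"] by simp
qed

lemma rat_less_two_power_size: "q < 2 ^ rat_size q"
proof -
  obtain a b j k where q: "q = of_int a / of_int b" "b > 0" "\<bar>a\<bar> < 2 ^ j" "b < 2 ^ k"
    "rat_size q = 1 + j + k" by (rule rat_sizeE)
  have "a \<le> \<bar>a\<bar> * b" using q(2) mult_mono[of "\<bar>a\<bar>" "\<bar>a\<bar>" 1 b] by linarith
  then have "rat_of_int a \<le> of_int (\<bar>a\<bar> * b)" by (simp only: of_int_le_iff)
  then have "q \<le> of_int \<bar>a\<bar>" using q by (simp add: pos_divide_le_eq)
  also have "\<dots> < of_int (2 ^ j)" using q(3) by (simp only: of_int_less_iff)
  also have "rat_of_int (2 ^ j) = 2 ^ j" by simp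
  also have "\<dots> \<le> 2 ^ rat_size q" using q(5) by (intro power_increasing) auto
  finally show ?thesis .
qed

section \<open>Cost of expressions and running time of programs in a bounded store\<close>

fun acost_coeff :: "aexp \<Rightarrow> nat" where
  "acost_coeff (Const q) = rat_size q"
| "acost_coeff (Cell x e) = acost_coeff e + 1"
| "acost_coeff (Plus a b) = 3 * (acost_coeff a + acost_coeff b)"
| "acost_coeff (Minus a b) = 3 * (acost_coeff a + acost_coeff b)"
| "acost_coeff (Times a b) = 3 * (acost_coeff a + acost_coeff b)"
| "acost_coeff (Divide a b) = 3 * (acost_coeff a + acost_coeff b)"
| "acost_coeff (Floor a) = 3 * acost_coeff a"

fun bcost_coeff :: "bexp \<Rightarrow> nat" where
  "bcost_coeff (Less a b) = 1 + acost_coeff a + acost_coeff b"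
| "bcost_coeff (Not b) = 1 + bcost_coeff b"
| "bcost_coeff (And b c) = 1 + bcost_coeff b + bcost_coeff c"

text \<open>One bound for all cells of all arrays, so that costs do not depend on which variables a
  program reads.\<close>

definition bounded_store :: "nat \<Rightarrow> store \<Rightarrow> bool" where
  "bounded_store Y s \<longleftrightarrow> (\<forall>x k. rat_size (s x k) \<le> Y)"

lemma bounded_store_update:
  "bounded_store Y s \<Longrightarrow> rat_size q \<le> Y \<Longrightarrow> bounded_store Y (store_update s x k q)"
  by (simp add: bounded_store_def store_update_def)

lemma rat_size_aval_le_acost: "rat_size (aval e s) \<le> acost e s"
  by (cases e) auto

text \<open>Expressions have fixed depth, and each operation enlarges sizes only by a constant
  factor. The factor 3 in \<open>acost_coeff\<close> pays once for the operands and at most twice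
  their cost for the size of the result, as in \<open>rat_size_add\<close>.\<close>

lemma acost_le:
  assumes "bounded_store Y s"
  shows "acost e s \<le> acost_coeff e * Y"
proof -
  have Y: "Y \<ge> 1" using assms rat_size_ge_2[of "s undefined undefined"]
    unfolding bounded_store_def by (meson one_le_numeral order_trans)
  show ?thesis
  proof (induction e)
    case (Const q)
    then show ?case using Y by simp
  next
    case (Cell x e)
    moreover have "rat_size (s x \<lfloor>aval e s\<rfloor>) \<le> Y" using assms by (simp add: bounded_store_def)
    ultimately show ?case by simp
  next
    case (Plus a b)
    have "rat_size (aval (Plus a b) s) \<le> 2 * (acost a s + acost b s)"
      using rat_size_add[of "aval a s" "aval b s"] rat_size_aval_le_acost[of a s]
        rat_size_aval_le_acost[of b s] by simp
    then show ?case using Plus by (simp add: algebra_simps)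
  next
    case (Minus a b)
    have "rat_size (aval (Minus a b) s) \<le> 2 * (acost a s + acost b s)"
      using rat_size_diff[of "aval a s" "aval b s"] rat_size_aval_le_acost[of a s]
        rat_size_aval_le_acost[of b s] by simp
    then show ?case using Minus by (simp add: algebra_simps)
  next
    case (Times a b)
    have "rat_size (aval (Times a b) s) \<le> acost a s + acost b s"
      using rat_size_mult[of "aval a s" "aval b s"] rat_size_aval_le_acost[of a s]
        rat_size_aval_le_acost[of b s] by simp
    then show ?case using Times by (simp add: algebra_simps)
  next
    case (Divide a b)
    have "rat_size (aval (Divide a b) s) \<le> acost a s + acost b s"
      using rat_size_divide[of "aval a s" "aval b s"] rat_size_aval_le_acost[of a s]
        rat_size_aval_le_acost[of b s] by simp
    then show ?case using Divide by (simp add: algebra_simps)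
  next
    case (Floor a)
    have "rat_size (aval (Floor a) s) \<le> 2 * acost a s"
      using rat_size_floor[of "aval a s"] rat_size_aval_le_acost[of a s] by simp
    then show ?case using Floor by (simp add: algebra_simps)
  qed
qed

lemma bcost_le:
  assumes "bounded_store Y s"
  shows "bcost b s \<le> bcost_coeff b * Y"
proof -
  have Y: "Y \<ge> 1" using assms rat_size_ge_2[of "s undefined undefined"]
    unfolding bounded_store_def by (meson one_le_numeral order_trans)
  show ?thesis
  proof (induction b)
    case (Less a b)
    show ?case using acost_le[OF assms, of a] acost_le[OF assms, of b] Y
      by (simp add: algebra_simps)
  qed (use Y in \<open>simp_all add: algebra_simps\<close>)
qed

text \<open>A polynomial in the size bound \<open>Y\<close> that depends on the syntax alone. The
  clause for \<open>While\<close> allows \<open>Y\<close> iterations, which each use of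
  \<open>wp_While\<close> has to justify; the summand 2 for a query or an approximation pays for
  \<open>m\<close> or the number of digits and for the size of the result.\<close>

fun time_bound :: "com \<Rightarrow> nat poly" where
  "time_bound Skip = 1"
| "time_bound (Assign x i e) = [:1, acost_coeff i + acost_coeff e:]"
| "time_bound (Query x i a) = [:1, acost_coeff i + 2:]"
| "time_bound (Approx x e) = [:1, acost_coeff e + 2:]"
| "time_bound (Seq c d) = 1 + time_bound c + time_bound d"
| "time_bound (If b c d) = [:1, bcost_coeff b:] + time_bound c + time_bound d"
| "time_bound (While b c) = [:1, 1:] * ([:1, bcost_coeff b:] + time_bound c)"

fun modified :: "com \<Rightarrow> vname set" where
  "modified Skip = {}"
| "modified (Assign x i e) = {x}"
| "modified (Query x i a) = {x}"
| "modified (Approx x e) = {x}"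
| "modified (Seq c d) = modified c \<union> modified d"
| "modified (If b c d) = modified c \<union> modified d"
| "modified (While b c) = modified c"

lemma exec_unmodified: "exec p n m v c s t s' \<Longrightarrow> x \<notin> modified c \<Longrightarrow> s' x = s x"
  by (induction rule: exec.induct) (auto simp: store_update_def)

abbreviation var :: "vname \<Rightarrow> aexp" where
  "var x \<equiv> Cell x (Const 0)"

abbreviation put :: "vname \<Rightarrow> aexp \<Rightarrow> com" where
  "put x e \<equiv> Assign x (Const 0) e"

notation Seq (infixr ";;" 60)

definition For :: "vname \<Rightarrow> nat \<Rightarrow> aexp \<Rightarrow> com \<Rightarrow> com" where
  "For x a e c =
     (put x (Const (of_nat a)) ;; While (Less (var x) e) (c ;; put x (Plus (var x) (Const 1))))"

lemma modified_For [simp]: "modified (For x a e c) = insert x (modified c)"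
  by (auto simp: For_def)

lemma store_update_apply [simp]:
  "store_update s x k q y = (if y = x then (s x)(k := q) else s y)"
  by (simp add: store_update_def)

section \<open>Rules for total correctness with a time bound\<close>

locale run_bound =
  fixes p :: real and n m :: nat and v :: "nat \<Rightarrow> nat set \<Rightarrow> rat" and Y :: nat
  assumes answers_bounded: "\<And>i S. i \<in> {1..n} \<Longrightarrow> S \<subseteq> {1..m} \<Longrightarrow>
      rat_size (v i S) \<le> Y"
    and n_le: "n + 10 \<le> Y" and m_le: "m + 10 \<le> Y"
begin

text \<open>The size bound is assumed and re-established inside the predicate, so invariants never
  mention it or the running time; an assignment merely owes the size of the value that it
  stores.\<close>

definition wp :: "com \<Rightarrow> (store \<Rightarrow> bool) \<Rightarrow> store \<Rightarrow> bool" where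
  "wp c Q s \<longleftrightarrow> (bounded_store Y s \<longrightarrow>
     (\<exists>t s'. exec p n m v c s t s' \<and> t \<le> poly (time_bound c) Y \<and> bounded_store Y s' \<and> Q s'))"

lemma wpD:
  assumes "wp c Q s" "bounded_store Y s"
  obtains t s' where "exec p n m v c s t s'" "t \<le> poly (time_bound c) Y" "bounded_store Y s'" "Q s'"
  using assms unfolding wp_def by blast

lemma wp_mono: "wp c Q s \<Longrightarrow> (\<And>s'. Q s' \<Longrightarrow> Q' s') \<Longrightarrow> wp c Q' s"
  unfolding wp_def by blast

lemma wp_frame:
  assumes "wp c Q s" "\<And>s'. Q s' \<Longrightarrow> (\<And>x. x \<notin> modified c \<Longrightarrow> s' x =
      s x) \<Longrightarrow> Q' s'"
  shows "wp c Q' s"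
  using assms exec_unmodified unfolding wp_def by metis

lemma wp_Skip: "Q s \<Longrightarrow> wp Skip Q s"
  unfolding wp_def using exec.Skip by fastforce

lemma wp_Assign:
  assumes "rat_size (aval e s) \<le> Y" "Q (store_update s x \<lfloor>aval i s\<rfloor> (aval e s))"
  shows "wp (Assign x i e) Q s"
  unfolding wp_def
proof (intro impI exI conjI)
  assume s: "bounded_store Y s"
  show "exec p n m v (Assign x i e) s (1 + acost i s + acost e s)
     (store_update s x \<lfloor>aval i s\<rfloor> (aval e s))" by (rule exec.Assign)
  show "1 + acost i s + acost e s \<le> poly (time_bound (Assign x i e)) Y"
    using acost_le[OF s, of i] acost_le[OF s, of e] by (simp add: algebra_simps)
qed (use assms bounded_store_update in auto)

lemma rat_size_answer: "rat_size (answer n v k (goods_of m a)) \<le> Y"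
proof (cases "1 \<le> k \<and> k \<le> int n")
  case True
  then have "nat k \<in> {1..n}" by auto
  then show ?thesis using answers_bounded[of "nat k" "goods_of m a"] True
    unfolding answer_def goods_of_def by (simp only: if_True simp_thms) blast
next
  case False
  then show ?thesis using m_le by (auto simp add: answer_def rat_size_def bitlen_alt_def)
qed

lemma wp_Query:
  assumes "Q (store_update s x 0 (answer n v \<lfloor>aval i s\<rfloor> (goods_of m (s a))))"
  shows "wp (Query x i a) Q s"
  unfolding wp_def
proof (intro impI exI conjI)
  let ?q = "answer n v \<lfloor>aval i s\<rfloor> (goods_of m (s a))"
  assume s: "bounded_store Y s"
  show "exec p n m v (Query x i a) s (1 + acost i s + m + rat_size ?q) (store_update s x 0 ?q)"
    by (rule exec.Query) simp
  show "1 + acost i s + m + rat_size ?q \<le> poly (time_bound (Query x i a)) Y"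
    using acost_le[OF s, of i] m_le rat_size_answer[of "\<lfloor>aval i s\<rfloor>" "s a"]
    by (simp add: algebra_simps)
  show "bounded_store Y (store_update s x 0 ?q)"
    using s rat_size_answer by (rule bounded_store_update)
qed (use assms in simp)

lemma wp_Approx:
  assumes "nat \<lfloor>aval e s\<rfloor> \<le> Y" "rat_size (truncated p (nat \<lfloor>aval e s\<rfloor>)) \<le> Y"
    "Q (store_update s x 0 (truncated p (nat \<lfloor>aval e s\<rfloor>)))"
  shows "wp (Approx x e) Q s"
  unfolding wp_def
proof (intro impI exI conjI)
  let ?k = "nat \<lfloor>aval e s\<rfloor>"
  assume s: "bounded_store Y s"
  show "exec p n m v (Approx x e) s (1 + acost e s + ?k + rat_size (truncated p ?k))
      (store_update s x 0 (truncated p ?k))"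
    by (rule exec.Approx) simp_all
  show "1 + acost e s + ?k + rat_size (truncated p ?k) \<le> poly (time_bound (Approx x e)) Y"
    using acost_le[OF s, of e] assms by (simp add: algebra_simps)
  show "bounded_store Y (store_update s x 0 (truncated p ?k))"
    using s assms(2) by (rule bounded_store_update)
qed (use assms in simp)

lemma wp_Seq:
  assumes "wp c (wp d Q) s"
  shows "wp (Seq c d) Q s"
  unfolding wp_def
proof
  assume "bounded_store Y s"
  with assms obtain t s' where 1: "exec p n m v c s t s'" "t \<le> poly (time_bound c) Y"
    "bounded_store Y s'" "wp d Q s'" by (rule wpD)
  from 1(4,3) obtain t' s'' where 2: "exec p n m v d s' t' s''" "t' \<le> poly (time_bound d) Y"
    "bounded_store Y s''" "Q s''" by (rule wpD)
  have "exec p n m v (Seq c d) s (1 + t + t') s''" using 1 2 exec.Seq by blast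
  moreover have "1 + t + t' \<le> poly (time_bound (Seq c d)) Y" using 1 2 by simp
  ultimately show "\<exists>t s'. exec p n m v (Seq c d) s t s' \<and> t \<le> poly (time_bound (Seq c d)) Y \<and>
      bounded_store Y s' \<and> Q s'" using 2 by blast
qed

lemma wp_If:
  assumes "bval b s \<Longrightarrow> wp c Q s" "\<not> bval b s \<Longrightarrow> wp d Q s"
  shows "wp (If b c d) Q s"
  unfolding wp_def
proof
  assume s: "bounded_store Y s"
  have b: "bcost b s \<le> bcost_coeff b * Y" using s by (rule bcost_le)
  show "\<exists>t s'. exec p n m v (If b c d) s t s' \<and> t \<le> poly (time_bound (If b c d)) Y \<and>
      bounded_store Y s' \<and> Q s'"
  proof (cases "bval b s")
    case True
    obtain t s' where 1: "exec p n m v c s t s'" "t \<le> poly (time_bound c) Y"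
      "bounded_store Y s'" "Q s'" using assms(1)[OF True] s by (rule wpD)
    have "exec p n m v (If b c d) s (1 + bcost b s + t) s'" using True 1 exec.IfTrue by blast
    moreover have "1 + bcost b s + t \<le> poly (time_bound (If b c d)) Y"
      using 1 b by (simp add: algebra_simps)
    ultimately show ?thesis using 1 by blast
  next
    case False
    obtain t s' where 1: "exec p n m v d s t s'" "t \<le> poly (time_bound d) Y"
      "bounded_store Y s'" "Q s'" using assms(2)[OF False] s by (rule wpD)
    have "exec p n m v (If b c d) s (1 + bcost b s + t) s'" using False 1 exec.IfFalse by blast
    moreover have "1 + bcost b s + t \<le> poly (time_bound (If b c d)) Y"
      using 1 b by (simp add: algebra_simps)
    ultimately show ?thesis using 1 by blast
  qed
qed

text \<open>The variant \<open>f\<close> yields termination and cost at once: it drops in every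
  iteration, so its initial value, at most \<open>Y\<close>, bounds their number.\<close>

lemma wp_While:
  fixes f :: "store \<Rightarrow> nat"
  assumes inv: "I s" and f: "f s \<le> Y"
    and body: "\<And>s. I s \<Longrightarrow> bval b s \<Longrightarrow> wp c (\<lambda>s'. I s' \<and> f s' < f s) s"
    and exit: "\<And>s. I s \<Longrightarrow> \<not> bval b s \<Longrightarrow> Q s"
  shows "wp (While b c) Q s"
proof -
  let ?C = "1 + bcost_coeff b * Y + poly (time_bound c) Y"
  have "\<exists>t s'. exec p n m v (While b c) s t s' \<and> t \<le> (1 + f s) * ?C \<and> bounded_store Y s' \<and> Q s'"
    if "I s" "bounded_store Y s" for s
    using that
  proof (induction "f s" arbitrary: s rule: less_induct)
    case less
    have b: "bcost b s \<le> bcost_coeff b * Y" using less.prems(2) by (rule bcost_le)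
    show ?case
    proof (cases "bval b s")
      case True
      obtain t s' where 1: "exec p n m v c s t s'" "t \<le> poly (time_bound c) Y"
        "bounded_store Y s'" "I s' \<and> f s' < f s"
        using body[OF less.prems(1) True] less.prems(2) by (rule wpD)
      obtain t' s'' where 2: "exec p n m v (While b c) s' t' s''" "t' \<le> (1 + f s') * ?C"
        "bounded_store Y s''" "Q s''" using less.hyps[of s'] 1 by blast
      have "exec p n m v (While b c) s (1 + bcost b s + t + t') s''"
        using True 1 2 exec.WhileTrue by blast
      moreover have "1 + bcost b s + t + t' \<le> ?C + (1 + f s') * ?C" using 1 2 b by linarith
      moreover have "?C + (1 + f s') * ?C = (1 + Suc (f s')) * ?C" by simp
      moreover have "(1 + Suc (f s')) * ?C \<le> (1 + f s) * ?C" using 1 by (intro mult_right_mono) auto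
      ultimately have "1 + bcost b s + t + t' \<le> (1 + f s) * ?C" by linarith
      with \<open>exec p n m v (While b c) s (1 + bcost b s + t + t') s''\<close> 2 show ?thesis by blast
    next
      case False
      have "exec p n m v (While b c) s (1 + bcost b s) s" using False by (rule exec.WhileFalse)
      moreover have "1 + bcost b s \<le> (1 + f s) * ?C" using b by simp
      ultimately show ?thesis using exit[OF less.prems(1) False] less.prems(2) by blast
    qed
  qed
  moreover have "(1 + f s) * ?C \<le> poly (time_bound (While b c)) Y"
  proof -
    have "(1 + f s) * ?C \<le> (1 + Y) * ?C" using f by (intro mult_right_mono) auto
    then show ?thesis by (simp add: algebra_simps)
  qed
  ultimately show ?thesis using inv unfolding wp_def by (meson order_trans)
qed

text \<open>The counter is passed to \<open>I\<close> as the argument \<open>j\<close>, and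
  \<open>stable\<close> says that \<open>I\<close> ignores its cell in the store. The limit
  \<open>e\<close> has to evaluate to \<open>b\<close> in all stores that agree with
  \<open>s0\<close> off the variables of the loop, and \<open>b + 2\<close> leaves room for the size
  of the final counter. Where the rule is used with \<open>goal_cases\<close>, case 3 is the limit,
  case 7 the body and case 8 the exit.\<close>

lemma wp_For:
  assumes inv: "I a s0"
    and stable: "\<And>j s q. I j s \<Longrightarrow> I j (store_update s x 0 q)"
    and bound: "\<And>s. (\<And>y. y \<noteq> x \<Longrightarrow> y \<notin> modified c \<Longrightarrow> s y =
        s0 y) \<Longrightarrow> aval e s = of_nat b"
    and ab: "a \<le> b" "b + 2 \<le> Y" and x: "x \<notin> modified c"
    and body: "\<And>j s. a \<le> j \<Longrightarrow> j < b \<Longrightarrow> I j s \<Longrightarrow> s x 0 =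
        of_nat j \<Longrightarrow>
      (\<And>y. y \<noteq> x \<Longrightarrow> y \<notin> modified c \<Longrightarrow> s y = s0 y) \<Longrightarrow>
        wp c (I (Suc j)) s"
    and exit: "\<And>s. I b s \<Longrightarrow> (\<And>y. y \<noteq> x \<Longrightarrow>
        y \<notin> modified c \<Longrightarrow> s y = s0 y) \<Longrightarrow> Q s"
  shows "wp (For x a e c) Q s0"
  unfolding For_def
proof (intro wp_Seq wp_Assign)
  let ?s = "store_update s0 x \<lfloor>aval (Const 0) s0\<rfloor> (aval (Const (of_nat a)) s0)"
  let ?I = "\<lambda>s. \<exists>j. a \<le> j \<and> j \<le> b \<and> I j s \<and> s x 0 = of_nat j \<and>
      (\<forall>y. y \<noteq> x \<longrightarrow> y \<notin> modified c \<longrightarrow> s y = s0 y)"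
  show "rat_size (aval (Const (of_nat a)) s0) \<le> Y"
    using rat_size_of_nat[of a] ab by simp
  show "wp (While (Less (var x) e) (c ;; put x (Plus (var x) (Const 1)))) Q ?s"
  proof (rule wp_While[where I = ?I and f = "\<lambda>s. b - nat \<lfloor>s x 0\<rfloor>"])
    show "?I ?s" using stable[OF inv, of "of_nat a"] ab
      by (intro exI[of _ a]) (auto simp: store_update_def)
    show "b - nat \<lfloor>?s x 0\<rfloor> \<le> Y" using ab by simp
  next
    fix s assume "?I s" and less: "bval (Less (var x) e) s"
    then obtain j where j: "a \<le> j" "j \<le> b" "I j s" "s x 0 = of_nat j"
      and fr: "\<And>y. y \<noteq> x \<Longrightarrow> y \<notin> modified c \<Longrightarrow> s y = s0 y" by blast
    have jb: "j < b" using less bound[OF fr] j by simp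
    show "wp (c ;; put x (Plus (var x) (Const 1)))
        (\<lambda>s'. ?I s' \<and> b - nat \<lfloor>s' x 0\<rfloor> < b - nat \<lfloor>s x 0\<rfloor>) s"
    proof (rule wp_Seq, rule wp_frame[OF body[OF j(1) jb j(3,4) fr]])
      fix s' assume I': "I (Suc j) s'" and fr': "\<And>y. y \<notin> modified c \<Longrightarrow> s' y = s y"
      have x': "s' x 0 = of_nat j" using fr' x j by simp
      have eq: "rat_of_nat j + 1 = of_nat (Suc j)" by simp
      show "wp (put x (Plus (var x) (Const 1)))
          (\<lambda>s'. ?I s' \<and> b - nat \<lfloor>s' x 0\<rfloor> < b - nat \<lfloor>s x 0\<rfloor>) s'"
      proof (rule wp_Assign)
        show "rat_size (aval (Plus (var x) (Const 1)) s') \<le> Y"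
          using rat_size_of_nat[of "Suc j"] jb ab by (simp add: x' eq del: of_nat_Suc)
        let ?s = "store_update s' x \<lfloor>aval (Const 0) s'\<rfloor> (aval (Plus (var x) (Const 1)) s')"
        have x'': "?s x 0 = of_nat (Suc j)" by (simp add: x' store_update_def)
        have "?I ?s"
        proof (intro exI[of _ "Suc j"] conjI)
          show "I (Suc j) ?s" using stable[OF I'] by simp
        qed (use fr fr' x'' j jb in \<open>auto simp: store_update_def\<close>)
        moreover have "b - nat \<lfloor>?s x 0\<rfloor> < b - nat \<lfloor>s x 0\<rfloor>"
          unfolding x'' j(4) floor_of_nat using jb by linarith
        ultimately show "?I ?s \<and> b - nat \<lfloor>?s x 0\<rfloor> < b - nat \<lfloor>s x 0\<rfloor>" ..
      qed
    qed auto
  next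
    fix s assume "?I s" and nless: "\<not> bval (Less (var x) e) s"
    then obtain j where j: "a \<le> j" "j \<le> b" "I j s" "s x 0 = of_nat j"
      and fr: "\<And>y. y \<noteq> x \<Longrightarrow> y \<notin> modified c \<Longrightarrow> s y = s0 y" by blast
    have "j = b" using nless bound[OF fr] j by simp
    then show "Q s" using exit j(3) fr by blast
  qed
qed

end

section \<open>Values of single goods and of low goods\<close>

definition index :: "vname \<Rightarrow> aexp" where
  "index x = Plus (Times (var ''i'') (var ''m'')) (var x)"

definition idx :: "nat \<Rightarrow> nat \<Rightarrow> nat \<Rightarrow> int" where
  "idx m i g = int (i * m + g)"

text \<open>Goods are numbered from 1, so \<open>g - 1\<close> is the remainder and \<open>i\<close>
  the quotient of the shifted index modulo \<open>m\<close>.\<close>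

lemma idx_eq_iff:
  assumes "g \<in> {1..m}" "h \<in> {1..m}"
  shows "idx m i g = idx m j h \<longleftrightarrow> i = j \<and> g = h"
proof
  assume "idx m i g = idx m j h"
  then have eq: "i * m + g = j * m + h" by (simp only: idx_def of_nat_eq_iff)
  have gm: "g - 1 < m" "h - 1 < m" using assms by auto
  have eq': "i * m + (g - 1) = j * m + (h - 1)" using eq assms by auto
  have "(i * m + (g - 1)) div m = i" "(j * m + (h - 1)) div m = j" using gm by auto
  then have "i = j" using eq' by metis
  then show "i = j \<and> g = h" using eq by simp
qed simp

lemma floor_index:
  assumes "s ''i'' 0 = of_nat i" "s ''m'' 0 = of_nat m" "s x 0 = of_nat g"
  shows "\<lfloor>aval (index x) s\<rfloor> = idx m i g"
proof -
  have "aval (index x) s = of_nat (i * m + g)" using assms by (simp add: index_def)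
  then show ?thesis unfolding idx_def by (simp only: floor_of_nat)
qed

text \<open>
  The programs below use the following arrays, where a pair of an agent \<open>i\<close> and a good \<open>g\<close> has index
  \<open>i * m + g\<close>: \<open>S\<close> values of single goods, \<open>V\<close> values of low goods, \<open>G\<close> flags for positive potentials, \<open>E\<close> cost
  exponents, \<open>F\<close> weights as a function of the exponent, \<open>P\<close> prices, \<open>Q\<close> target profits, \<open>A\<close> goods of agents
  (\<open>0\<close> if none), \<open>C\<close> values secured by agents, \<open>R\<close> values of the unmatched goods, \<open>T\<close> and \<open>X\<close> query sets.
  Goods without an owner have \<open>owner\<close> \<open>0\<close>.
\<close>

definition singles_com :: com where
  "singles_com =
     For ''g'' 1 (Plus (var ''m'') (Const 1)) (
       Assign ''T'' (var ''g'') (Const 1) ;;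
       Query ''y'' (var ''i'') ''T'' ;;
       Assign ''S'' (index ''g'') (var ''y'') ;;
       Assign ''T'' (var ''g'') (Const 0))"

text \<open>Ties are broken by index so that exactly \<open>min n m\<close> goods have rank below \<open>n\<close>.\<close>

definition rank_com :: com where
  "rank_com =
     For ''g'' 1 (Plus (var ''m'') (Const 1)) (
       put ''r'' (Const 0) ;;
       For ''h'' 1 (Plus (var ''m'') (Const 1))
         (If (And (Not (Less (Cell ''S'' (index ''h'')) (Cell ''S'' (index ''g''))))
               (Not (And (Not (Less (Cell ''S'' (index ''g'')) (Cell ''S'' (index ''h''))))
                         (Not (Less (var ''h'') (var ''g''))))))
           (put ''r'' (Plus (var ''r'') (Const 1)))
           Skip) ;;
       If (Less (var ''r'') (var ''n''))
         (Assign ''X'' (var ''g'') (Const 0))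
         (Assign ''X'' (var ''g'') (Const 1)))"

definition values_com :: com where
  "values_com =
     For ''i'' 1 (Plus (var ''n'') (Const 1))
       (singles_com ;; rank_com ;; Query ''y'' (var ''i'') ''X'' ;; Assign ''V'' (var ''i'') (var ''y''))"

definition rank :: "nat \<Rightarrow> (nat \<Rightarrow> rat) \<Rightarrow> nat \<Rightarrow> nat" where
  "rank m f g = card {h \<in> {1..m}. f g < f h \<or> f g = f h \<and> h < g}"

definition low_goods :: "nat \<Rightarrow> nat \<Rightarrow> (nat \<Rightarrow> rat) \<Rightarrow> nat set" where
  "low_goods n m f = {g \<in> {1..m}. n \<le> rank m f g}"

lemma rat_size_0 [simp]: "rat_size 0 = 2" and rat_size_1 [simp]: "rat_size 1 = 3"
  by (simp_all add: rat_size_def bitlen_alt_def)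

context run_bound
begin

definition sizes :: "store \<Rightarrow> bool" where
  "sizes s \<longleftrightarrow> s ''n'' 0 = of_nat n \<and> s ''m'' 0 = of_nat m"

lemma const_bounds: "2 \<le> Y" "3 \<le> Y"
  using n_le by simp_all

text \<open>Clearing the cell of \<open>T\<close> after each query keeps \<open>T\<close> empty
  between queries, so every query is about a singleton. The rows of other agents in \<open>S\<close>
  survive, which the loop over the agents needs.\<close>

lemma wp_singles:
  assumes sz: "sizes s" and i: "s ''i'' 0 = of_nat i" "i \<in> {1..n}"
    and T: "\<forall>g\<in>{1..m}. s ''T'' (int g) = 0"
  shows "wp singles_com (\<lambda>s'. (\<forall>g\<in>{1..m}. s' ''T'' (int g) = 0) \<and>
    (\<forall>i'. \<forall>g\<in>{1..m}. s' ''S'' (idx m i' g) = (if i' = i then v i {g} else s ''S'' (idx m i' g)))) s"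
  unfolding singles_com_def
proof (rule wp_For[where b = "m + 1" and I = "\<lambda>j s'. (\<forall>g\<in>{1..m}. s' ''T'' (int g) = 0) \<and>
    (\<forall>i'. \<forall>g\<in>{1..m}. s' ''S'' (idx m i' g) =
       (if i' = i \<and> g < j then v i {g} else s ''S'' (idx m i' g)))"], goal_cases)
  case (7 j s')
  have n: "s' ''n'' 0 = of_nat n" "s' ''m'' 0 = of_nat m" "s' ''i'' 0 = of_nat i"
    using 7(5)[of "''n''"] 7(5)[of "''m''"] 7(5)[of "''i''"] sz i by (simp_all add: sizes_def)
  have j: "j \<in> {1..m}" using 7 by auto
  have *: "rat_size (v i {j}) \<le> Y" using answers_bounded i j by auto
  show ?case
  proof (intro wp_Seq wp_Assign wp_Query, goal_cases)
    case 2
    have "goods_of m (store_update s' ''T'' (int j) 1 ''T'') = {j}"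
      using 7(3) j by (auto simp: goods_of_def)
    then show ?case using * i n 7 by (simp add: answer_def)
  next
    case 4
    have "goods_of m (store_update s' ''T'' (int j) 1 ''T'') = {j}"
      using 7(3) j by (auto simp: goods_of_def)
    then show ?case using * i n 7 j
      by (auto simp add: answer_def floor_index idx_eq_iff less_Suc_eq)
  qed (use const_bounds in simp_all)
qed (use sz T m_le in \<open>auto simp: sizes_def\<close>)

text \<open>The inner loop accumulates in \<open>r\<close> the size of the set defining the rank,
  cut off at the loop variable. Afterwards \<open>X\<close> is the characteristic array of the low
  goods, so that one query returns their joint value.\<close>

lemma wp_rank:
  assumes sz: "sizes s" and i: "s ''i'' 0 = of_nat i" "i \<in> {1..n}"
    and S: "\<forall>g\<in>{1..m}. s ''S'' (idx m i g) = f g"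
  shows "wp rank_com (\<lambda>s'. \<forall>g\<in>{1..m}. s' ''X'' (int g) = (if rank m f g < n then 0 else 1)) s"
  unfolding rank_com_def
proof (rule wp_For[where b = "m + 1" and I = "\<lambda>j s'. \<forall>g\<in>{1..m}. g < j \<longrightarrow>
    s' ''X'' (int g) = (if rank m f g < n then 0 else 1)"], goal_cases)
  case (7 j s')
  have n: "s' ''n'' 0 = of_nat n" "s' ''m'' 0 = of_nat m" "s' ''i'' 0 = of_nat i" "s' ''S'' = s ''S''"
    using 7(5)[of "''n''"] 7(5)[of "''m''"] 7(5)[of "''i''"] 7(5)[of "''S''"] sz i
    by (simp_all add: sizes_def)
  have j: "j \<in> {1..m}" using 7 by auto
  let ?R = "\<lambda>k. {h \<in> {1..m}. (f j < f h \<or> f j = f h \<and> h < j) \<and> h < k}"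
  show ?case
  proof (intro wp_Seq wp_Assign, goal_cases)
    case 2
    show ?case
    proof (rule wp_For[where b = "m + 1" and I = "\<lambda>k t. t ''r'' 0 = of_nat (card (?R k))"], goal_cases)
      case (7 k t)
      have k: "k \<in> {1..m}" using 7 by auto
      have eq: "t ''n'' 0 = of_nat n" "t ''m'' 0 = of_nat m" "t ''i'' 0 = of_nat i" "t ''S'' = s ''S''"
        "t ''g'' 0 = of_nat j"
        using 7(5)[of "''n''"] 7(5)[of "''m''"] 7(5)[of "''i''"] 7(5)[of "''S''"] 7(5)[of "''g''"]
          n \<open>s' ''g'' 0 = of_nat j\<close> by simp_all
      have ix: "\<lfloor>aval (index ''g'') t\<rfloor> = idx m i j" "\<lfloor>aval (index ''h'') t\<rfloor> = idx m i k"
        using eq 7(4) by (simp_all add: floor_index)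
      have le: "card (?R (Suc k)) \<le> card {1..m}" by (intro card_mono) auto
      show ?case
      proof (intro wp_If, goal_cases)
        case 1
        then have "f j < f k \<or> f j = f k \<and> k < j"
          using S j k by (auto simp: eq 7(4) ix)
        then have "?R (Suc k) = insert k (?R k)" using k by (auto simp: less_Suc_eq)
        moreover have "k \<notin> ?R k" by simp
        ultimately have *: "card (?R (Suc k)) = Suc (card (?R k))" by (simp del: atLeastAtMost_iff)
        show ?case
        proof (intro wp_Assign, goal_cases)
          case 1
          show ?case using rat_size_of_nat[of "card (?R (Suc k))"] le m_le 7 unfolding *
            by (simp add: add.commute)
        next
          case 2
          show ?case using 7 unfolding * by simp
        qed
      next
        case 2
        then have "\<not> (f j < f k \<or> f j = f k \<and> k < j)"
          using S j k by (auto simp: eq 7(4) ix)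
        then have "?R (Suc k) = ?R k" using k by (auto simp: less_Suc_eq)
        then show ?case using 7 by (intro wp_Skip) simp
      qed
    next
      case (8 t)
      have eq: "t ''n'' 0 = of_nat n" "t ''g'' 0 = of_nat j" "t ''X'' = s' ''X''"
        using 8(2)[of "''n''"] 8(2)[of "''g''"] 8(2)[of "''X''"] n \<open>s' ''g'' 0 = of_nat j\<close> by simp_all
      have "?R (m + 1) = {h \<in> {1..m}. f j < f h \<or> f j = f h \<and> h < j}" by auto
      then have r: "t ''r'' 0 = of_nat (rank m f j)" using 8(1) unfolding rank_def by metis
      show ?case
        by (intro wp_If wp_Assign) (use const_bounds 7(3) j in \<open>auto simp: eq r less_Suc_eq\<close>)
    qed (use n m_le in auto)
  qed (use const_bounds in simp_all)
qed (use sz m_le in \<open>auto simp: sizes_def\<close>)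

lemma wp_values:
  assumes sz: "sizes s" and T: "\<forall>g\<in>{1..m}. s ''T'' (int g) = 0"
  shows "wp values_com (\<lambda>s'. \<forall>i\<in>{1..n}.
    (\<forall>g\<in>{1..m}. s' ''S'' (idx m i g) = v i {g}) \<and>
    s' ''V'' (int i) = v i (low_goods n m (\<lambda>g. v i {g}))) s"
  unfolding values_com_def
proof (rule wp_For[where b = "n + 1" and I = "\<lambda>j s'. (\<forall>g\<in>{1..m}. s' ''T'' (int g) = 0) \<and>
    (\<forall>i\<in>{1..n}. i < j \<longrightarrow> (\<forall>g\<in>{1..m}. s' ''S'' (idx m i g) = v i {g}) \<and>
    s' ''V'' (int i) = v i (low_goods n m (\<lambda>g. v i {g})))"], goal_cases)
  case (7 j s')
  have n: "sizes s'" using 7(5)[of "''n''"] 7(5)[of "''m''"] sz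
    by (simp add: sizes_def singles_com_def rank_com_def)
  have j: "j \<in> {1..n}" using 7 by auto
  show ?case
  proof (intro wp_Seq, rule wp_frame[OF wp_singles[OF n 7(4) j]], goal_cases)
    case (2 s1)
    have s1: "sizes s1" "s1 ''i'' 0 = of_nat j" "s1 ''V'' = s' ''V''"
      using 2(2)[of "''n''"] 2(2)[of "''m''"] 2(2)[of "''i''"] 2(2)[of "''V''"] n 7(4)
      by (simp_all add: singles_com_def sizes_def)
    show ?case
    proof (intro wp_Seq, rule wp_frame[OF wp_rank[OF s1(1,2) j, of "\<lambda>g. v j {g}"]], goal_cases)
      case (2 s2)
      have s2: "s2 ''i'' 0 = of_nat j" "s2 ''V'' = s1 ''V''" "s2 ''T'' = s1 ''T''" "s2 ''S'' = s1 ''S''"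
        using 2(2)[of "''i''"] 2(2)[of "''V''"] 2(2)[of "''T''"] 2(2)[of "''S''"] s1
        by (simp_all add: rank_com_def)
      have "goods_of m (s2 ''X'') = low_goods n m (\<lambda>g. v j {g})"
        using 2(1) by (auto simp: goods_of_def low_goods_def not_less split: if_splits)
      then have a: "answer n v (int j) (goods_of m (s2 ''X'')) = v j (low_goods n m (\<lambda>g. v j {g}))"
        using j by (simp add: answer_def)
      have "rat_size (v j (low_goods n m (\<lambda>g. v j {g}))) \<le> Y"
        using j by (intro answers_bounded) (auto simp: low_goods_def)
      then show ?case
        using \<open>(\<forall>g\<in>{1..m}. s1 ''T'' (int g) = 0) \<and> _\<close> 7(3) j
        by (intro wp_Seq wp_Query wp_Assign) (auto simp: s1 s2 a less_Suc_eq)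
    qed (use 2 in simp)
  qed (use 7 in simp)
qed (use sz T n_le in \<open>auto simp: sizes_def singles_com_def rank_com_def\<close>)

end

section \<open>Logarithmic costs of potentials\<close>

definition gam :: "nat \<Rightarrow> rat" where
  "gam G = 1 + 1 / of_nat G"

definition level :: "nat \<Rightarrow> rat \<Rightarrow> int" where
  "level G u = \<lfloor>log (real_of_rat (gam G)) (real_of_rat u)\<rfloor>"

text \<open>With \<open>l * l\<close> digits the truncation error of \<open>p\<close> is at most
  \<open>1 / 2 ^ (l * l)\<close>; after multiplication by \<open>l\<close> it is still at most 1.
  The square is a nonnegative integer obtained without an absolute value, and its unary charge is
  polynomial.\<close>

definition cost_exponent :: "real \<Rightarrow> rat \<Rightarrow> rat \<Rightarrow> int \<Rightarrow> int" where
  "cost_exponent p a b l = \<lfloor>(a * truncated p (nat (l * l)) + b) * of_int l\<rfloor>"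

lemma gam_gt_1: "G \<ge> 1 \<Longrightarrow> gam G > 1"
  by (simp add: gam_def)

lemma gam_power_ge_2: "G \<ge> 1 \<Longrightarrow> gam G ^ G \<ge> 2"
  using Bernoulli_inequality[of "1 / rat_of_nat G" G]
    order_trans[of "- 1" 0 "1 / rat_of_nat G"] by (simp add: gam_def)

lemma of_rat_power_int: "real_of_rat (q powi k) = real_of_rat q powi k"
  by (simp add: power_int_def of_rat_power of_rat_inverse)

lemma level_eqI:
  assumes G: "G \<ge> 1" and u: "gam G powi l \<le> u" "u < gam G powi (l + 1)"
  shows "level G u = l"
proof -
  let ?g = "real_of_rat (gam G)"
  have g: "?g > 1" using gam_gt_1[OF G] by simp
  have pos: "u > 0" using u(1) gam_gt_1[OF G] zero_less_power_int[of "gam G" l] by linarith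
  have "real_of_rat (gam G powi l) \<le> of_rat u" "real_of_rat u < real_of_rat (gam G powi (l + 1))"
    using u by (simp_all only: of_rat_less_eq of_rat_less)
  then have "?g powr l \<le> of_rat u" "of_rat u < ?g powr (l + 1)"
    using g powr_real_of_int'[of ?g l] powr_real_of_int'[of ?g "l + 1"]
    by (simp_all only: of_rat_power_int) auto
  then show ?thesis unfolding level_def using g pos by (subst floor_log_eq_powr_iff) simp_all
qed

text \<open>A number of \<open>b\<close> bits is below \<open>2 ^ b\<close>, at most
  \<open>(gam G ^ G) ^ b\<close>, and its inverse has no more bits. Hence its level is at most
  \<open>G * b\<close> in absolute value and can be reached by single steps.\<close>

lemma gam_power_int_bounds:
  assumes G: "G \<ge> 1" and u: "u > 0" "rat_size u \<le> b"
  shows "u < gam G powi (int (G * b))" "gam G powi (- int (G * b)) < u"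
proof -
  have *: "w < gam G ^ (G * b)" if "rat_size w \<le> b" for w
  proof -
    have "w < 2 ^ rat_size w" by (rule rat_less_two_power_size)
    also have "\<dots> \<le> 2 ^ b" using that by (intro power_increasing) auto
    also have "\<dots> \<le> (gam G ^ G) ^ b" using gam_power_ge_2[OF G] by (intro power_mono) auto
    finally show ?thesis by (simp add: power_mult)
  qed
  show "u < gam G powi (int (G * b))" using *[OF u(2)] by (simp only: power_int_of_nat)
  have "inverse u < gam G ^ (G * b)" using * rat_size_inverse[of u] u(2) by (meson order_trans)
  then have "inverse (gam G ^ (G * b)) < inverse (inverse u)"
    using u(1) by (intro less_imp_inverse_less) auto
  then show "gam G powi (- int (G * b)) < u"
    by (simp only: power_int_minus power_int_of_nat inverse_inverse_eq)
qed

lemma rat_size_power_int: "rat_size (q powi k) \<le> 3 + nat \<bar>k\<bar> * rat_size q"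
proof (cases "k \<ge> 0")
  case True
  then show ?thesis using rat_size_power[of q "nat k"] by (simp add: power_int_def)
next
  case False
  have "rat_size (inverse q ^ nat (- k)) \<le> 3 + nat (- k) * rat_size (inverse q)"
    by (rule rat_size_power)
  also have "\<dots> \<le> 3 + nat (- k) * rat_size q" using rat_size_inverse[of q] by simp
  finally show ?thesis using False by (simp add: power_int_def)
qed

lemma truncated_bounds: "real_of_rat (truncated p k) \<le> p" "p < real_of_rat (truncated p k) + 1 / 2 ^ k"
proof -
  have t: "real_of_rat (truncated p k) = \<lfloor>p * 2 ^ k\<rfloor> / 2 ^ k"
    by (simp add: truncated_def of_rat_divide of_rat_power)
  show "real_of_rat (truncated p k) \<le> p" unfolding t by (simp add: pos_divide_le_eq)
  have "p * 2 ^ k < \<lfloor>p * 2 ^ k\<rfloor> + 1" by linarith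
  then have "p < (\<lfloor>p * 2 ^ k\<rfloor> + 1) / 2 ^ k" by (simp add: pos_less_divide_eq)
  then show "p < real_of_rat (truncated p k) + 1 / 2 ^ k" unfolding t by (simp add: add_divide_distrib)
qed

lemma rat_size_truncated:
  assumes "\<bar>p\<bar> + 1 \<le> 2 ^ j"
  shows "rat_size (truncated p k) \<le> 2 * k + j + 3"
proof -
  have "\<bar>\<lfloor>p * 2 ^ k\<rfloor>\<bar> \<le> \<bar>p * 2 ^ k\<bar> + 1" by linarith
  also have "\<dots> = \<bar>p\<bar> * 2 ^ k + 1" by (simp add: abs_mult)
  also have "\<dots> \<le> (\<bar>p\<bar> + 1) * 2 ^ k" by (simp add: algebra_simps)
  also have "\<dots> \<le> 2 ^ j * 2 ^ k" using assms by (intro mult_right_mono) auto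
  also have "\<dots> < 2 ^ (j + k + 1)" by (simp add: power_add)
  finally have "real_of_int \<bar>\<lfloor>p * 2 ^ k\<rfloor>\<bar> < real_of_int (2 ^ (j + k + 1))" by simp
  then have "\<bar>\<lfloor>p * 2 ^ k\<rfloor>\<bar> < 2 ^ (j + k + 1)" by (simp only: of_int_less_iff)
  then have "rat_size (truncated p k) \<le> 1 + (j + k + 1) + (k + 1)"
    by (intro rat_size_fraction[of "2 ^ k" "\<lfloor>p * 2 ^ k\<rfloor>"]) (simp_all add: truncated_def)
  then show ?thesis by simp
qed

lemma cost_exponent_bound:
  assumes p: "\<bar>p\<bar> + 1 \<le> 2 ^ j" and ab: "\<bar>a\<bar> \<le> 1" "\<bar>b\<bar> \<le>
      1" and l: "\<bar>l\<bar> \<le> int L"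
  shows "\<bar>cost_exponent p a b l\<bar> \<le> int ((2 ^ j + 1) * L + 1)"
proof -
  let ?t = "truncated p (nat (l * l))"
  have "1 / 2 ^ nat (l * l) \<le> (1::real)" by (simp add: divide_le_eq)
  then have "\<bar>real_of_rat ?t\<bar> \<le> 2 ^ j" using truncated_bounds[where p = p and k = "nat (l * l)"] p by linarith
  then have "real_of_rat \<bar>?t\<bar> \<le> real_of_rat (2 ^ j)" by (simp add: of_rat_power)
  then have t: "\<bar>?t\<bar> \<le> 2 ^ j" by (simp only: of_rat_less_eq)
  have "\<bar>a * ?t + b\<bar> \<le> \<bar>a\<bar> * \<bar>?t\<bar> + \<bar>b\<bar>" by (metis abs_mult abs_triangle_ineq)
  also have "\<dots> \<le> 1 * 2 ^ j + 1" using t ab by (intro add_mono mult_mono) auto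
  finally have "\<bar>a * ?t + b\<bar> \<le> 2 ^ j + 1" by simp
  then have "\<bar>a * ?t + b\<bar> * \<bar>of_int l\<bar> \<le> (2 ^ j + 1) * of_int (int L)"
    using l by (intro mult_mono) (auto simp flip: of_int_abs simp del: of_int_of_nat_eq)
  then have *: "\<bar>(a * ?t + b) * of_int l\<bar> \<le> of_int (int ((2 ^ j + 1) * L))"
    by (simp only: abs_mult of_nat_mult of_int_of_nat_eq) (simp add: add.commute)
  have "\<bar>\<lfloor>x\<rfloor>\<bar> \<le> K + 1" if "\<bar>x\<bar> \<le> of_int K" for x :: rat and K :: int
    using that by linarith
  from this[OF *] show ?thesis unfolding cost_exponent_def by simp
qed

text \<open>A linear search through the exact powers of \<open>gam G\<close>, starting from 1: the
  first loop descends to some power that is at most \<open>u\<close>, the second climbs to the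
  largest such power.\<close>

definition level_com :: "nat \<Rightarrow> com" where
  "level_com G =
     (put ''t'' (Const 1) ;; put ''l'' (Const 0) ;;
      While (Less (var ''u'') (var ''t''))
        (put ''t'' (Divide (var ''t'') (Const (gam G))) ;; put ''l'' (Minus (var ''l'') (Const 1))) ;;
      While (Not (Less (var ''u'') (Times (var ''t'') (Const (gam G)))))
        (put ''t'' (Times (var ''t'') (Const (gam G))) ;; put ''l'' (Plus (var ''l'') (Const 1))))"

text \<open>Besides storing the exponent, this maintains the least exponent in \<open>w\<close>,
  with \<open>f\<close> telling whether \<open>w\<close> has been set, and a bound for all absolute
  values in \<open>b\<close>. The latter is the largest square: the language has no absolute value,
  and integers satisfy \<open>abs e <= e * e\<close>.\<close>

definition record_com :: com where
  "record_com =
     (Assign ''E'' (index ''g'') (var ''e'') ;;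
      Assign ''G'' (index ''g'') (Const 1) ;;
      If (And (Less (Const 0) (var ''f'')) (Not (Less (var ''e'') (var ''w''))))
        Skip
        (put ''w'' (var ''e'') ;; put ''f'' (Const 1)) ;;
      If (Less (var ''b'') (Times (var ''e'') (var ''e'')))
        (put ''b'' (Times (var ''e'') (var ''e'')))
        Skip)"

definition exponent_com :: "nat \<Rightarrow> rat \<Rightarrow> rat \<Rightarrow> com" where
  "exponent_com G a b =
     (put ''u'' (Plus (Times (var ''n'') (Cell ''S'' (index ''g''))) (Cell ''V'' (var ''i''))) ;;
      If (Less (Const 0) (var ''u''))
        (level_com G ;;
         Approx ''a'' (Times (var ''l'') (var ''l'')) ;;
         put ''e'' (Floor (Times (Plus (Times (Const a) (var ''a'')) (Const b)) (var ''l''))) ;;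
         record_com)
        (Assign ''G'' (index ''g'') (Const 0)))"

definition exponents_com :: "nat \<Rightarrow> rat \<Rightarrow> rat \<Rightarrow> com" where
  "exponents_com G a b =
     (put ''f'' (Const 0) ;; put ''b'' (Const 0) ;; put ''w'' (Const 0) ;;
      For ''i'' 1 (Plus (var ''n'') (Const 1))
        (For ''g'' 1 (Plus (var ''m'') (Const 1)) (exponent_com G a b)))"

context run_bound
begin

definition low_value :: "nat \<Rightarrow> rat" where
  "low_value i = v i (low_goods n m (\<lambda>g. v i {g}))"

definition potential :: "nat \<Rightarrow> nat \<Rightarrow> rat" where
  "potential i g = of_nat n * v i {g} + low_value i"

lemma rat_size_potential:
  assumes "\<And>i S. i \<in> {1..n} \<Longrightarrow> S \<subseteq> {1..m} \<Longrightarrow> rat_size (v i S) \<le>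
      L" "i \<in> {1..n}" "g \<in> {1..m}"
  shows "rat_size (potential i g) \<le> 2 * n + 4 * L + 4"
proof -
  have "rat_size (v i {g}) \<le> L" "rat_size (low_value i) \<le> L"
    unfolding low_value_def low_goods_def by (rule assms(1), use assms in auto)+
  moreover have "rat_size (of_nat n * v i {g}) \<le> n + 2 + rat_size (v i {g})"
    using rat_size_mult[of "of_nat n" "v i {g}"] rat_size_of_nat[of n] by simp
  ultimately show ?thesis unfolding potential_def
    using rat_size_add[of "of_nat n * v i {g}" "low_value i"] by simp
qed

lemma wp_level:
  assumes G: "G \<ge> 1" and s: "s ''u'' 0 = u" and u: "u > 0" "rat_size u \<le> b"
    and Y: "3 + G * b * rat_size (gam G) \<le> Y" "2 * (G * b) + 2 \<le> Y"
  shows "wp (level_com G) (\<lambda>s'. s' ''l'' 0 = of_int (level G u) \<and> \<bar>level G u\<bar> \<le> int (G * b)) s"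
proof -
  let ?L = "int (G * b)"
  note g = gam_gt_1[OF G]
  note ub = gam_power_int_bounds[OF G u]
  have t_size: "rat_size (gam G powi l) \<le> Y" if "\<bar>l\<bar> \<le> ?L" for l
  proof -
    have "rat_size (gam G powi l) \<le> 3 + nat \<bar>l\<bar> * rat_size (gam G)" by (rule rat_size_power_int)
    also have "\<dots> \<le> 3 + G * b * rat_size (gam G)" using that
      by (intro add_left_mono mult_right_mono) (simp_all add: nat_le_iff)
    finally show ?thesis using Y by simp
  qed
  have l_size: "rat_size (of_int l) \<le> Y" if "\<bar>l\<bar> \<le> ?L" for l
    using rat_size_of_int[of l] that Y by linarith
  have less: "l < k" if "gam G powi l < gam G powi k" for l k
    using that g by (metis linorder_not_less less_imp_le power_int_increasing)
  have down: "gam G powi l / gam G = gam G powi (l - 1)" for l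
    using g by (simp add: power_int_diff)
  have up: "gam G powi l * gam G = gam G powi (l + 1)" for l
    using g by (simp add: power_int_add)
  let ?I = "\<lambda>l s. s ''u'' 0 = u \<and> s ''l'' 0 = of_int l \<and> s ''t'' 0 = gam G powi l"
  have wp2: "wp (While (Not (Less (var ''u'') (Times (var ''t'') (Const (gam G)))))
        (put ''t'' (Times (var ''t'') (Const (gam G))) ;; put ''l'' (Plus (var ''l'') (Const 1))))
     (\<lambda>s'. s' ''l'' 0 = of_int (level G u) \<and> \<bar>level G u\<bar> \<le> ?L) s'"
    if "?I l0 s'" "\<bar>l0\<bar> \<le> ?L" "gam G powi l0 \<le> u" for s' l0
  proof (rule wp_While[where I = "\<lambda>s. \<exists>l. ?I l s \<and> \<bar>l\<bar> \<le> ?L \<and> gam G powi l \<le> u" and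
        f = "\<lambda>s. nat (?L - \<lfloor>s ''l'' 0\<rfloor>)"], goal_cases)
    case 1
    then show ?case using that by blast
  next
    case 2
    have "nat (?L - l0) \<le> 2 * (G * b)" using that(2) by linarith
    then show ?case using that Y by simp
  next
    case (3 s)
    then obtain l where l: "?I l s" "\<bar>l\<bar> \<le> ?L" "gam G powi l \<le> u" by blast
    have le: "gam G powi (l + 1) \<le> u" using 3(2) l by (simp add: up not_less)
    \<comment> \<open>The next power is still at most \<open>u\<close>, hence below the power with
      exponent \<open>?L\<close>; this bounds its size and makes the variant drop.\<close>
    have "l + 1 < ?L" using less le ub(1) by fastforce
    then have l1: "\<bar>l + 1\<bar> \<le> ?L" using l(2) by linarith
    have eq: "rat_of_int l + 1 = of_int (l + 1)" by simp
    show ?case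
      by (intro wp_Seq wp_Assign)
         (use l l1 le t_size[OF l1] l_size[OF l1] \<open>l + 1 < ?L\<close> in
           \<open>auto simp: up eq simp del: of_int_add\<close>)
  next
    case (4 s)
    then obtain l where l: "?I l s" "\<bar>l\<bar> \<le> ?L" "gam G powi l \<le> u" by blast
    have "u < gam G powi (l + 1)" using 4(2) l by (simp add: up not_less)
    then show ?case using l level_eqI[OF G l(3)] by simp
  qed
  show ?thesis unfolding level_com_def
  proof (intro wp_Seq wp_Assign, goal_cases)
    case 3
    show ?case
    proof (rule wp_While[where I = "\<lambda>s. \<exists>l. ?I l s \<and> - ?L \<le> l \<and> l \<le> 0" and
        f = "\<lambda>s. nat (?L + \<lfloor>s ''l'' 0\<rfloor>)"], goal_cases)
      case 1
      then show ?case using s by (intro exI[of _ 0]) auto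
    next
      case 2
      have "nat (?L + 0) \<le> 2 * (G * b)" by linarith
      then show ?case using Y by simp
    next
      case (3 s)
      then obtain l where l: "?I l s" "- ?L \<le> l" "l \<le> 0" by blast
      have "u < gam G powi l" using 3(2) l by simp
      then have "- ?L < l" using less ub(2) by fastforce
      then have l1: "\<bar>l - 1\<bar> \<le> ?L" using l(3) by linarith
      have eq: "rat_of_int l - 1 = of_int (l - 1)" by simp
      show ?case
        by (intro wp_Seq wp_Assign)
           (use l l1 t_size[OF l1] l_size[OF l1] \<open>- ?L < l\<close> in
             \<open>auto simp: down eq simp del: of_int_diff\<close>)
    next
      case (4 s)
      then obtain l where l: "?I l s" "- ?L \<le> l" "l \<le> 0" by blast
      show ?case by (rule wp2[of s l, OF l(1)]) (use l 4(2) in auto)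
    qed
  qed (use const_bounds in simp_all)
qed

end

text \<open>The coefficients \<open>ca\<close> and \<open>cb\<close> describe the multiplier
  \<open>ca * p + cb\<close> of the logarithms. The three inequalities on \<open>Y\<close> leave
  room for powers of \<open>gam G\<close>, for truncations of \<open>p\<close> and for squares of
  exponents, in this order.\<close>

locale matching_bound = run_bound +
  fixes G H j bits :: nat and ca cb :: rat
  assumes G: "G \<ge> 1" and p_le: "\<bar>p\<bar> + 1 \<le> 2 ^ j" and cab: "\<bar>ca\<bar> \<le> 1" "\<bar>cb\<bar> \<le> 1"
    and potential_size: "\<And>i g. i \<in> {1..n} \<Longrightarrow> g \<in> {1..m} \<Longrightarrow>
        rat_size (potential i g) \<le> bits"
    and level_size: "3 + G * bits * rat_size (gam G) \<le> Y"
    and approx_size: "2 * ((G * bits) * (G * bits)) + j + 2 * (G * bits) + 3 \<le> Y"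
    and exponent_size: "((2 ^ j + 1) * (G * bits) + 1) * ((2 ^ j + 1) * (G * bits) + 1) + 2 \<le> Y"
begin

definition max_exponent :: nat where
  "max_exponent = (2 ^ j + 1) * (G * bits) + 1"

definition expo :: "nat \<Rightarrow> nat \<Rightarrow> int" where
  "expo i g = cost_exponent p ca cb (level G (potential i g))"

definition recorded :: "nat \<Rightarrow> store \<Rightarrow> nat \<Rightarrow> nat \<Rightarrow> bool" where
  "recorded k s i g \<longleftrightarrow> (if potential i g > 0
     then s ''G'' (idx m i g) = 1 \<and> s ''E'' (idx m i g) = of_int (expo i g) \<and> \<bar>expo i g\<bar> \<le> int k
     else s ''G'' (idx m i g) = 0)"

definition min_expo :: "(nat \<times> nat) set \<Rightarrow> int \<Rightarrow> bool" where
  "min_expo D l \<longleftrightarrow> (\<exists>(i, g) \<in> D. potential i g > 0 \<and> l = expo i g) \<and>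
      (\<forall>(i, g) \<in> D. potential i g > 0 \<longrightarrow> l \<le> expo i g)"

text \<open>\<open>D\<close> is the set of pairs treated so far. Until a positive potential is met,
  \<open>w\<close> holds the default 0 and \<open>f\<close> is 0. The bound \<open>k\<close> is the
  number actually stored in \<open>b\<close>, since the depth of the weight table is computed from
  it.\<close>

definition exponents_inv :: "(nat \<times> nat) set \<Rightarrow> store \<Rightarrow> bool" where
  "exponents_inv D s \<longleftrightarrow>
     (\<exists>k. s ''b'' 0 = of_nat k \<and> k \<le> max_exponent * max_exponent \<and>
       (\<forall>(i, g) \<in> D. recorded k s i g)) \<and>
     (\<exists>l. s ''w'' 0 = of_int l \<and>
       (s ''f'' 0 = 0 \<and> l = 0 \<and> (\<forall>(i, g) \<in> D. \<not> potential i g > 0) \<or>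
        s ''f'' 0 = 1 \<and> min_expo D l))"

lemma exponents_inv_cong:
  assumes "exponents_inv D s" "\<And>x. x \<in> {''b'', ''w'', ''f'', ''G'', ''E''} \<Longrightarrow> s' x = s x"
  shows "exponents_inv D s'"
proof -
  have "s' ''b'' = s ''b''" "s' ''w'' = s ''w''" "s' ''f'' = s ''f''" "s' ''G'' = s ''G''" "s' ''E'' = s ''E''"
    using assms(2) by auto
  then show ?thesis using assms(1) unfolding exponents_inv_def recorded_def by (simp only:)
qed

lemma abs_expo_le:
  assumes "i \<in> {1..n}" "g \<in> {1..m}" "\<bar>level G (potential i g)\<bar> \<le> int (G * bits)"
  shows "\<bar>expo i g\<bar> \<le> int max_exponent"
  unfolding expo_def max_exponent_def by (rule cost_exponent_bound[OF p_le cab assms(3)])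

lemma expo_facts:
  assumes "\<bar>expo i g\<bar> \<le> int max_exponent"
  shows "expo i g * expo i g \<le> int (max_exponent * max_exponent)"
    "\<bar>expo i g\<bar> \<le> expo i g * expo i g"
    "rat_size (of_int (expo i g)) \<le> Y" "rat_size (of_int (expo i g) * of_int (expo i g)) \<le> Y"
proof -
  let ?e = "expo i g"
  have "\<bar>?e\<bar> * \<bar>?e\<bar> \<le> int max_exponent * int max_exponent"
    using assms by (intro mult_mono) auto
  then show e2: "?e * ?e \<le> int (max_exponent * max_exponent)"
    by (simp only: abs_mult_self_eq of_nat_mult)
  show e: "\<bar>?e\<bar> \<le> ?e * ?e"
    by (cases "?e = 0") (use mult_mono[of 1 "\<bar>?e\<bar>" "\<bar>?e\<bar>" "\<bar>?e\<bar>"] in auto)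
  have z: "\<bar>z\<bar> \<le> int (max_exponent * max_exponent) \<Longrightarrow> rat_size (of_int z) \<le> Y" for z
    using rat_size_of_int[of z] exponent_size unfolding max_exponent_def by linarith
  show "rat_size (of_int ?e) \<le> Y" by (rule z) (use e e2 in linarith)
  have "rat_size (of_int (?e * ?e)) \<le> Y" by (rule z) (use e e2 in linarith)
  then show "rat_size (of_int ?e * of_int ?e) \<le> Y" by simp
qed

lemma wp_record:
  assumes sz: "sizes s" and ig: "s ''i'' 0 = of_nat i" "i \<in> {1..n}" "s ''g'' 0 = of_nat g" "g \<in> {1..m}"
    and e: "s ''e'' 0 = of_int (expo i g)" and pos: "potential i g > 0"
    and e_le: "\<bar>expo i g\<bar> \<le> int max_exponent"
    and D: "D \<subseteq> {1..n} \<times> {1..m}" "(i, g) \<notin> D" and inv: "exponents_inv D s"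
  shows "wp record_com (exponents_inv (insert (i, g) D)) s"
proof -
  have ix: "\<lfloor>aval (index ''g'') t\<rfloor> = idx m i g"
    if "t ''i'' = s ''i''" "t ''g'' = s ''g''" "t ''m'' = s ''m''" for t
    using that ig sz by (intro floor_index) (simp_all add: sizes_def)
  have D': "idx m i' g' \<noteq> idx m i g" if "(i', g') \<in> D" for i' g'
    using that D ig by (subst idx_eq_iff) auto
  obtain k where k: "s ''b'' 0 = of_nat k" "k \<le> max_exponent * max_exponent" "\<forall>(i, g) \<in> D. recorded k s i g"
    using inv unfolding exponents_inv_def by blast
  obtain l where l: "s ''w'' 0 = of_int l"
     "s ''f'' 0 = 0 \<and> l = 0 \<and> (\<forall>(i, g) \<in> D. \<not> potential i g > 0) \<or> s ''f'' 0 = 1 \<and>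
       min_expo D l"
    using inv unfolding exponents_inv_def by blast
  note ef = expo_facts[OF e_le]
  define s1 where "s1 = store_update (store_update s ''E'' (idx m i g) (of_int (expo i g))) ''G'' (idx m i g) 1"
  let ?W = "\<lambda>s'. \<exists>l. s' ''w'' 0 = of_int l \<and> s' ''f'' 0 = 1 \<and> min_expo (insert (i, g) D) l"
  have min1: "min_expo (insert (i, g) D) l" if "min_expo D l" "l \<le> expo i g"
    using that unfolding min_expo_def by auto
  have min2: "min_expo (insert (i, g) D) (expo i g)"
    if "s ''f'' 0 = 0 \<or> expo i g < l"
  proof -
    have "expo i g \<le> expo i' g'" if "(i', g') \<in> D" "potential i' g' > 0" for i' g'
      using that \<open>s ''f'' 0 = 0 \<or> expo i g < l\<close> l unfolding min_expo_def by fastforce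
    then show ?thesis using pos unfolding min_expo_def by auto
  qed
  have rec: "\<forall>(i, g) \<in> insert (i, g) D. recorded k' s' i g"
    if "k \<le> k'" "\<bar>expo i g\<bar> \<le> int k'" "s' ''G'' = s1 ''G''" "s' ''E'' = s1 ''E''" for k' s'
  proof -
    have "recorded k' s' i' g'" if ig': "(i', g') \<in> D" for i' g'
    proof -
      have "s' ''G'' (idx m i' g') = s ''G'' (idx m i' g')" "s' ''E'' (idx m i' g') = s ''E'' (idx m i' g')"
        using D'[OF ig'] \<open>s' ''G'' = s1 ''G''\<close> \<open>s' ''E'' = s1 ''E''\<close> by (simp_all add: s1_def)
      moreover have "recorded k s i' g'" using k(3) ig' by auto
      moreover have "\<bar>expo i' g'\<bar> \<le> int k \<Longrightarrow> \<bar>expo i' g'\<bar> \<le>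
        int k'" using \<open>k \<le> k'\<close> by linarith
      ultimately show ?thesis unfolding recorded_def by presburger
    qed
    moreover have "s' ''G'' (idx m i g) = 1" "s' ''E'' (idx m i g) = of_int (expo i g)"
      using \<open>s' ''G'' = s1 ''G''\<close> \<open>s' ''E'' = s1 ''E''\<close> by (simp_all add: s1_def)
    then have "recorded k' s' i g" using \<open>\<bar>expo i g\<bar> \<le> int k'\<close> pos unfolding recorded_def by simp
    ultimately show ?thesis by blast
  qed
  have W: "wp (If (And (Less (Const 0) (var ''f'')) (Not (Less (var ''e'') (var ''w''))))
        Skip (put ''w'' (var ''e'') ;; put ''f'' (Const 1))) ?W s1"
  proof (intro wp_If wp_Skip wp_Seq wp_Assign, goal_cases)
    case 1
    then have "s ''f'' 0 = 1" "min_expo D l" "l \<le> expo i g" using l e by (auto simp: s1_def)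
    then show ?case using l(1) min1 by (intro exI[of _ l]) (simp add: s1_def)
  next
    case 4
    then have "s ''f'' 0 = 0 \<or> expo i g < l" using l e by (auto simp: s1_def)
    then show ?case using min2 e by (intro exI[of _ "expo i g"]) (simp add: s1_def)
  qed (use e ef(3) const_bounds in \<open>simp_all add: s1_def\<close>)
  have B: "wp (If (Less (var ''b'') (Times (var ''e'') (var ''e'')))
        (put ''b'' (Times (var ''e'') (var ''e''))) Skip) (exponents_inv (insert (i, g) D)) s2"
    if W2: "?W s2" and fr: "\<And>x. x \<notin> {''w'', ''f''} \<Longrightarrow> s2 x = s1 x" for s2
  proof -
    have b: "s2 ''b'' 0 = of_nat k" "s2 ''e'' 0 = of_int (expo i g)" "s2 ''G'' = s1 ''G''" "s2 ''E'' = s1 ''E''"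
      using fr k(1) e by (simp_all add: s1_def)
    have cmp: "bval (Less (var ''b'') (Times (var ''e'') (var ''e''))) s2 \<longleftrightarrow> int k < expo i g * expo i g"
    proof -
      have "bval (Less (var ''b'') (Times (var ''e'') (var ''e''))) s2 \<longleftrightarrow>
          rat_of_int (int k) < of_int (expo i g * expo i g)" by (simp add: b)
      then show ?thesis by (simp only: of_int_less_iff)
    qed
    have nn: "of_nat (nat (expo i g * expo i g)) = rat_of_int (expo i g) * of_int (expo i g)"
      by (metis of_int_mult of_nat_nat zero_le_square)
    show ?thesis
    proof (intro wp_If wp_Assign wp_Skip, goal_cases)
      case 1
      then show ?case using ef(4) b by simp
    next
      case 2
      then have kk: "int k < expo i g * expo i g" unfolding cmp .
      have le: "k \<le> nat (expo i g * expo i g)" "\<bar>expo i g\<bar> \<le> int (nat (expo i g * expo i g))"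
        "nat (expo i g * expo i g) \<le> max_exponent * max_exponent"
        using kk ef(1,2) by linarith+
      let ?s = "store_update s2 ''b'' \<lfloor>aval (Const 0) s2\<rfloor> (aval (Times (var ''e'') (var ''e'')) s2)"
      have "?s ''b'' 0 = of_nat (nat (expo i g * expo i g))" using b(2) nn by simp
      moreover have "?s ''G'' = s1 ''G''" "?s ''E'' = s1 ''E''" "?s ''w'' = s2 ''w''" "?s ''f'' = s2 ''f''"
        using b(3,4) by simp_all
      ultimately show ?case using W2 le(3) rec[OF le(1,2)] unfolding exponents_inv_def by metis
    next
      case 3
      then have "\<not> int k < expo i g * expo i g" unfolding cmp .
      then have le: "\<bar>expo i g\<bar> \<le> int k" using ef(2) by linarith
      show ?case using W2 k(2) b rec[OF le_refl le] unfolding exponents_inv_def by metis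
    qed
  qed
  show ?thesis
    unfolding record_com_def
  proof (intro wp_Seq wp_Assign, goal_cases)
    case 3
    have "store_update (store_update s ''E'' \<lfloor>aval (index ''g'') s\<rfloor> (aval (var ''e'') s)) ''G''
        \<lfloor>aval (index ''g'') (store_update s ''E'' \<lfloor>aval (index ''g'') s\<rfloor> (aval (var ''e'') s))\<rfloor>
        (aval (Const 1) (store_update s ''E'' \<lfloor>aval (index ''g'') s\<rfloor> (aval (var ''e'') s))) = s1"
      using e by (simp add: s1_def ix)
    then show ?case
      by (simp only:) (rule wp_frame[OF W], rule B, simp_all)
  qed (use e ef(3) const_bounds in simp_all)
qed

lemma wp_exponent:
  assumes sz: "sizes s" and ig: "s ''i'' 0 = of_nat i" "i \<in> {1..n}" "s ''g'' 0 = of_nat g" "g \<in> {1..m}"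
    and S: "s ''S'' (idx m i g) = v i {g}" and V: "s ''V'' (int i) = low_value i"
    and D: "D \<subseteq> {1..n} \<times> {1..m}" "(i, g) \<notin> D" and inv: "exponents_inv D s"
  shows "wp (exponent_com G ca cb) (exponents_inv (insert (i, g) D)) s"
proof -
  have ix: "\<lfloor>aval (index ''g'') t\<rfloor> = idx m i g"
    if "t ''i'' = s ''i''" "t ''g'' = s ''g''" "t ''m'' = s ''m''" for t
    using that ig sz by (intro floor_index) (simp_all add: sizes_def)
  have u: "aval (Plus (Times (var ''n'') (Cell ''S'' (index ''g''))) (Cell ''V'' (var ''i''))) s = potential i g"
    using S V ig sz by (simp add: ix potential_def sizes_def)
  have D': "idx m i' g' \<noteq> idx m i g" if "(i', g') \<in> D" for i' g'
    using that D ig by (subst idx_eq_iff) auto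
  have usz: "rat_size (potential i g) \<le> bits" using potential_size ig by blast
  have bY: "bits \<le> Y"
  proof -
    have "1 * bits * 1 \<le> G * bits * rat_size (gam G)"
      using G rat_size_ge_2[of "gam G"] by (intro mult_mono) auto
    then show ?thesis using level_size by linarith
  qed
  define s1 where "s1 = store_update s ''u'' 0 (potential i g)"
  have su: "s1 ''u'' 0 = potential i g" by (simp add: s1_def)
  have inv_s: "exponents_inv D s1" using inv by (rule exponents_inv_cong) (auto simp: s1_def)
  have "wp (If (Less (Const 0) (var ''u''))
        (level_com G ;;
         Approx ''a'' (Times (var ''l'') (var ''l'')) ;;
         put ''e'' (Floor (Times (Plus (Times (Const ca) (var ''a'')) (Const cb)) (var ''l''))) ;;
         record_com)
        (Assign ''G'' (index ''g'') (Const 0))) (exponents_inv (insert (i, g) D)) s1"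
  proof (intro wp_If wp_Seq, goal_cases)
    case 1
    then have pos: "potential i g > 0" using su by simp
    have Y2: "2 * (G * bits) + 2 \<le> Y" using approx_size by linarith
    show ?case
    proof (rule wp_frame[OF wp_level[of G s1 "potential i g" bits, OF G su pos usz level_size Y2]], goal_cases)
      case (1 s2)
      let ?l = "level G (potential i g)" and ?e = "expo i g"
      have l: "s2 ''l'' 0 = of_int ?l" "\<bar>?l\<bar> \<le> int (G * bits)" using 1(1) by auto
      have fr: "s2 x = s1 x" if "x \<notin> {''t'', ''l''}" for x
        using 1(2)[of x] that by (auto simp: level_com_def)
      have inv1: "exponents_inv D s2"
        using inv_s by (rule exponents_inv_cong) (auto simp: fr)
      have e_le: "\<bar>?e\<bar> \<le> int max_exponent" using abs_expo_le ig l by blast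
      have "\<bar>?l\<bar> * \<bar>?l\<bar> \<le> int (G * bits) * int (G * bits)"
        using l(2) by (intro mult_mono) auto
      then have "?l * ?l \<le> int ((G * bits) * (G * bits))"
        by (simp only: abs_mult_self_eq of_nat_mult)
      then have kl: "nat (?l * ?l) \<le> (G * bits) * (G * bits)" by linarith
      have "aval (Times (var ''l'') (var ''l'')) s2 = of_int (?l * ?l)"
        using l by simp
      then have ae: "nat \<lfloor>aval (Times (var ''l'') (var ''l'')) s2\<rfloor> = nat (?l * ?l)"
        by (simp only: floor_of_int)
      show ?case
      proof (intro wp_Seq wp_Approx, goal_cases)
        case 1
        show ?case unfolding ae using kl approx_size by linarith
      next
        case 2
        show ?case unfolding ae using rat_size_truncated[OF p_le, of "nat (?l * ?l)"] kl approx_size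
          by linarith
      next
        case 3
        define s3 where "s3 = store_update s2 ''a'' 0 (truncated p (nat (?l * ?l)))"
        have ev: "aval (Floor (Times (Plus (Times (Const ca) (var ''a'')) (Const cb)) (var ''l''))) s3 = of_int ?e"
          using l by (simp add: expo_def cost_exponent_def s3_def)
        show ?case unfolding ae s3_def[symmetric]
        proof (rule wp_Assign)
          show "wp record_com (exponents_inv (insert (i, g) D)) (store_update s3 ''e'' \<lfloor>aval (Const 0) s3\<rfloor>
            (aval (Floor (Times (Plus (Times (Const ca) (var ''a'')) (Const cb)) (var ''l''))) s3))"
            unfolding ev
          proof (rule wp_record[OF _ _ ig(2) _ ig(4) _ pos e_le D])
            show "exponents_inv D (store_update s3 ''e'' \<lfloor>aval (Const 0) s3\<rfloor> (of_int ?e))"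
              using inv1 by (rule exponents_inv_cong) (auto simp: s3_def)
          qed (use sz ig fr in \<open>auto simp: sizes_def s3_def s1_def\<close>)
        qed (use ev expo_facts(3)[OF e_le] in simp)
      qed
    qed
  next
    case 2
    then have pos: "\<not> potential i g > 0" using su by simp
    have inv_u: "exponents_inv (insert (i, g) D) (store_update s1 ''G'' (idx m i g) 0)"
    proof -
      have "\<forall>(i', g') \<in> insert (i, g) D. recorded k (store_update s1 ''G'' (idx m i g) 0) i' g'"
        if "\<forall>(i, g) \<in> D. recorded k s1 i g" for k
      proof -
        have "recorded k (store_update s1 ''G'' (idx m i g) 0) i' g'" if ig': "(i', g') \<in> D" for i' g'
          using D'[OF ig'] \<open>\<forall>(i, g) \<in> D. recorded k s1 i g\<close> ig' unfolding recorded_def by auto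
        moreover have "recorded k (store_update s1 ''G'' (idx m i g) 0) i g"
          using pos unfolding recorded_def by simp
        ultimately show ?thesis by auto
      qed
      moreover have "min_expo (insert (i, g) D) l" if "min_expo D l" for l
        using that pos unfolding min_expo_def by auto
      ultimately show ?thesis using inv_s pos unfolding exponents_inv_def by simp blast
    qed
    show ?case
      by (intro wp_Assign) (use const_bounds inv_u in \<open>simp_all add: ix s1_def\<close>)
  qed
  then show ?thesis unfolding exponent_com_def
    by (intro wp_Seq wp_Assign) (use u usz bY in \<open>simp_all add: s1_def del: aval.simps(3)\<close>)
qed

lemma wp_exponents:
  assumes sz: "sizes s"
    and S: "\<forall>i\<in>{1..n}. (\<forall>g\<in>{1..m}. s ''S'' (idx m i g) = v i {g}) \<and> s ''V'' (int i) = low_value i"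
  shows "wp (exponents_com G ca cb) (exponents_inv ({1..n} \<times> {1..m})) s"
proof -
  let ?D = "\<lambda>i g. {1..<i} \<times> {1..m} \<union> {i} \<times> {1..<g}"
  have stable: "exponents_inv D (store_update s x k q)"
    if "exponents_inv D s" "x \<in> {''i'', ''g''}" for D s x k q
    using that(1) by (rule exponents_inv_cong) (use that(2) in auto)
  have mods: "x \<in> {''n'', ''m'', ''S'', ''V''} \<Longrightarrow> x \<notin> modified (exponent_com G ca cb)" for x
    by (auto simp: exponent_com_def level_com_def record_com_def)
  have mods': "''i'' \<notin> modified (exponent_com G ca cb)" "''g'' \<notin> modified (exponent_com G ca cb)"
    by (auto simp: exponent_com_def level_com_def record_com_def)
  define s0 where "s0 = store_update (store_update (store_update s ''f'' 0 0) ''b'' 0 0) ''w'' 0 0"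
  have s0: "sizes s0" "\<And>x. x \<in> {''S'', ''V'', ''n'', ''m''} \<Longrightarrow> s0 x = s x"
    using sz by (auto simp: s0_def sizes_def)
  have "wp (For ''i'' 1 (Plus (var ''n'') (Const 1))
      (For ''g'' 1 (Plus (var ''m'') (Const 1)) (exponent_com G ca cb)))
    (exponents_inv ({1..n} \<times> {1..m})) s0"
  proof (rule wp_For[where b = "n + 1" and I = "\<lambda>j. exponents_inv ({1..<j} \<times> {1..m})"], goal_cases)
    case 1
    show ?case unfolding exponents_inv_def s0_def by (auto intro: exI[of _ 0])
  next
    case (7 i s1)
    have fr: "s1 x = s x" if "x \<in> {''S'', ''V'', ''n'', ''m''}" for x
      using 7(5)[of x] mods[of x] s0(2)[of x] that by auto
    show ?case
    proof (rule wp_For[where b = "m + 1" and I = "\<lambda>g. exponents_inv (?D i g)"], goal_cases)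
      case (7 g s2)
      have fr2: "s2 x = s x" if "x \<in> {''S'', ''V'', ''n'', ''m''}" for x
        using 7(5)[of x] mods[of x] fr[of x] that by auto
      have i2: "s2 ''i'' 0 = of_nat i" using 7(5)[of "''i''"] mods' \<open>s1 ''i'' 0 = of_nat i\<close> by simp
      have ig: "i \<in> {1..n}" "g \<in> {1..m}" using \<open>i < n + 1\<close> \<open>1 \<le> i\<close> 7(1,2) by auto
      have "wp (exponent_com G ca cb) (exponents_inv (insert (i, g) (?D i g))) s2"
        by (rule wp_exponent) (use sz S 7 ig fr2 i2 in \<open>auto simp: sizes_def\<close>)
      moreover have "insert (i, g) (?D i g) = ?D i (Suc g)" using \<open>1 \<le> g\<close> by auto
      ultimately show ?case by simp
    next
      case (8 s2)
      have "?D i (m + 1) = {1..<Suc i} \<times> {1..m}" using \<open>1 \<le> i\<close> by auto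
      then show ?case using 8(1) by simp
    next
      case 1
      then show ?case using 7(3) by simp
    next
      case (3 s2)
      have "s2 ''m'' = s ''m''" using 3[of "''m''"] fr[of "''m''"] mods by simp
      then show ?case using sz by (simp add: sizes_def)
    qed (use stable mods' m_le in auto)
  next
    case (3 s1)
    have "s1 ''n'' = s ''n''" using 3[of "''n''"] s0(2)[of "''n''"] mods by simp
    then show ?case using sz by (simp add: sizes_def)
  next
    case (8 s1)
    have "{1..<n + 1} = {1..n}" by auto
    then show ?case using 8(1) by simp
  qed (use stable mods' n_le in auto)
  then show ?thesis unfolding exponents_com_def s0_def
    by (intro wp_Seq wp_Assign) (use const_bounds in simp_all)
qed

end

section \<open>Auctions\<close>

text \<open>Prices \<open>P\<close> and target profits \<open>Q\<close> form a solution of the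
  linear-programming dual of the assignment problem: \<open>W i g <= P g + Q i\<close> is dual
  feasibility, and \<open>P (A i) + Q i <= W i (A i) + 1\<close> is complementary slackness up to
  one price increment. Goods without owner have price 0. The number 0 stands for no agent and for no
  good.\<close>

definition auction_inv ::
  "nat \<Rightarrow> nat \<Rightarrow> (nat \<Rightarrow> nat \<Rightarrow> nat) \<Rightarrow> nat \<Rightarrow> (nat \<Rightarrow> nat) \<Rightarrow> (nat \<Rightarrow> nat) \<Rightarrow> (nat \<Rightarrow> nat) \<Rightarrow> (nat \<Rightarrow> nat) \<Rightarrow> bool"
where
  "auction_inv n m W cap A Ow P Q \<longleftrightarrow>
     (\<forall>i\<in>{1..n}. A i \<le> m \<and> Q i \<le> cap \<and> (A i \<noteq> 0 \<longrightarrow>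
        Ow (A i) = i \<and> P (A i) + Q i \<le> W i (A i) + 1 \<and> 0 < W i (A i))) \<and>
     (\<forall>g\<in>{1..m}. Ow g \<le> n \<and> P g \<le> cap \<and> (Ow g \<noteq> 0 \<longrightarrow> A (Ow g) =
       g) \<and> (Ow g = 0 \<longrightarrow> P g = 0)) \<and>
     (\<forall>i\<in>{1..n}. \<forall>g\<in>{1..m}. W i g \<le> P g + Q i \<and> W i g \<le> cap)"

text \<open>A bid: raising a price preserves dual feasibility, and the slack 1 absorbs the increment
  for the new owner. A displaced owner is free again, so slackness asks nothing of her. If
  \<open>g\<close> had no owner, the update at \<open>Ow g\<close> touches only the dummy agent 0.
  As \<open>Q i\<close> is positive, so is the weight obtained.\<close>

lemma auction_inv_take:
  assumes inv: "auction_inv n m W cap A Ow P Q" and i: "i \<in> {1..n}" and g: "g \<in> {1..m}"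
    and A: "A i = 0" and Q: "0 < Q i" and W: "P g + Q i \<le> W i g"
  shows "auction_inv n m W cap (A(Ow g := 0, i := g)) (Ow(g := i)) (P(g := P g + 1)) Q"
proof -
  have inv1: "A k \<le> m" "Q k \<le> cap" "A k \<noteq> 0 \<Longrightarrow> Ow (A k) = k"
    "A k \<noteq> 0 \<Longrightarrow> P (A k) + Q k \<le> W k (A k) + 1" "A k \<noteq> 0 \<Longrightarrow>
      0 < W k (A k)" if "k \<in> {1..n}" for k
    using inv that unfolding auction_inv_def by auto
  have inv2: "Ow h \<le> n" "P h \<le> cap" "Ow h \<noteq> 0 \<Longrightarrow> A (Ow h) = h" "Ow h = 0 \<Longrightarrow>
      P h = 0" if "h \<in> {1..m}" for h
    using inv that unfolding auction_inv_def by auto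
  have inv3: "W k h \<le> P h + Q k" "W k h \<le> cap" if "k \<in> {1..n}" "h \<in> {1..m}" for k h
    using inv that unfolding auction_inv_def by auto
  have Owi: "Ow h \<noteq> i" if "h \<in> {1..m}" for h using inv2(3)[OF that] A i that by auto
  have other: "A k \<noteq> g" if "k \<in> {1..n}" "k \<noteq> Ow g" for k
    using inv1(3)[OF that(1)] that g by auto
  show ?thesis unfolding auction_inv_def
  proof (intro conjI ballI, goal_cases)
    case (1 k) then show ?case using inv1(1)[of k] g by auto
  next
    case (2 k) then show ?case using inv1 by auto
  next
    case (3 k)
    show ?case
    proof (cases "k = i")
      case True
      then show ?thesis using W g Q by auto
    next
      case False
      then show ?thesis using inv1[OF 3] other[OF 3] by auto
    qed
  next
    case (4 h) then show ?case using inv2(1)[of h] i by auto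
  next
    case (5 h) then show ?case using inv2(2)[of h] W Q inv3(2)[OF i g] by auto
  next
    case (6 h)
    have "Ow h = Ow g \<Longrightarrow> Ow h \<noteq> 0 \<Longrightarrow> h = g" using inv2(3)[OF 6] inv2(3)[OF g] by metis
    then show ?case using inv2(3)[OF 6] Owi[OF 6] i by auto
  next
    case (7 h) then show ?case using inv2(4)[of h] i by auto
  next
    case (8 k h) then show ?case using inv3(1)[of k h] by (auto simp: le_SucI)
  next
    case (9 k h) then show ?case using inv3(2)[of k h] by auto
  qed
qed

text \<open>Strict inequality for all goods is exactly the room needed to reduce the profit by 1,
  and slackness is demanded of assigned agents only, while \<open>i\<close> is free.\<close>

lemma auction_inv_lower:
  assumes inv: "auction_inv n m W cap A Ow P Q" and i: "i \<in> {1..n}"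
    and A: "A i = 0" and W: "\<And>g. g \<in> {1..m} \<Longrightarrow> W i g < P g + Q i"
  shows "auction_inv n m W cap A Ow P (Q(i := Q i - 1))"
proof -
  have "W i g \<le> P g + (Q i - 1)" if "g \<in> {1..m}" for g using W[OF that] by linarith
  moreover have "Q i - 1 \<le> cap" using inv i unfolding auction_inv_def by (meson diff_le_self order_trans)
  ultimately show ?thesis using inv A i unfolding auction_inv_def by auto
qed

text \<open>Weak duality: by feasibility every partial matching weighs at most all prices plus all
  profits. Unsold goods have price 0 and unassigned agents profit 0, so both sums reduce to the
  assigned pairs, where slackness loses 1 per agent.\<close>

lemma auction_inv_optimal:
  assumes inv: "auction_inv n m W cap A Ow P Q"
    and final: "\<And>i. i \<in> {1..n} \<Longrightarrow> A i \<noteq> 0 \<or> Q i = 0"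
    and sigma: "I \<subseteq> {1..n}" "inj_on f I" "f ` I \<subseteq> {1..m}"
  shows "(\<Sum>i\<in>I. W i (f i)) \<le> (\<Sum>i | i \<in> {1..n} \<and> A i \<noteq> 0. W i (A i)) + n"
proof -
  let ?J = "{i \<in> {1..n}. A i \<noteq> 0}"
  have inv1: "A k \<le> m" "A k \<noteq> 0 \<Longrightarrow> Ow (A k) = k"
    "A k \<noteq> 0 \<Longrightarrow> P (A k) + Q k \<le> W k (A k) + 1" if "k \<in> {1..n}" for k
    using inv that unfolding auction_inv_def by auto
  have "(\<Sum>i\<in>I. W i (f i)) \<le> (\<Sum>i\<in>I. P (f i) + Q i)"
    using inv sigma unfolding auction_inv_def by (intro sum_mono) blast
  also have "\<dots> = (\<Sum>g\<in>f ` I. P g) + (\<Sum>i\<in>I. Q i)"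
    by (simp add: sum.distrib sum.reindex[OF sigma(2)])
  also have "(\<Sum>i\<in>I. Q i) \<le> (\<Sum>i\<in>{1..n}. Q i)" using sigma by (intro sum_mono2) auto
  also have "(\<Sum>i\<in>{1..n}. Q i) = (\<Sum>i\<in>?J. Q i)"
    using final by (intro sum.mono_neutral_right) blast+
  also have "(\<Sum>g\<in>f ` I. P g) \<le> (\<Sum>g\<in>{1..m}. P g)" using sigma by (intro sum_mono2) auto
  also have "(\<Sum>g\<in>{1..m}. P g) = (\<Sum>g\<in>A ` ?J. P g)"
  proof (rule sum.mono_neutral_right)
    show "A ` ?J \<subseteq> {1..m}" using inv1 by auto
    show "\<forall>g\<in>{1..m} - A ` ?J. P g = 0"
    proof
      fix g assume g: "g \<in> {1..m} - A ` ?J"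
      have "Ow g = 0"
      proof (rule ccontr)
        assume "Ow g \<noteq> 0"
        then have "Ow g \<in> ?J \<and> A (Ow g) = g" using inv g unfolding auction_inv_def by auto
        then show False using g by (metis DiffD2 imageI)
      qed
      then show "P g = 0" using inv g unfolding auction_inv_def by auto
    qed
  qed auto
  also have "(\<Sum>g\<in>A ` ?J. P g) = (\<Sum>i\<in>?J. P (A i))"
  proof (subst sum.reindex)
    show "inj_on A ?J" by (rule inj_onI) (metis (mono_tags, lifting) inv1(2) mem_Collect_eq)
  qed simp
  also have "(\<Sum>i\<in>?J. P (A i)) + (\<Sum>i\<in>?J. Q i) = (\<Sum>i\<in>?J. P (A i) + Q i)"
    by (simp add: sum.distrib)
  also have "\<dots> \<le> (\<Sum>i\<in>?J. W i (A i) + 1)" using inv1 by (intro sum_mono) auto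
  also have "\<dots> = (\<Sum>i\<in>?J. W i (A i)) + card ?J" by (subst sum.distrib) simp
  also have "card ?J \<le> card {1..n}" by (intro card_mono) auto
  finally show ?thesis by simp
qed

section \<open>Tables of integer weights\<close>

definition table_com :: "nat \<Rightarrow> nat \<Rightarrow> int \<Rightarrow> rat \<Rightarrow> rat \<Rightarrow> rat \<Rightarrow> com" where
  "table_com G H sg al be de =
     (put ''d'' (Plus (Times (Plus (Times (Const 2) (var ''n'')) (Const 1)) (var ''b''))
                  (Times (Const (of_nat (G + 2))) (Plus (var ''n'') (Const 1)))) ;;
      put ''N'' (Times (Const (of_nat H)) (var ''n'')) ;;
      put ''t'' (Const 1) ;;
      For ''j'' 0 (Plus (var ''d'') (Const 1))
        (Assign ''F'' (Times (Const (of_int sg)) (var ''j''))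
           (Floor (Plus (Times (var ''N'') (Plus (Times (Const al) (var ''t'')) (Const be)))
                        (Times (Const de) (var ''j'')))) ;;
         put ''t'' (Divide (var ''t'') (Const (gam G)))))"

text \<open>With \<open>d\<close> the distance of an exponent from the threshold, the three triples
  give the weight shapes \<open>gam G powi - d\<close>, \<open>1 - gam G powi - d\<close> and
  \<open>d\<close>. The sign \<open>sg\<close> says on which side of the threshold weights are
  positive, and \<open>ch\<close> scales the length of the threshold search, which is a single
  auction for \<open>ch = 0\<close>.\<close>

locale table_bound = matching_bound +
  fixes sg :: int and al be de :: rat and ch :: nat
  assumes sg: "sg = 1 \<or> sg = - 1"
    and coeffs: "(al, be, de) \<in> {(1, 0, 0), (- 1, 1, 0), (0, 0, 1)}"
    and ch: "ch \<le> 1"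
begin

text \<open>Large enough for all three cases, for exponents in the range from \<open>- k\<close> to
  \<open>k\<close>: for \<open>p > 0\<close> distances reach \<open>2 * k\<close>; for
  \<open>p < 0\<close> the search must pass the largest exponent by \<open>G * (n + 1)\<close>, so
  that relative costs fall to \<open>1 / 2 ^ (n + 1)\<close>; for \<open>p = 0\<close> it must pass
  \<open>2 * n * k + n\<close>, and the summand \<open>k\<close> makes up for a start as low as
  \<open>- k\<close>.\<close>

definition depth_of :: "nat \<Rightarrow> nat" where
  "depth_of k = (2 * n + 1) * k + (G + 2) * (n + 1)"

definition table_entry :: "nat \<Rightarrow> int" where
  "table_entry k = \<lfloor>of_nat (H * n) * (al * gam G powi (- int k) + be) + de * of_nat k\<rfloor>"

definition table :: "nat \<Rightarrow> int \<Rightarrow> int" where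
  "table D k = (if 0 \<le> sg * k \<and> sg * k \<le> int D then table_entry (nat (sg * k)) else 0)"

lemma table_entry_bounds: "0 \<le> table_entry k" "table_entry k \<le> int (H * n + k)"
proof -
  have g: "0 < gam G powi (- int k)" "gam G powi (- int k) \<le> 1"
    using gam_gt_1[OF G] by (auto simp: power_int_minus field_simps)
  have *: "0 \<le> al * gam G powi (- int k) + be \<and> al * gam G powi (- int k) + be \<le> 1" "0 \<le> de" "de \<le> 1"
    using coeffs g by auto
  have "rat_of_nat (H * n) * (al * gam G powi (- int k) + be) \<le> of_nat (H * n) * 1"
    using * by (intro mult_left_mono) auto
  moreover have "de * of_nat k \<le> 1 * of_nat k" using * by (intro mult_right_mono) auto
  ultimately have "of_nat (H * n) * (al * gam G powi (- int k) + be) + de * of_nat k \<le> of_int (int (H * n + k))"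
    by simp
  then show "table_entry k \<le> int (H * n + k)" unfolding table_entry_def by linarith
  show "0 \<le> table_entry k" unfolding table_entry_def using * by simp
qed

lemma table_bounds: "0 \<le> table D k" "table D k \<le> int (H * n + D)"
  using table_entry_bounds[of "nat (sg * k)"] by (auto simp: table_def)

lemma wp_table:
  assumes sz: "sizes s" and b: "s ''b'' 0 = of_nat k" and F: "\<And>i. s ''F'' i = 0"
    and D: "D = depth_of k"
    and Y: "3 + (D + 1) * rat_size (gam G) \<le> Y" "H * n + D + 3 \<le> Y"
  shows "wp (table_com G H sg al be de) (\<lambda>s'. s' ''d'' 0 = of_nat D \<and> s' ''N'' 0 = of_nat (H * n) \<and>
    (\<forall>i. s' ''F'' i = of_int (table D i))) s"
proof -
  define s1 where "s1 = store_update (store_update (store_update s ''d'' 0 (of_nat D)) ''N'' 0 (of_nat (H * n))) ''t'' 0 1"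
  have sg2: "sg * (sg * x) = x" for x using sg by auto
  have "wp (For ''j'' 0 (Plus (var ''d'') (Const 1))
        (Assign ''F'' (Times (Const (of_int sg)) (var ''j''))
           (Floor (Plus (Times (var ''N'') (Plus (Times (Const al) (var ''t'')) (Const be)))
                        (Times (Const de) (var ''j'')))) ;;
         put ''t'' (Divide (var ''t'') (Const (gam G)))))
     (\<lambda>s'. s' ''d'' 0 = of_nat D \<and> s' ''N'' 0 = of_nat (H * n) \<and>
    (\<forall>i. s' ''F'' i = of_int (table D i))) s1"
  proof (rule wp_For[where b = "D + 1" and I = "\<lambda>j s. s ''t'' 0 = gam G powi (- int j) \<and>
      (\<forall>i. s ''F'' i = (if 0 \<le> sg * i \<and> sg * i < int j then of_int (table_entry (nat (sg * i))) else 0))"],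
      goal_cases)
    case 1
    then show ?case using F by (auto simp: s1_def)
  next
    case (7 j s2)
    have N: "s2 ''N'' 0 = of_nat (H * n)" using 7(5)[of "''N''"] by (simp add: s1_def)
    have ev: "aval (Floor (Plus (Times (var ''N'') (Plus (Times (Const al) (var ''t'')) (Const be)))
                        (Times (Const de) (var ''j'')))) s2 = of_int (table_entry j)"
      using N 7(3,4) by (simp add: table_entry_def)
    have ix: "\<lfloor>aval (Times (Const (of_int sg)) (var ''j'')) s2\<rfloor> = sg * int j"
    proof -
      have "aval (Times (Const (of_int sg)) (var ''j'')) s2 = of_int (sg * int j)" using 7(4) by simp
      then show ?thesis by (simp only: floor_of_int)
    qed
    have e_size: "rat_size (of_int (table_entry j)) \<le> Y"
      using rat_size_of_int[of "table_entry j"] table_entry_bounds[of j] 7(2) Y by linarith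
    have t_size: "rat_size (gam G powi (- int (Suc j))) \<le> Y"
    proof -
      have "rat_size (gam G powi (- int (Suc j))) \<le> 3 + nat \<bar>- int (Suc j)\<bar> * rat_size (gam G)"
        by (rule rat_size_power_int)
      also have "\<dots> \<le> 3 + (D + 1) * rat_size (gam G)" using 7(2)
        by (intro add_left_mono mult_right_mono) auto
      finally show ?thesis using Y by simp
    qed
    have t: "gam G powi (- int j) / gam G = gam G powi (- int (Suc j))"
    proof -
      have "gam G powi (- int j) / gam G = gam G powi (- int j - 1)"
        using gam_gt_1[OF G] by (simp add: power_int_diff)
      also have "- int j - 1 = - int (Suc j)" by simp
      finally show ?thesis .
    qed
    have neq: "i = sg * int j \<longleftrightarrow> sg * i = int j" for i using sg2 by metis
    show ?case
    proof (intro wp_Seq wp_Assign, goal_cases)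
      case 1
      show ?case unfolding ev by (rule e_size)
    next
      case 2
      show ?case using t_size 7(3) t by simp
    next
      case 3
      have "(if i = sg * int j then of_int (table_entry j) else s2 ''F'' i) =
          (if 0 \<le> sg * i \<and> sg * i < int (Suc j) then rat_of_int (table_entry (nat (sg * i))) else 0)" for i
        using 7(3) unfolding neq by auto
      then show ?case unfolding ev ix using 7(3) t by (simp del: of_nat_Suc)
    qed
  next
    case (8 s2)
    then show ?case using 8(2)[of "''d''"] 8(2)[of "''N''"] by (simp add: s1_def table_def)
  qed (use Y in \<open>auto simp: s1_def\<close>)
  moreover have "aval (Plus (Times (Plus (Times (Const 2) (var ''n'')) (Const 1)) (var ''b''))
                  (Times (Const (of_nat (G + 2))) (Plus (var ''n'') (Const 1)))) s = of_nat D"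
    unfolding D depth_of_def using sz b by (simp add: sizes_def algebra_simps)
  moreover have "rat_size (of_nat D) \<le> Y" "rat_size (of_nat (H * n)) \<le> Y"
    using rat_size_of_nat[of D] rat_size_of_nat[of "H * n"] Y by linarith+
  ultimately show ?thesis unfolding table_com_def
    using sz const_bounds by (intro wp_Seq wp_Assign) (simp_all add: s1_def sizes_def)
qed

end

section \<open>The auction program and its running time\<close>

definition take_com :: com where
  "take_com =
     (Assign ''A'' (Cell ''owner'' (var ''g'')) (Const 0) ;;
      Assign ''C'' (Cell ''owner'' (var ''g'')) (Const 0) ;;
      Assign ''owner'' (var ''g'') (var ''i'') ;;
      Assign ''A'' (var ''i'') (var ''g'') ;;
      Assign ''C'' (var ''i'') (Cell ''S'' (index ''g'')) ;;
      Assign ''P'' (var ''g'') (Plus (Cell ''P'' (var ''g'')) (Const 1)) ;;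
      put ''i'' (Const 1) ;; put ''g'' (Const 1))"

definition weight_aexp :: aexp where
  "weight_aexp =
     Times (Cell ''G'' (index ''g'')) (Cell ''F'' (Minus (var ''c'') (Cell ''E'' (index ''g''))))"

text \<open>One step of a scan over the agents and, for a free agent with positive target profit,
  over the goods. The restart at the first agent after a bid is needed because the displaced owner
  may already have been passed.\<close>

definition auction_step_com :: com where
  "auction_step_com =
     If (And (Not (Less (Const 0) (Cell ''A'' (var ''i'')))) (Less (Const 0) (Cell ''Q'' (var ''i''))))
       (If (Not (Less weight_aexp (Plus (Cell ''P'' (var ''g'')) (Cell ''Q'' (var ''i'')))))
         take_com
         (If (Less (var ''g'') (var ''m''))
           (put ''g'' (Plus (var ''g'') (Const 1)))
           (Assign ''Q'' (var ''i'') (Minus (Cell ''Q'' (var ''i'')) (Const 1)) ;; put ''g'' (Const 1))))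
       (put ''i'' (Plus (var ''i'') (Const 1)) ;; put ''g'' (Const 1))"

definition auction_com :: com where
  "auction_com =
     (For ''g'' 1 (Plus (var ''m'') (Const 1))
        (Assign ''P'' (var ''g'') (Const 0) ;; Assign ''owner'' (var ''g'') (Const 0)) ;;
      For ''i'' 1 (Plus (var ''n'') (Const 1))
        (Assign ''Q'' (var ''i'') (Plus (var ''N'') (var ''d'')) ;;
         Assign ''A'' (var ''i'') (Const 0) ;; Assign ''C'' (var ''i'') (Const 0)) ;;
      put ''i'' (Const 1) ;; put ''g'' (Const 1) ;;
      While (Not (Less (var ''n'') (var ''i''))) auction_step_com)"

text \<open>The second component of the lexicographic variants for auctions and for swaps; it counts
  down along a scan between two changes.\<close>

definition scan_position :: "nat \<Rightarrow> nat \<Rightarrow> nat \<Rightarrow> nat \<Rightarrow> nat" where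
  "scan_position n m i g = (n + 1 - i) * m + (m - g)"

lemma scan_position_bound: "1 \<le> i \<Longrightarrow> 1 \<le> g \<Longrightarrow> scan_position n m i g \<le> (n + 1) * m"
proof -
  assume "1 \<le> i" "1 \<le> g"
  then have "scan_position n m i g \<le> n * m + m" unfolding scan_position_def
    by (intro add_mono mult_right_mono) auto
  then show ?thesis by simp
qed

lemma scan_position_next_good: "g < m \<Longrightarrow> scan_position n m i (Suc g) < scan_position n m i g"
  by (simp add: scan_position_def)

lemma scan_position_next_agent:
  assumes "i \<le> n" "g \<le> m" "1 \<le> m"
  shows "scan_position n m (Suc i) 1 < scan_position n m i g"
proof -
  have "n + 1 - i = Suc (n + 1 - Suc i)" using assms by simp
  then show ?thesis using assms by (simp add: scan_position_def)
qed

lemma lex_measure_less: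
  fixes a b x y K :: nat
  assumes "a < b" "x < K"
  shows "a * K + x < b * K + y"
proof -
  have "a * K + x < Suc a * K" using assms by simp
  also have "\<dots> \<le> b * K" using assms by (intro mult_right_mono) auto
  finally show ?thesis by simp
qed

definition own_value :: "(nat \<Rightarrow> nat set \<Rightarrow> rat) \<Rightarrow> (nat \<Rightarrow> nat) \<Rightarrow> nat \<Rightarrow> rat" where
  "own_value v A i = (if A i = 0 then 0 else v i {A i})"

definition holds_matching ::
  "nat \<Rightarrow> nat \<Rightarrow> (nat \<Rightarrow> nat set \<Rightarrow> rat) \<Rightarrow> (nat \<Rightarrow> nat) \<Rightarrow> (nat \<Rightarrow> nat) \<Rightarrow> store \<Rightarrow> bool" where
  "holds_matching n m v A Ow s \<longleftrightarrow>
     (\<forall>i\<in>{1..n}. s ''A'' (int i) = of_nat (A i) \<and> s ''C'' (int i) = own_value v A i) \<and>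
     (\<forall>g\<in>{1..m}. s ''owner'' (int g) = of_nat (Ow g))"

definition is_matching :: "nat \<Rightarrow> nat \<Rightarrow> (nat \<Rightarrow> nat) \<Rightarrow> (nat \<Rightarrow> nat) \<Rightarrow> bool" where
  "is_matching n m A Ow \<longleftrightarrow>
     (\<forall>i\<in>{1..n}. A i \<le> m \<and> (A i \<noteq> 0 \<longrightarrow> Ow (A i) = i)) \<and>
     (\<forall>g\<in>{1..m}. Ow g \<le> n \<and> (Ow g \<noteq> 0 \<longrightarrow> A (Ow g) = g))"

lemma auction_inv_is_matching: "auction_inv n m W cap A Ow P Q \<Longrightarrow> is_matching n m A Ow"
  unfolding auction_inv_def is_matching_def by blast

context table_bound
begin

definition weight :: "nat \<Rightarrow> int \<Rightarrow> nat \<Rightarrow> nat \<Rightarrow> nat" where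
  "weight D c i g = (if potential i g > 0 then nat (table D (c - expo i g)) else 0)"

definition ready :: "nat \<Rightarrow> int \<Rightarrow> store \<Rightarrow> bool" where
  "ready D c s \<longleftrightarrow> sizes s \<and> s ''c'' 0 = of_int c \<and>
     s ''d'' 0 = of_nat D \<and> s ''N'' 0 = of_nat (H * n) \<and> (\<forall>k. s ''F'' k = of_int (table D k)) \<and>
     (\<forall>i\<in>{1..n}. \<forall>g\<in>{1..m}. s ''S'' (idx m i g) = v i {g} \<and>
        (if potential i g > 0 then s ''G'' (idx m i g) = 1 \<and> s ''E'' (idx m i g) = of_int (expo i g)
         else s ''G'' (idx m i g) = 0))"

lemma ready_cong:
  assumes "ready D c s" "\<And>x. x \<in> {''n'', ''m'', ''c'', ''d'', ''N'', ''F'', ''S'', ''G'', ''E''} \<Longrightarrow>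
      s' x = s x"
  shows "ready D c s'"
proof -
  have "s' ''n'' = s ''n''" "s' ''m'' = s ''m''" "s' ''c'' = s ''c''" "s' ''d'' = s ''d''" "s' ''N'' = s ''N''"
    "s' ''F'' = s ''F''" "s' ''S'' = s ''S''" "s' ''G'' = s ''G''" "s' ''E'' = s ''E''"
    by (rule assms(2), simp)+
  then have "ready D c s' = ready D c s" unfolding ready_def sizes_def by (simp only:)
  then show ?thesis using assms(1) by simp
qed

lemma aval_weight:
  assumes r: "ready D c s" and ig: "s ''i'' 0 = of_nat i" "i \<in> {1..n}" "s ''g'' 0 = of_nat g" "g \<in> {1..m}"
  shows "aval weight_aexp s = of_nat (weight D c i g)"
proof -
  have ix: "\<lfloor>aval (index ''g'') s\<rfloor> = idx m i g"
    using r ig by (intro floor_index) (simp_all add: ready_def sizes_def)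
  have a: "aval weight_aexp s =
      s ''G'' (idx m i g) * s ''F'' \<lfloor>s ''c'' 0 - s ''E'' (idx m i g)\<rfloor>"
    by (simp add: weight_aexp_def ix)
  have e: "if potential i g > 0 then s ''G'' (idx m i g) = 1 \<and> s ''E'' (idx m i g) = of_int (expo i g)
         else s ''G'' (idx m i g) = 0" and c: "s ''c'' 0 = of_int c"
      and F: "\<And>k. s ''F'' k = of_int (table D k)"
    using r ig(2,4) unfolding ready_def by blast+
  show ?thesis
  proof (cases "potential i g > 0")
    case True
    then have e': "s ''G'' (idx m i g) = 1" "s ''E'' (idx m i g) = of_int (expo i g)"
      using e by presburger+
    have "\<lfloor>s ''c'' 0 - s ''E'' (idx m i g)\<rfloor> = c - expo i g"
      unfolding e' c by (metis floor_of_int of_int_diff)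
    then have "aval weight_aexp s = of_int (table D (c - expo i g))" unfolding a F e' by simp
    also have "\<dots> = of_nat (nat (table D (c - expo i g)))" using table_bounds(1) by simp
    finally show ?thesis using True unfolding weight_def by presburger
  next
    case False
    then have "s ''G'' (idx m i g) = 0" using e by presburger
    then show ?thesis using False unfolding a weight_def by simp
  qed
qed

lemma weight_le: "weight D c i g \<le> H * n + D"
  using table_bounds(2)[of D "c - expo i g"] by (auto simp: weight_def nat_le_iff)

text \<open>The last two clauses make a scan a certificate: agents before \<open>i\<close> are
  settled, and the goods before \<open>g\<close> fail the current target profit of \<open>i\<close>,
  so reaching the last good justifies lowering that profit.\<close>

definition auction_state ::
  "nat \<Rightarrow> int \<Rightarrow> (nat \<Rightarrow> nat) \<Rightarrow> (nat \<Rightarrow> nat) \<Rightarrow> (nat \<Rightarrow> nat) \<Rightarrow> (nat \<Rightarrow> nat) \<Rightarrow> nat \<Rightarrow> nat \<Rightarrow> store \<Rightarrow> bool" where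
  "auction_state D c A Ow P Q i g s \<longleftrightarrow>
     auction_inv n m (weight D c) (H * n + D) A Ow P Q \<and> holds_matching n m v A Ow s \<and>
     (\<forall>i\<in>{1..n}. s ''Q'' (int i) = of_nat (Q i)) \<and> (\<forall>g\<in>{1..m}. s ''P'' (int g) = of_nat (P g)) \<and>
     s ''i'' 0 = of_nat i \<and> s ''g'' 0 = of_nat g \<and> 1 \<le> i \<and> i \<le> n + 1 \<and> g \<in> {1..m} \<and>
     (\<forall>i'\<in>{1..n}. i' < i \<longrightarrow> A i' \<noteq> 0 \<or> Q i' = 0) \<and>
     (i \<le> n \<longrightarrow> A i = 0 \<longrightarrow> 0 < Q i \<longrightarrow>
       (\<forall>h\<in>{1..m}. h < g \<longrightarrow> weight D c i h < P h + Q i))"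

text \<open>A bid raises one price and a lowering reduces one profit by 1, so the first sum drops in
  both cases; its factor exceeds every scan position. Since \<open>H * n + D\<close> bounds prices
  and profits, unit increments are affordable.\<close>

definition auction_measure :: "nat \<Rightarrow> store \<Rightarrow> nat" where
  "auction_measure D s =
     ((\<Sum>i\<in>{1..n}. nat \<lfloor>s ''Q'' (int i)\<rfloor>) + (\<Sum>g\<in>{1..m}. (H * n + D) - nat \<lfloor>s ''P'' (int g)\<rfloor>)) * ((n + 1) * m + 1)
     + scan_position n m (nat \<lfloor>s ''i'' 0\<rfloor>) (nat \<lfloor>s ''g'' 0\<rfloor>)"

lemma auction_measure_eq:
  assumes "auction_state D c A Ow P Q i g s"
  shows "auction_measure D s =
     ((\<Sum>i\<in>{1..n}. Q i) + (\<Sum>g\<in>{1..m}. (H * n + D) - P g)) * ((n + 1) * m + 1) + scan_position n m i g"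
proof -
  have "(\<Sum>i\<in>{1..n}. nat \<lfloor>s ''Q'' (int i)\<rfloor>) = (\<Sum>i\<in>{1..n}. Q i)"
    "(\<Sum>g\<in>{1..m}. (H * n + D) - nat \<lfloor>s ''P'' (int g)\<rfloor>) = (\<Sum>g\<in>{1..m}. (H * n + D) - P g)"
    using assms unfolding auction_state_def by (intro sum.cong; simp)+
  then show ?thesis using assms unfolding auction_measure_def auction_state_def by simp
qed

text \<open>If \<open>g\<close> has no owner, the first two assignments write to cell 0 of
  \<open>A\<close> and \<open>C\<close>, which no invariant reads.\<close>

lemma wp_take:
  assumes r: "ready D c s" and st: "auction_state D c A Ow P Q i g s"
    and i: "i \<le> n" and free: "A i = 0" and Q: "0 < Q i" and W: "P g + Q i \<le> weight D c i g"
    and Y: "H * n + D + 3 \<le> Y"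
  shows "wp take_com (\<lambda>s'. auction_state D c (A(Ow g := 0, i := g)) (Ow(g := i)) (P(g := P g + 1)) Q 1 1 s') s"
proof -
  have inv: "auction_inv n m (weight D c) (H * n + D) A Ow P Q" and h: "holds_matching n m v A Ow s"
    and QP: "\<And>i. i\<in>{1..n} \<Longrightarrow> s ''Q'' (int i) =
        of_nat (Q i)" "\<And>g. g\<in>{1..m} \<Longrightarrow> s ''P'' (int g) = of_nat (P g)"
    and ig: "s ''i'' 0 = of_nat i" "i \<in> {1..n}" "s ''g'' 0 = of_nat g" "g \<in> {1..m}"
    using st i unfolding auction_state_def by auto
  have inv': "auction_inv n m (weight D c) (H * n + D) (A(Ow g := 0, i := g)) (Ow(g := i)) (P(g := P g + 1)) Q"
    by (rule auction_inv_take[OF inv ig(2,4) free Q W])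
  have A: "s ''A'' (int k) = of_nat (A k)" "s ''C'' (int k) = own_value v A k" if "k \<in> {1..n}" for k
    using h that unfolding holds_matching_def by auto
  have ow: "s ''owner'' (int k) = of_nat (Ow k)" if "k \<in> {1..m}" for k
    using h that unfolding holds_matching_def by auto
  have ix: "\<lfloor>aval (index ''g'') t\<rfloor> = idx m i g"
    if "t ''i'' 0 = of_nat i" "t ''g'' 0 = of_nat g" "t ''m'' 0 = of_nat m" for t
    using that by (intro floor_index)
  have m0: "s ''m'' 0 = of_nat m" and S: "s ''S'' (idx m i g) = v i {g}"
    using r ig unfolding ready_def sizes_def by auto
  have Pg: "P g + 1 \<le> H * n + D" using W Q weight_le[of D c i g] by linarith
  have sz: "rat_size (of_nat i) \<le> Y" "rat_size (of_nat g) \<le> Y" "rat_size (v i {g}) \<le> Y"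
    "rat_size (of_nat (P g) + 1) \<le> Y"
  proof -
    show "rat_size (of_nat i) \<le> Y" "rat_size (of_nat g) \<le> Y"
      using rat_size_of_nat[of i] rat_size_of_nat[of g] ig n_le m_le by auto
    show "rat_size (v i {g}) \<le> Y" using answers_bounded ig by auto
    show "rat_size (of_nat (P g) + 1) \<le> Y" using rat_size_of_nat[of "P g + 1"] Pg Y by (simp add: add.commute)
  qed
  define s1 where "s1 = store_update (store_update s ''A'' (int (Ow g)) 0) ''C'' (int (Ow g)) 0"
  define s2 where "s2 = store_update (store_update s1 ''owner'' (int g) (of_nat i)) ''A'' (int i) (of_nat g)"
  define s3 where "s3 = store_update (store_update s2 ''C'' (int i) (v i {g})) ''P'' (int g) (of_nat (P g) + 1)"
  define s4 where "s4 = store_update (store_update s3 ''i'' 0 1) ''g'' 0 1"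
  note defs = s1_def s2_def s3_def s4_def
  have "holds_matching n m v (A(Ow g := 0, i := g)) (Ow(g := i)) s4"
    unfolding holds_matching_def
  proof (intro conjI ballI, goal_cases)
    case (1 k)
    then show ?case using A[of k] by (simp add: defs)
  next
    case (2 k)
    then show ?case using A[of k] ig(4) by (simp add: defs own_value_def)
  next
    case (3 k)
    then show ?case using ow[of k] by (simp add: defs)
  qed
  moreover have "s4 ''Q'' (int k) = of_nat (Q k)" if "k \<in> {1..n}" for k
    using QP(1)[OF that] by (simp add: defs)
  moreover have "s4 ''P'' (int k) = of_nat ((P(g := P g + 1)) k)" if "k \<in> {1..m}" for k
    using QP(2)[OF that] by (simp add: defs)
  moreover have "s4 ''i'' 0 = of_nat 1" "s4 ''g'' 0 = of_nat 1" by (simp_all add: s4_def)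
  ultimately have post: "auction_state D c (A(Ow g := 0, i := g)) (Ow(g := i)) (P(g := P g + 1)) Q 1 1 s4"
    unfolding auction_state_def using inv' ig(4) by auto
  show ?thesis unfolding take_com_def
  proof (intro wp_Seq wp_Assign, goal_cases)
    case 9
    then show ?case using post ig S m0 ow[OF ig(4)] QP(2)[OF ig(4)] by (simp add: defs ix)
  qed (use sz ow[OF ig(4)] ig S m0 QP(2)[OF ig(4)] const_bounds in \<open>simp_all add: ix\<close>)
qed

lemma wp_auction_step:
  assumes r: "ready D c s" and st: "auction_state D c A Ow P Q i g s"
    and i: "i \<le> n" and Y: "H * n + D + 3 \<le> Y"
  shows "wp auction_step_com (\<lambda>s'. ready D c s' \<and> (\<exists>A Ow P Q i g. auction_state D c A Ow P Q i g s') \<and>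
     auction_measure D s' < auction_measure D s) s"
proof -
  let ?Q = "(\<lambda>s'. (\<exists>A Ow P Q i g. auction_state D c A Ow P Q i g s') \<and>
      auction_measure D s' < auction_measure D s)"
  let ?guard = "And (Not (Less (Const 0) (Cell ''A'' (var ''i'')))) (Less (Const 0) (Cell ''Q'' (var ''i'')))"
  have inv: "auction_inv n m (weight D c) (H * n + D) A Ow P Q" and h: "holds_matching n m v A Ow s"
    and QP: "\<And>i. i\<in>{1..n} \<Longrightarrow> s ''Q'' (int i) =
        of_nat (Q i)" "\<And>g. g\<in>{1..m} \<Longrightarrow> s ''P'' (int g) = of_nat (P g)"
    and ig: "s ''i'' 0 = of_nat i" "i \<in> {1..n}" "s ''g'' 0 = of_nat g" "g \<in> {1..m}"
    and row: "\<And>h. A i = 0 \<Longrightarrow> 0 < Q i \<Longrightarrow> h \<in> {1..m} \<Longrightarrow>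
        h < g \<Longrightarrow> weight D c i h < P h + Q i"
    using st i unfolding auction_state_def by auto
  have A: "s ''A'' (int i) = of_nat (A i)"
    using h ig unfolding holds_matching_def by auto
  have Qi: "s ''Q'' (int i) = of_nat (Q i)" and Pg: "s ''P'' (int g) = of_nat (P g)" using QP ig by auto
  have m0: "s ''m'' 0 = of_nat m" "s ''n'' 0 = of_nat n" using r unfolding ready_def sizes_def by auto
  have W: "aval weight_aexp s = of_nat (weight D c i g)" by (rule aval_weight[OF r ig])
  note meas = auction_measure_eq[OF st]
  let ?K = "(n + 1) * m + 1"
  have frame: "ready D c s'" if "\<And>x. x \<notin> modified auction_step_com \<Longrightarrow> s' x = s x" for s'
    by (rule ready_cong[OF r], rule that) (auto simp: auction_step_com_def take_com_def)
  have cap: "Q i \<le> H * n + D" using inv ig unfolding auction_inv_def by auto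
  have "wp auction_step_com ?Q s"
    unfolding auction_step_com_def
  proof (rule wp_If)
    assume "bval (?guard) s"
    then have free: "A i = 0" "0 < Q i" using ig A Qi by simp_all
    show "wp (If (Not (Less weight_aexp (Plus (Cell ''P'' (var ''g'')) (Cell ''Q'' (var ''i'')))))
         take_com
         (If (Less (var ''g'') (var ''m''))
           (put ''g'' (Plus (var ''g'') (Const 1)))
           (Assign ''Q'' (var ''i'') (Minus (Cell ''Q'' (var ''i'')) (Const 1)) ;; put ''g'' (Const 1))))
       ?Q s"
    proof (intro wp_If, goal_cases)
      case 1
      have "\<not> rat_of_nat (weight D c i g) < of_nat (P g + Q i)"
        using 1 W ig Qi Pg by simp
      then have le: "P g + Q i \<le> weight D c i g" by (simp only: of_nat_less_iff not_less)
      show ?case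
      proof (rule wp_mono[OF wp_take[OF r st i free le Y]], intro conjI exI)
        fix s' assume st': "auction_state D c (A(Ow g := 0, i := g)) (Ow(g := i)) (P(g := P g + 1)) Q 1 1 s'"
        then show "auction_state D c (A(Ow g := 0, i := g)) (Ow(g := i)) (P(g := P g + 1)) Q 1 1 s'" .
        have "P g + 1 \<le> H * n + D" using le free weight_le[of D c i g] by linarith
        then have "(\<Sum>h\<in>{1..m}. (H * n + D) - (P(g := P g + 1)) h) < (\<Sum>h\<in>{1..m}. (H * n + D) - P h)"
          using ig(4) by (intro sum_strict_mono_ex1) auto
        moreover have "scan_position n m 1 1 < ?K"
          using scan_position_bound[of 1 1 n m] by simp
        ultimately show "auction_measure D s' < auction_measure D s"
          unfolding meas auction_measure_eq[OF st'] by (intro lex_measure_less) linarith+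
      qed
    next
      case 2
      have "rat_of_nat (weight D c i g) < of_nat (P g + Q i)"
        using 2 W ig Qi Pg by simp
      then have lt: "weight D c i g < P g + Q i" by (simp only: of_nat_less_iff)
      have gm: "g < m" using 2 ig m0 by simp
      have sz: "rat_size (of_nat g + 1) \<le> Y" using rat_size_of_nat[of "g + 1"] gm m_le by (simp add: add.commute)
      show ?case
      proof (rule wp_Assign)
        let ?s = "store_update s ''g'' \<lfloor>aval (Const 0) s\<rfloor> (aval (Plus (var ''g'') (Const 1)) s)"
        have st': "auction_state D c A Ow P Q i (Suc g) ?s"
          using st gm lt free ig unfolding auction_state_def holds_matching_def
          by (auto simp: less_Suc_eq)
        have "auction_measure D ?s < auction_measure D s"
          unfolding meas auction_measure_eq[OF st'] using scan_position_next_good[OF gm, of n i] by linarith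
        then show "(\<exists>A Ow P Q i g. auction_state D c A Ow P Q i g ?s) \<and>
            auction_measure D ?s < auction_measure D s" using st' by blast
      qed (use sz ig in simp)
    next
      case 3
      have "rat_of_nat (weight D c i g) < of_nat (P g + Q i)"
        using 3 W ig Qi Pg by simp
      then have lt: "weight D c i g < P g + Q i" by (simp only: of_nat_less_iff)
      have gm: "g = m" using 3 ig m0 by simp
      have all: "weight D c i h < P h + Q i" if "h \<in> {1..m}" for h
        using row[OF free that] lt gm that by (cases "h = m") auto
      have inv': "auction_inv n m (weight D c) (H * n + D) A Ow P (Q(i := Q i - 1))"
        by (rule auction_inv_lower[OF inv ig(2) free(1) all])
      have av: "aval (Minus (Cell ''Q'' (var ''i'')) (Const 1)) s = of_nat (Q i - 1)"
        "\<lfloor>aval (var ''i'') s\<rfloor> = int i" "\<lfloor>aval (Const 0) t\<rfloor> = 0" "aval (Const 1) t = 1" for t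
        using free by (simp_all add: Qi ig of_nat_diff)
      have sz: "rat_size (of_nat (Q i - 1)) \<le> Y" using rat_size_of_nat[of "Q i - 1"] cap Y by linarith
      show ?case
      proof (intro wp_Seq wp_Assign, goal_cases)
        case 3
        let ?s = "store_update (store_update s ''Q'' (int i) (of_nat (Q i - 1))) ''g'' 0 1"
        have st': "auction_state D c A Ow P (Q(i := Q i - 1)) i 1 ?s"
          using st ig inv' unfolding auction_state_def holds_matching_def by auto
        have "(\<Sum>k\<in>{1..n}. (Q(i := Q i - 1)) k) < (\<Sum>k\<in>{1..n}. Q k)"
          using ig(2) free by (intro sum_strict_mono_ex1) auto
        moreover have "scan_position n m i 1 < ?K"
          using scan_position_bound[of i 1 n m] ig by simp
        ultimately have "auction_measure D ?s < auction_measure D s"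
          unfolding meas auction_measure_eq[OF st'] by (intro lex_measure_less) linarith+
        then show ?case using st' unfolding av by blast
      next
        case 1
        show ?case unfolding av by (rule sz)
      qed (use const_bounds in simp)
    qed
  next
    assume "\<not> bval (?guard) s"
    then have busy: "A i \<noteq> 0 \<or> Q i = 0" using ig A Qi by auto
    have sz: "rat_size (of_nat i + 1) \<le> Y" using rat_size_of_nat[of "i + 1"] ig n_le by (simp add: add.commute)
    show "wp (put ''i'' (Plus (var ''i'') (Const 1)) ;; put ''g'' (Const 1))
       ?Q s"
    proof (intro wp_Seq wp_Assign, goal_cases)
      case 3
      let ?s = "store_update (store_update s ''i'' 0 (of_nat (Suc i))) ''g'' 0 1"
      have st': "auction_state D c A Ow P Q (Suc i) 1 ?s"
        using st ig busy unfolding auction_state_def holds_matching_def by (auto simp: less_Suc_eq)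
      have "auction_measure D ?s < auction_measure D s"
        unfolding meas auction_measure_eq[OF st'] using scan_position_next_agent[of i n g m] ig by auto
      moreover have "store_update (store_update s ''i'' \<lfloor>aval (Const 0) s\<rfloor>
          (aval (Plus (var ''i'') (Const 1)) s)) ''g'' \<lfloor>aval (Const 0) s\<rfloor> (aval (Const 1) s) = ?s"
        using ig by (simp add: add.commute)
      ultimately show ?case using st' by (simp only: aval.simps) blast
    qed (use sz ig const_bounds in simp_all)
  qed
  then show ?thesis
  proof (rule wp_frame)
    fix s'
    assume "(\<exists>A Ow P Q i g. auction_state D c A Ow P Q i g s') \<and> auction_measure D s' < auction_measure D s"
      "\<And>x. x \<notin> modified auction_step_com \<Longrightarrow> s' x = s x"
    then show "ready D c s' \<and> (\<exists>A Ow P Q i g. auction_state D c A Ow P Q i g s') \<and>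
       auction_measure D s' < auction_measure D s"
      using frame by blast
  qed
qed

end

section \<open>Search for a threshold at which every agent is served\<close>

definition check_com :: com where
  "check_com =
     (put ''y'' (Const 1) ;;
      For ''i'' 1 (Plus (var ''n'') (Const 1))
        (If (Less (Const 0) (Cell ''A'' (var ''i''))) Skip (put ''y'' (Const 0))))"

definition search_com :: "nat \<Rightarrow> com" where
  "search_com ch =
     (put ''z'' (Plus (var ''w'') (Times (Const (of_nat ch)) (var ''d''))) ;;
      put ''c'' (Minus (var ''w'') (Const 1)) ;;
      put ''y'' (Const 0) ;;
      While (And (Not (Less (Const 0) (var ''y''))) (Less (var ''c'') (var ''z'')))
        (put ''c'' (Plus (var ''c'') (Const 1)) ;; auction_com ;; check_com))"

definition perfect :: "nat \<Rightarrow> (nat \<Rightarrow> nat) \<Rightarrow> bool" where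
  "perfect n A \<longleftrightarrow> (\<forall>i\<in>{1..n}. A i \<noteq> 0)"

context table_bound
begin

text \<open>The comparison includes partial matchings because for \<open>p > 0\<close> an optimal
  allocation may leave agents with value 0.\<close>

definition auction_result :: "nat \<Rightarrow> int \<Rightarrow> (nat \<Rightarrow> nat) \<Rightarrow> bool" where
  "auction_result D c A \<longleftrightarrow>
     (\<forall>i\<in>{1..n}. A i \<le> m \<and> (A i \<noteq> 0 \<longrightarrow> 0 < weight D c i (A i))) \<and>
     (\<forall>I f. I \<subseteq> {1..n} \<longrightarrow> inj_on f I \<longrightarrow> f ` I \<subseteq> {1..m} \<longrightarrow>
        (\<Sum>i\<in>I. weight D c i (f i)) \<le> (\<Sum>i | i \<in> {1..n} \<and> A i \<noteq> 0. weight D c i (A i)) + n)"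

lemma wp_auction:
  assumes r: "ready D c s" and m: "1 \<le> m"
    and Y: "(n + m) * (H * n + D) * ((n + 1) * m + 1) + (n + 1) * m + 3 \<le> Y" "H * n + D + 3 \<le> Y"
  shows "wp auction_com (\<lambda>s'. ready D c s' \<and>
    (\<exists>A Ow. is_matching n m A Ow \<and> holds_matching n m v A Ow s' \<and> auction_result D c A)) s"
proof -
  let ?post = "(\<lambda>s'. ready D c s' \<and> (\<exists>A Ow. is_matching n m A Ow \<and>
      holds_matching n m v A Ow s' \<and> auction_result D c A))"
  let ?guard = "Not (Less (var ''n'') (var ''i''))"
  let ?cap = "H * n + D"
  let ?P = "\<lambda>s. \<forall>g\<in>{1..m}. s ''P'' (int g) = 0 \<and> s ''owner'' (int g) = 0"
  let ?Q = "\<lambda>s. \<forall>i\<in>{1..n}. s ''Q'' (int i) = of_nat ?cap \<and> s ''A'' (int i) = 0 \<and>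
      s ''C'' (int i) = 0"
  have w1: "wp (For ''g'' 1 (Plus (var ''m'') (Const 1))
        (Assign ''P'' (var ''g'') (Const 0) ;; Assign ''owner'' (var ''g'') (Const 0))) ?P s"
  proof (rule wp_For[where b = "m + 1" and I = "\<lambda>j s. \<forall>g\<in>{1..m}. g < j \<longrightarrow>
      s ''P'' (int g) = 0 \<and> s ''owner'' (int g) = 0"], goal_cases)
    case (7 j s')
    then show ?case by (intro wp_Seq wp_Assign) (use const_bounds in \<open>auto simp: less_Suc_eq\<close>)
  qed (use r m_le in \<open>auto simp: ready_def sizes_def\<close>)
  have w2: "wp (For ''i'' 1 (Plus (var ''n'') (Const 1))
        (Assign ''Q'' (var ''i'') (Plus (var ''N'') (var ''d'')) ;;
         Assign ''A'' (var ''i'') (Const 0) ;; Assign ''C'' (var ''i'') (Const 0))) ?Q s1"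
    if r1: "ready D c s1" for s1
  proof (rule wp_For[where b = "n + 1" and I = "\<lambda>j s. \<forall>i\<in>{1..n}. i < j \<longrightarrow>
      s ''Q'' (int i) = of_nat ?cap \<and> s ''A'' (int i) = 0 \<and> s ''C'' (int i) = 0"], goal_cases)
    case (7 j s')
    have N: "s' ''N'' 0 = of_nat (H * n)" "s' ''d'' 0 = of_nat D"
      using 7(5)[of "''N''"] 7(5)[of "''d''"] r1 unfolding ready_def by simp_all
    have av: "aval (Plus (var ''N'') (var ''d'')) s' = of_nat ?cap" using N by simp
    have sz: "rat_size (of_nat ?cap) \<le> Y" using rat_size_of_nat[of ?cap] Y by linarith
    show ?case
    proof (intro wp_Seq wp_Assign, goal_cases)
      case 1
      show ?case unfolding av by (rule sz)
    next
      case 4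
      show ?case unfolding av using 7(3,4) by (auto simp: less_Suc_eq)
    qed (use const_bounds in simp_all)
  qed (use r1 n_le in \<open>auto simp: ready_def sizes_def\<close>)
  have w3: "wp (put ''i'' (Const 1) ;; put ''g'' (Const 1) ;;
      While (?guard) auction_step_com) ?post s2"
    if r2: "ready D c s2" and P: "?P s2" and Q: "?Q s2" for s2
  proof -
    let ?I = "\<lambda>s. ready D c s \<and> (\<exists>A Ow P Q i g. auction_state D c A Ow P Q i g s)"
    define s3 where "s3 = store_update (store_update s2 ''i'' 0 1) ''g'' 0 1"
    have r3: "ready D c s3" using r2 by (rule ready_cong) (auto simp: s3_def)
    have "auction_inv n m (weight D c) ?cap (\<lambda>_. 0) (\<lambda>_. 0) (\<lambda>_. 0) (\<lambda>_. ?cap)"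
      unfolding auction_inv_def using weight_le by auto
    then have st3: "auction_state D c (\<lambda>_. 0) (\<lambda>_. 0) (\<lambda>_. 0) (\<lambda>_. ?cap) 1 1 s3"
      unfolding auction_state_def holds_matching_def own_value_def using P Q m
      by (auto simp: s3_def)
    have "wp (While (?guard) auction_step_com) ?post s3"
    proof (rule wp_While[where I = ?I and f = "auction_measure D"])
      show "?I s3" using r3 st3 by blast
      have "scan_position n m 1 1 \<le> (n + 1) * m" by (rule scan_position_bound) auto
      then have "auction_measure D s3 \<le> (n + m) * ?cap * ((n + 1) * m + 1) + (n + 1) * m"
        unfolding auction_measure_eq[OF st3] by (simp add: algebra_simps)
      then show "auction_measure D s3 \<le> Y" using Y by linarith
    next
      fix s assume I: "?I s" and b: "bval (?guard) s"
      then obtain A Ow P Q i g where st: "auction_state D c A Ow P Q i g s" by blast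
      have "s ''i'' 0 = of_nat i" "s ''n'' 0 = of_nat n"
        using st I unfolding auction_state_def ready_def sizes_def by blast+
      then have "i \<le> n" using b by simp
      then show "wp auction_step_com (\<lambda>s'. ?I s' \<and> auction_measure D s' < auction_measure D s) s"
        using wp_auction_step[OF conjunct1[OF I] st _ Y(2)] by simp
    next
      fix s assume I: "?I s" and b: "\<not> bval (?guard) s"
      then obtain A Ow P Q i g where st: "auction_state D c A Ow P Q i g s" by blast
      have "s ''i'' 0 = of_nat i" "s ''n'' 0 = of_nat n"
        using st I unfolding auction_state_def ready_def sizes_def by blast+
      then have i: "n < i" using b by simp
      have inv: "auction_inv n m (weight D c) ?cap A Ow P Q" and h: "holds_matching n m v A Ow s"
        and fin: "\<And>i'. i' \<in> {1..n} \<Longrightarrow> A i' \<noteq> 0 \<or> Q i' = 0"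
        using st i unfolding auction_state_def by auto
      have "auction_result D c A" unfolding auction_result_def
        using auction_inv_optimal[OF inv fin] inv unfolding auction_inv_def by blast
      then show "ready D c s \<and> (\<exists>A Ow. is_matching n m A Ow \<and> holds_matching n m v A Ow s \<and>
          auction_result D c A)"
        using I h auction_inv_is_matching[OF inv] by blast
    qed
    then show ?thesis by (intro wp_Seq wp_Assign) (use const_bounds in \<open>simp_all add: s3_def\<close>)
  qed
  show ?thesis unfolding auction_com_def
  proof (intro wp_Seq, rule wp_frame[OF w1], goal_cases)
    case (1 s1)
    have r1: "ready D c s1" using r by (rule ready_cong, intro 1(2)) auto
    show ?case
    proof (intro wp_Seq, rule wp_frame[OF w2[OF r1]], goal_cases)
      case (1 s2)
      have r2: "ready D c s2" using r1 by (rule ready_cong, intro 1(2)) auto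
      have "?P s2" using \<open>?P s1\<close> 1(2)[of "''P''"] 1(2)[of "''owner''"] by simp
      then show ?case using w3[OF r2] 1(1) by blast
    qed
  qed
qed

lemma wp_check:
  assumes sz: "sizes s" and A: "\<forall>i\<in>{1..n}. s ''A'' (int i) = of_nat (A i)"
  shows "wp check_com (\<lambda>s'. s' ''y'' 0 = (if perfect n A then 1 else 0)) s"
proof -
  define s1 where "s1 = store_update s ''y'' 0 1"
  have "wp (For ''i'' 1 (Plus (var ''n'') (Const 1))
        (If (Less (Const 0) (Cell ''A'' (var ''i''))) Skip (put ''y'' (Const 0))))
     (\<lambda>s'. s' ''y'' 0 = (if perfect n A then 1 else 0)) s1"
  proof (rule wp_For[where b = "n + 1" and I = "\<lambda>j s. s ''y'' 0 =
    (if \<forall>i\<in>{1..<j}. A i \<noteq> 0 then 1 else 0)"],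
      goal_cases)
    case (7 j s2)
    have Aj: "s2 ''A'' (int j) = of_nat (A j)" using 7(5)[of "''A''"] A 7(1,2) by (simp add: s1_def)
    have iff: "(\<forall>i\<in>{1..<Suc j}. A i \<noteq> 0) \<longleftrightarrow> (\<forall>i\<in>{1..<j}. A i \<noteq> 0) \<and> A j \<noteq> 0"
      using 7(1) by (auto simp: less_Suc_eq)
    show ?case unfolding iff
      by (intro wp_If wp_Skip wp_Assign) (use 7(3,4) Aj const_bounds in auto)
  next
    case (8 s2)
    have "{1..<n + 1} = {1..n}" by auto
    then show ?case using 8(1) by (simp only: perfect_def)
  qed (use sz n_le in \<open>auto simp: s1_def sizes_def\<close>)
  then show ?thesis unfolding check_com_def
    by (intro wp_Seq wp_Assign) (use const_bounds in \<open>simp_all add: s1_def\<close>)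
qed

text \<open>The failure at \<open>c - 1\<close> is kept as evidence that the final threshold is not
  far above the costs of an optimal matching. The last clause admits exhaustion of the search, which
  \<open>depth_of\<close> later excludes whenever some perfect matching has positive
  potentials.\<close>

definition search_result :: "nat \<Rightarrow> int \<Rightarrow> (nat \<Rightarrow> nat) \<Rightarrow> bool" where
  "search_result D l A \<longleftrightarrow> (\<exists>c. l \<le> c \<and> c \<le> l + int (ch * D) \<and>
    auction_result D c A \<and>
     (c = l \<or> (\<exists>A'. auction_result D (c - 1) A' \<and> \<not> perfect n A')) \<and>
     (perfect n A \<or> c = l + int (ch * D)))"

lemma wp_search:
  assumes r: "ready D c0 s" and m: "1 \<le> m" and w: "s ''w'' 0 = of_int l"
    and Y: "(n + m) * (H * n + D) * ((n + 1) * m + 1) + (n + 1) * m + 3 \<le> Y" "H * n + D + 3 \<le> Y"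
      "nat \<bar>l\<bar> + D + 5 \<le> Y"
  shows "wp (search_com ch) (\<lambda>s'. \<exists>A Ow. is_matching n m A Ow \<and> holds_matching n m v A Ow s' \<and>
     search_result D l A) s"
proof -
  let ?Q = "(\<lambda>s'. \<exists>A Ow. is_matching n m A Ow \<and> holds_matching n m v A Ow s' \<and> search_result D l A)"
  \<comment> \<open>Before the first auction \<open>c\<close> is one below the first threshold and
    there is no matching yet; the value 0 of \<open>y\<close> forces the loop to run.\<close>
  let ?alt = "\<lambda>c s. c = l - 1 \<and> s ''y'' 0 = 0 \<or> l \<le> c \<and>
     (\<exists>A Ow. is_matching n m A Ow \<and> holds_matching n m v A Ow s \<and> auction_result D c A \<and>
       s ''y'' 0 = (if perfect n A then 1 else 0) \<and> (c = l \<or> (\<exists>A'. auction_result D (c - 1) A' \<and>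
         \<not> perfect n A')))"
  let ?guard = "And (Not (Less (Const 0) (var ''y''))) (Less (var ''c'') (var ''z''))"
  let ?body = "put ''c'' (Plus (var ''c'') (Const 1)) ;; auction_com ;; check_com"
  let ?z = "l + int (ch * D)"
  let ?dec = "\<lambda>s. nat (?z - \<lfloor>s ''c'' 0\<rfloor>)"
  have chD: "ch * D \<le> D" using ch by (cases "ch = 0") auto
  have small: "rat_size (of_int k) \<le> Y" if "l - 1 \<le> k" "k \<le> ?z" for k
    using rat_size_of_int[of k] that Y(3) chD by linarith
  define s1 where "s1 = store_update (store_update (store_update s ''z'' 0 (of_int ?z)) ''c'' 0 (of_int (l - 1))) ''y'' 0 0"
  have r1: "ready D (l - 1) s1"
  proof -
    have "ready D (l - 1) (store_update s ''c'' 0 (of_int (l - 1)))"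
      using r unfolding ready_def sizes_def by simp
    then show ?thesis by (rule ready_cong) (auto simp: s1_def)
  qed
  let ?I = "\<lambda>s. s ''z'' 0 = of_int ?z \<and> (\<exists>c. ready D c s \<and> l - 1 \<le> c \<and> c \<le> ?z \<and>
     (?alt c s))"
  have rc: "ready D c s \<Longrightarrow> s ''c'' 0 = of_int c" for c s unfolding ready_def by blast
  have body: "wp (?body)
     (\<lambda>s'. ?I s' \<and> nat (?z - \<lfloor>s' ''c'' 0\<rfloor>) < ?dec s) s"
    if I: "?I s" and b: "bval (?guard) s" for s
  proof -
    obtain c where rs: "ready D c s" and cl: "l - 1 \<le> c" "c \<le> ?z" and
      alt: "?alt c s"
      using I by blast
    have z: "s ''z'' 0 = of_int ?z" using I by blast
    have cz: "c < ?z"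
    proof -
      have "rat_of_int c < of_int ?z" using b z rc[OF rs] by simp
      then show ?thesis by (simp only: of_int_less_iff)
    qed
    have prev: "c + 1 = l \<or> (\<exists>A'. auction_result D (c + 1 - 1) A' \<and> \<not> perfect n A')"
    proof (cases "c = l - 1")
      case False
      then obtain A where "auction_result D c A" "s ''y'' 0 = (if perfect n A then 1 else 0)" using alt by blast
      then show ?thesis using b by (auto split: if_splits)
    qed simp
    have av: "aval (Plus (var ''c'') (Const 1)) s = of_int (c + 1)" using rc[OF rs] by simp
    define s2 where "s2 = store_update s ''c'' 0 (of_int (c + 1))"
    have r2: "ready D (c + 1) s2" using rs unfolding ready_def sizes_def s2_def by simp
    have "wp (auction_com ;; check_com)
       (\<lambda>s'. ?I s' \<and> nat (?z - \<lfloor>s' ''c'' 0\<rfloor>) < ?dec s) s2"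
    proof (rule wp_Seq, rule wp_frame[OF wp_auction[OF r2 m Y(1,2)]], goal_cases)
      case (1 s3)
      then obtain A Ow where r3: "ready D (c + 1) s3" and A: "is_matching n m A Ow" "holds_matching n m v A Ow s3"
        "auction_result D (c + 1) A" by blast
      have z3: "s3 ''z'' 0 = of_int ?z"
        using 1(2)[of "''z''"] z by (simp add: s2_def auction_com_def auction_step_com_def take_com_def)
      have "sizes s3" "\<forall>i\<in>{1..n}. s3 ''A'' (int i) = of_nat (A i)"
        using r3 A unfolding ready_def holds_matching_def by blast+
      then show ?case
      proof (rule wp_frame[OF wp_check], goal_cases)
        case (1 s4)
        have fr: "s4 x = s3 x" if "x \<notin> {''y'', ''i''}" for x
          using 1(2)[of x] that by (auto simp: check_com_def)
        have r4: "ready D (c + 1) s4" using r3 by (rule ready_cong) (auto simp: fr)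
        have h4: "holds_matching n m v A Ow s4" using A(2) unfolding holds_matching_def by (simp add: fr)
        have z4: "s4 ''z'' 0 = of_int ?z" using z3 by (simp add: fr)
        have "?I s4"
          using z4 r4 h4 A(1,3) 1(1) prev cl cz by (intro conjI exI[of _ "c + 1"]) (auto simp del: of_int_add)
        moreover have "nat (?z - \<lfloor>s4 ''c'' 0\<rfloor>) < ?dec s"
          unfolding rc[OF r4] rc[OF rs] floor_of_int using cz by linarith
        ultimately show ?case by blast
      qed
    qed
    then show ?thesis
      by (intro wp_Seq, intro wp_Assign) (use small[of "c + 1"] cl cz av in \<open>simp_all add: s2_def del: aval.simps(3)\<close>)
  qed
  have "wp (While (?guard)
        (?body))
     ?Q s1"
  proof (rule wp_While[where I = ?I and f = "\<lambda>s. ?dec s"])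
    have "l - 1 \<le> ?z" by linarith
    moreover have "s1 ''z'' 0 = of_int ?z" "s1 ''y'' 0 = 0" by (simp_all add: s1_def)
    ultimately show "?I s1" using r1 by blast
    show "nat (?z - \<lfloor>s1 ''c'' 0\<rfloor>) \<le> Y" unfolding rc[OF r1] floor_of_int using chD Y(3) by linarith
  next
    fix s assume I: "?I s" and b: "\<not> bval (?guard) s"
    obtain c where rs: "ready D c s" and cl: "l - 1 \<le> c" "c \<le> ?z" and
      alt: "?alt c s"
      using I by blast
    have z: "s ''z'' 0 = of_int ?z" using I by blast
    have ny: "s ''y'' 0 > 0 \<or> c = ?z"
    proof -
      have "s ''y'' 0 > 0 \<or> \<not> rat_of_int c < of_int ?z" using b z rc[OF rs] by auto
      then show ?thesis using cl(2) by (simp only: of_int_less_iff) linarith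
    qed
    have lz: "l \<le> ?z" by linarith
    have lc: "l \<le> c"
    proof (cases "c = ?z")
      case True
      then show ?thesis using lz by (simp only:)
    next
      case False
      then show ?thesis using ny alt by auto
    qed
    then obtain A Ow where "is_matching n m A Ow" "holds_matching n m v A Ow s"
        "auction_result D c A" "s ''y'' 0 = (if perfect n A then 1 else 0)"
        "c = l \<or> (\<exists>A'. auction_result D (c - 1) A' \<and> \<not> perfect n A')" using alt by force
    then show "\<exists>A Ow. is_matching n m A Ow \<and> holds_matching n m v A Ow s \<and> search_result D l A"
      unfolding search_result_def using lc cl ny by (metis less_irrefl)
  qed (rule body)
  moreover have "aval (Plus (var ''w'') (Times (Const (of_nat ch)) (var ''d''))) s = of_int ?z"
    using w r unfolding ready_def by simp
  moreover have "aval (Minus (var ''w'') (Const 1)) t = of_int (l - 1)" if "t ''w'' = s ''w''" for t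
    using w that by simp
  moreover have "rat_size (of_int ?z) \<le> Y" "rat_size (of_int (l - 1)) \<le> Y"
    by (rule small; linarith)+
  ultimately show ?thesis unfolding search_com_def
    by (intro wp_Seq wp_Assign)
       (use const_bounds in \<open>simp_all add: s1_def del: aval.simps(3,4)\<close>)
qed

end

section \<open>Swaps and bag filling\<close>

text \<open>An agent without a good has \<open>C\<close> equal to 0 and also takes part; releasing
  her good 0 only writes to the dummy cell of \<open>owner\<close>. The old good becomes unmatched
  and may interest an earlier agent, hence the restart.\<close>

definition swap_step_com :: com where
  "swap_step_com =
     If (And (Not (Less (Const 0) (Cell ''owner'' (var ''g'')))) (Less (Cell ''C'' (var ''i'')) (Cell ''S'' (index ''g''))))
       (Assign ''owner'' (Cell ''A'' (var ''i'')) (Const 0) ;;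
        Assign ''owner'' (var ''g'') (var ''i'') ;;
        Assign ''A'' (var ''i'') (var ''g'') ;;
        Assign ''C'' (var ''i'') (Cell ''S'' (index ''g'')) ;;
        put ''i'' (Const 1) ;; put ''g'' (Const 1))
       (If (Less (var ''g'') (var ''m''))
         (put ''g'' (Plus (var ''g'') (Const 1)))
         (put ''i'' (Plus (var ''i'') (Const 1)) ;; put ''g'' (Const 1)))"

definition swap_com :: com where
  "swap_com =
     (put ''i'' (Const 1) ;; put ''g'' (Const 1) ;;
      While (Not (Less (var ''n'') (var ''i''))) swap_step_com)"

definition free_goods :: "nat \<Rightarrow> (nat \<Rightarrow> nat) \<Rightarrow> nat set" where
  "free_goods m Ow = {g \<in> {1..m}. Ow g = 0}"

context run_bound
begin

definition swap_state ::
  "(nat \<Rightarrow> nat) \<Rightarrow> (nat \<Rightarrow> nat) \<Rightarrow> (nat \<Rightarrow> nat) \<Rightarrow> nat \<Rightarrow> nat \<Rightarrow> store \<Rightarrow> bool" where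
  "swap_state A0 A Ow i g s \<longleftrightarrow>
     sizes s \<and> (\<forall>i\<in>{1..n}. \<forall>g\<in>{1..m}. s ''S'' (idx m i g) = v i {g}) \<and>
     is_matching n m A Ow \<and> holds_matching n m v A Ow s \<and>
     s ''i'' 0 = of_nat i \<and> s ''g'' 0 = of_nat g \<and> 1 \<le> i \<and> i \<le> n + 1 \<and> g \<in> {1..m} \<and>
     (\<forall>k\<in>{1..n}. own_value v A0 k \<le> own_value v A k) \<and>
     (\<forall>k\<in>{1..n}. \<forall>h\<in>{1..m}. k < i \<or> k = i \<and> h < g \<longrightarrow> Ow h =
       0 \<longrightarrow> v k {h} \<le> own_value v A k)"

text \<open>A swap shrinks the set of goods that the agent values above her own and leaves the own
  values of the others unchanged. So there are at most \<open>n * m\<close> swaps, whatever the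
  values are.\<close>

definition swap_measure :: "store \<Rightarrow> nat" where
  "swap_measure s =
     (\<Sum>i\<in>{1..n}. card {g \<in> {1..m}. s ''C'' (int i) < v i {g}}) * ((n + 1) * m + 1)
     + scan_position n m (nat \<lfloor>s ''i'' 0\<rfloor>) (nat \<lfloor>s ''g'' 0\<rfloor>)"

lemma swap_measure_eq:
  assumes "swap_state A0 A Ow i g s"
  shows "swap_measure s =
     (\<Sum>i\<in>{1..n}. card {g \<in> {1..m}. own_value v A i < v i {g}}) * ((n + 1) * m + 1) + scan_position n m i g"
proof -
  have "(\<Sum>i\<in>{1..n}. card {g \<in> {1..m}. s ''C'' (int i) < v i {g}}) =
      (\<Sum>i\<in>{1..n}. card {g \<in> {1..m}. own_value v A i < v i {g}})"
    using assms unfolding swap_state_def holds_matching_def by (intro sum.cong) simp_all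
  then show ?thesis using assms unfolding swap_measure_def swap_state_def by simp
qed

lemma wp_swap_step:
  assumes st: "swap_state A0 A Ow i g s" and i: "i \<le> n"
  shows "wp swap_step_com (\<lambda>s'. (\<exists>A Ow i g. swap_state A0 A Ow i g s') \<and>
     swap_measure s' < swap_measure s) s"
proof -
  let ?Q = "(\<lambda>s'. (\<exists>A Ow i g. swap_state A0 A Ow i g s') \<and> swap_measure s' < swap_measure s)"
  let ?guard = "And (Not (Less (Const 0) (Cell ''owner'' (var ''g'')))) (Less (Cell ''C'' (var ''i'')) (Cell ''S'' (index ''g'')))"
  have sz: "sizes s" and S: "\<And>i g. i\<in>{1..n} \<Longrightarrow> g\<in>{1..m} \<Longrightarrow> s ''S'' (idx m i g) =
      v i {g}"
    and mt: "is_matching n m A Ow" and h: "holds_matching n m v A Ow s"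
    and ig: "s ''i'' 0 = of_nat i" "i \<in> {1..n}" "s ''g'' 0 = of_nat g" "g \<in> {1..m}"
    and imp: "\<And>k. k\<in>{1..n} \<Longrightarrow> own_value v A0 k \<le> own_value v A k"
    and prev: "\<And>k h. k\<in>{1..n} \<Longrightarrow> h\<in>{1..m} \<Longrightarrow> k < i \<or> k = i \<and>
        h < g \<Longrightarrow> Ow h = 0 \<Longrightarrow> v k {h} \<le> own_value v A k"
    using st i unfolding swap_state_def by (blast, blast, blast, blast, blast, force, blast, blast, blast, blast)
  have A: "s ''A'' (int k) = of_nat (A k)" "s ''C'' (int k) = own_value v A k" if "k \<in> {1..n}" for k
    using h that unfolding holds_matching_def by auto
  have ow: "s ''owner'' (int k) = of_nat (Ow k)" if "k \<in> {1..m}" for k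
    using h that unfolding holds_matching_def by auto
  have m0: "s ''m'' 0 = of_nat m" using sz unfolding sizes_def by simp
  have ix: "\<lfloor>aval (index ''g'') t\<rfloor> = idx m i g"
    if "t ''i'' 0 = of_nat i" "t ''g'' 0 = of_nat g" "t ''m'' 0 = of_nat m" for t
    using that by (intro floor_index)
  note meas = swap_measure_eq[OF st]
  have szs: "rat_size (of_nat i) \<le> Y" "rat_size (of_nat g) \<le> Y" "rat_size (v i {g}) \<le> Y"
  proof -
    show "rat_size (of_nat i) \<le> Y" "rat_size (of_nat g) \<le> Y"
      using rat_size_of_nat[of i] rat_size_of_nat[of g] ig n_le m_le by auto
    show "rat_size (v i {g}) \<le> Y" using answers_bounded ig by auto
  qed
  show ?thesis unfolding swap_step_com_def
  proof (rule wp_If)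
    assume "bval (?guard) s"
    then have free: "Ow g = 0" and better: "own_value v A i < v i {g}"
      using ow[OF ig(4)] A[OF ig(2)] S[OF ig(2,4)] ix[of s] ig m0 by simp_all
    define s1 where "s1 = store_update (store_update s ''owner'' (int (A i)) 0) ''owner'' (int g) (of_nat i)"
    define s2 where "s2 = store_update (store_update s1 ''A'' (int i) (of_nat g)) ''C'' (int i) (v i {g})"
    define s3 where "s3 = store_update (store_update s2 ''i'' 0 1) ''g'' 0 1"
    let ?A = "A(i := g)" and ?Ow = "Ow(A i := 0, g := i)"
    have Ai: "A k \<noteq> g" if "k \<in> {1..n}" for k
      using mt free that ig(4) unfolding is_matching_def by force
    have mt': "is_matching n m ?A ?Ow"
    proof -
      have mt1: "A k \<le> m" "A k \<noteq> 0 \<Longrightarrow> Ow (A k) = k" if "k \<in> {1..n}" for k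
        using mt that unfolding is_matching_def by auto
      have mt2: "Ow k \<le> n" "Ow k \<noteq> 0 \<Longrightarrow> A (Ow k) = k" if "k \<in> {1..m}" for k
        using mt that unfolding is_matching_def by auto
      have ne: "A k \<noteq> A i" if "k \<in> {1..n}" "k \<noteq> i" "A k \<noteq> 0" for k
        using mt1(2)[OF that(1,3)] mt1(2)[OF ig(2)] that by metis
      show ?thesis unfolding is_matching_def
      proof (intro conjI ballI, goal_cases)
        case (1 k) then show ?case using mt1(1)[of k] ig(4) by auto
      next
        case (2 k) then show ?case using mt1(2)[of k] ne[of k] Ai[of k] by auto
      next
        case (3 k) then show ?case using mt2(1)[of k] ig(2) by auto
      next
        case (4 k) then show ?case using mt2(2)[of k] by (cases "Ow k = 0") auto
      qed
    qed
    have h': "holds_matching n m v ?A ?Ow s3"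
      unfolding holds_matching_def
    proof (intro conjI ballI, goal_cases)
      case (1 k)
      then show ?case using A[of k] by (simp add: s1_def s2_def s3_def)
    next
      case (2 k)
      then show ?case using A[of k] ig(4) by (simp add: s1_def s2_def s3_def own_value_def)
    next
      case (3 k)
      then show ?case using ow[of k] by (simp add: s1_def s2_def s3_def)
    qed
    have own': "own_value v ?A k = (if k = i then v i {g} else own_value v A k)" for k
      using ig(4) by (simp add: own_value_def)
    have st': "swap_state A0 ?A ?Ow 1 1 s3"
    proof -
      have "own_value v A0 k \<le> own_value v ?A k" if "k \<in> {1..n}" for k
        unfolding own' using imp[OF that] better by auto
      moreover have "sizes s3" using sz by (simp add: sizes_def s1_def s2_def s3_def)
      moreover have "s3 ''S'' = s ''S''" "s3 ''i'' 0 = of_nat 1" "s3 ''g'' 0 = of_nat 1"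
        by (simp_all add: s1_def s2_def s3_def)
      ultimately show ?thesis unfolding swap_state_def using mt' h' S ig by auto
    qed
    have "(\<Sum>k\<in>{1..n}. card {h \<in> {1..m}. own_value v ?A k < v k {h}}) <
        (\<Sum>k\<in>{1..n}. card {h \<in> {1..m}. own_value v A k < v k {h}})"
    proof (rule sum_strict_mono_ex1)
      show "\<forall>k\<in>{1..n}. card {h \<in> {1..m}. own_value v ?A k < v k {h}} \<le>
          card {h \<in> {1..m}. own_value v A k < v k {h}}"
        unfolding own' using better by (auto intro!: card_mono)
      have "{h \<in> {1..m}. own_value v ?A i < v i {h}} \<subset> {h \<in> {1..m}. own_value v A i < v i {h}}"
        unfolding own' using better ig(4) by auto
      then have "card {h \<in> {1..m}. own_value v ?A i < v i {h}} < card {h \<in> {1..m}. own_value v A i < v i {h}}"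
        by (intro psubset_card_mono) auto
      then show "\<exists>k\<in>{1..n}. card {h \<in> {1..m}. own_value v ?A k < v k {h}} < card {h \<in> {1..m}. own_value v A k < v k {h}}"
        using ig(2) by blast
    qed simp
    moreover have "scan_position n m 1 1 < (n + 1) * m + 1"
      using scan_position_bound[of 1 1 n m] by simp
    ultimately have "swap_measure s3 < swap_measure s"
      unfolding meas swap_measure_eq[OF st'] by (rule lex_measure_less)
    then have post: "(\<exists>A Ow i g. swap_state A0 A Ow i g s3) \<and> swap_measure s3 < swap_measure s"
      using st' by blast
    show "wp (Assign ''owner'' (Cell ''A'' (var ''i'')) (Const 0) ;;
        Assign ''owner'' (var ''g'') (var ''i'') ;; Assign ''A'' (var ''i'') (var ''g'') ;;
        Assign ''C'' (var ''i'') (Cell ''S'' (index ''g'')) ;; put ''i'' (Const 1) ;; put ''g'' (Const 1)) ?Q s"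
    proof (intro wp_Seq wp_Assign, goal_cases)
      case 7
      then show ?case using post ig S[OF ig(2,4)] m0 A[OF ig(2)] by (simp add: s1_def s2_def s3_def ix)
    qed (use szs ig S[OF ig(2,4)] m0 A[OF ig(2)] const_bounds in \<open>simp_all add: ix\<close>)
  next
    assume "\<not> bval (?guard) s"
    then have ok: "Ow g = 0 \<Longrightarrow> v i {g} \<le> own_value v A i"
      using ow[OF ig(4)] A[OF ig(2)] S[OF ig(2,4)] ix[of s] ig m0 by (simp add: not_less)
    have upd: "swap_state A0 A Ow i' g' s'"
      if "\<And>x. x \<notin> {''i'', ''g''} \<Longrightarrow> s' x = s x" "s' ''i'' 0 = of_nat i'" "s' ''g'' 0 = of_nat g'"
        "1 \<le> i'" "i' \<le> n + 1" "g' \<in> {1..m}"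
        "\<And>k h. k\<in>{1..n} \<Longrightarrow> h\<in>{1..m} \<Longrightarrow> k < i' \<or> k = i' \<and>
          h < g' \<Longrightarrow> Ow h = 0 \<Longrightarrow> v k {h} \<le> own_value v A k"
      for i' g' s'
    proof -
      have "sizes s'" using sz that(1) by (simp add: sizes_def)
      moreover have "holds_matching n m v A Ow s'" using h that(1) by (simp add: holds_matching_def)
      moreover have "s' ''S'' = s ''S''" using that(1) by simp
      ultimately show ?thesis unfolding swap_state_def using that(2-) mt S imp by auto
    qed
    show "wp (If (Less (var ''g'') (var ''m''))
         (put ''g'' (Plus (var ''g'') (Const 1)))
         (put ''i'' (Plus (var ''i'') (Const 1)) ;; put ''g'' (Const 1)))
      ?Q s"
    proof (rule wp_If)
      assume "bval (Less (var ''g'') (var ''m'')) s"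
      then have gm: "g < m" using ig m0 by simp
      show "wp (put ''g'' (Plus (var ''g'') (Const 1)))
        ?Q s"
      proof (rule wp_Assign)
        let ?s = "store_update s ''g'' \<lfloor>aval (Const 0) s\<rfloor> (aval (Plus (var ''g'') (Const 1)) s)"
        have st': "swap_state A0 A Ow i (Suc g) ?s"
        proof (rule upd)
          fix k h assume "k\<in>{1..n}" "h\<in>{1..m}" "k < i \<or> k = i \<and> h < Suc g" "Ow h = 0"
          then show "v k {h} \<le> own_value v A k" using prev[of k h] ok by (cases "k = i \<and> h = g") auto
        qed (use ig gm in auto)
        have "swap_measure ?s < swap_measure s"
          unfolding meas swap_measure_eq[OF st'] using scan_position_next_good[OF gm, of n i] by linarith
        then show "(\<exists>A Ow i g. swap_state A0 A Ow i g ?s) \<and> swap_measure ?s < swap_measure s"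
          using st' by blast
      qed (use rat_size_of_nat[of "g + 1"] gm m_le ig in \<open>simp add: add.commute\<close>)
    next
      assume "\<not> bval (Less (var ''g'') (var ''m'')) s"
      then have gm: "g = m" using ig m0 by simp
      show "wp (put ''i'' (Plus (var ''i'') (Const 1)) ;; put ''g'' (Const 1))
        ?Q s"
      proof (intro wp_Seq, rule wp_Assign, goal_cases)
        case 2
        let ?s1 = "store_update s ''i'' \<lfloor>aval (Const 0) s\<rfloor> (aval (Plus (var ''i'') (Const 1)) s)"
        show ?case
        proof (rule wp_Assign)
          let ?s = "store_update ?s1 ''g'' \<lfloor>aval (Const 0) ?s1\<rfloor> (aval (Const 1) ?s1)"
          have st': "swap_state A0 A Ow (Suc i) 1 ?s"
          proof (rule upd)
            fix k h assume "k\<in>{1..n}" "h\<in>{1..m}" "k < Suc i \<or> k = Suc i \<and> h < 1" "Ow h = 0"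
            then show "v k {h} \<le> own_value v A k" using prev[of k h] ok gm
              by (cases "k = i \<and> h = g") (auto simp: less_Suc_eq)
          qed (use ig in auto)
          have "swap_measure ?s < swap_measure s"
            unfolding meas swap_measure_eq[OF st'] using scan_position_next_agent[of i n g m] ig by auto
          then show "(\<exists>A Ow i g. swap_state A0 A Ow i g ?s) \<and> swap_measure ?s < swap_measure s"
            using st' by blast
        qed (use const_bounds in simp)
      qed (use rat_size_of_nat[of "i + 1"] ig n_le in \<open>simp add: add.commute\<close>)
    qed
  qed
qed

lemma wp_swap:
  assumes sz: "sizes s" and S: "\<forall>i\<in>{1..n}. \<forall>g\<in>{1..m}. s ''S'' (idx m i g) = v i {g}"
    and A: "is_matching n m A0 Ow0" "holds_matching n m v A0 Ow0 s" and m: "1 \<le> m"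
    and Y: "n * m * ((n + 1) * m + 1) + (n + 1) * m \<le> Y"
  shows "wp swap_com (\<lambda>s'. \<exists>A Ow. is_matching n m A Ow \<and> holds_matching n m v A Ow s' \<and>
     (\<forall>i\<in>{1..n}. own_value v A0 i \<le> own_value v A i) \<and>
     (\<forall>i\<in>{1..n}. \<forall>g\<in>free_goods m Ow. v i {g} \<le> own_value v A i)) s"
proof -
  define s1 where "s1 = store_update (store_update s ''i'' 0 1) ''g'' 0 1"
  have st1: "swap_state A0 A0 Ow0 1 1 s1"
    unfolding swap_state_def using assms by (auto simp: s1_def sizes_def holds_matching_def)
  have "wp (While (Not (Less (var ''n'') (var ''i''))) swap_step_com)
    (\<lambda>s'. \<exists>A Ow. is_matching n m A Ow \<and> holds_matching n m v A Ow s' \<and>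
     (\<forall>i\<in>{1..n}. own_value v A0 i \<le> own_value v A i) \<and>
     (\<forall>i\<in>{1..n}. \<forall>g\<in>free_goods m Ow. v i {g} \<le> own_value v A i)) s1"
  proof (rule wp_While[where I = "\<lambda>s. \<exists>A Ow i g. swap_state A0 A Ow i g s" and f = swap_measure])
    show "\<exists>A Ow i g. swap_state A0 A Ow i g s1" using st1 by blast
    have "card {g \<in> {1..m}. own_value v A0 i < v i {g}} \<le> m" for i
    proof -
      have "card {g \<in> {1..m}. own_value v A0 i < v i {g}} \<le> card {1..m}" by (intro card_mono) auto
      then show ?thesis by simp
    qed
    then have "(\<Sum>i\<in>{1..n}. card {g \<in> {1..m}. own_value v A0 i < v i {g}}) \<le> n * m"
      using sum_bounded_above[of "{1..n}" "\<lambda>i. card {g \<in> {1..m}. own_value v A0 i < v i {g}}" m] by simp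
    then have "swap_measure s1 \<le> n * m * ((n + 1) * m + 1) + (n + 1) * m"
      unfolding swap_measure_eq[OF st1] using scan_position_bound[of 1 1 n m]
      by (intro add_mono mult_right_mono) auto
    then show "swap_measure s1 \<le> Y" using Y by linarith
  next
    fix s assume "\<exists>A Ow i g. swap_state A0 A Ow i g s" and b: "bval (Not (Less (var ''n'') (var ''i''))) s"
    then obtain A Ow i g where st: "swap_state A0 A Ow i g s" by blast
    have "i \<le> n" using st b unfolding swap_state_def sizes_def by simp
    then show "wp swap_step_com (\<lambda>s'. (\<exists>A Ow i g. swap_state A0 A Ow i g s') \<and>
        swap_measure s' < swap_measure s) s"
      using wp_swap_step[OF st] by blast
  next
    fix s assume "\<exists>A Ow i g. swap_state A0 A Ow i g s" and b: "\<not> bval (Not (Less (var ''n'') (var ''i''))) s"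
    then obtain A Ow i g where st: "swap_state A0 A Ow i g s" by blast
    have "n < i" using st b unfolding swap_state_def sizes_def by simp
    then have "v k {h} \<le> own_value v A k" if "k \<in> {1..n}" "h \<in> free_goods m Ow" for k h
      using st that unfolding swap_state_def free_goods_def by auto
    then show "\<exists>A Ow. is_matching n m A Ow \<and> holds_matching n m v A Ow s \<and>
       (\<forall>i\<in>{1..n}. own_value v A0 i \<le> own_value v A i) \<and>
       (\<forall>i\<in>{1..n}. \<forall>g\<in>free_goods m Ow. v i {g} \<le> own_value v A i)"
      using st unfolding swap_state_def by blast
  qed
  then show ?thesis unfolding swap_com_def
    by (intro wp_Seq wp_Assign) (use const_bounds in \<open>simp_all add: s1_def\<close>)
qed

end

section \<open>Bag filling\<close>

definition hand_com :: com where
  "hand_com =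
     For ''h'' 1 (Plus (var ''m'') (Const 1))
       (If (Less (Const 0) (Cell ''X'' (var ''h'')))
         (Assign ''owner'' (var ''h'') (var ''i'') ;; Assign ''X'' (var ''h'') (Const 0))
         Skip)"

definition offer_com :: com where
  "offer_com =
     For ''i'' 1 (Plus (var ''n'') (Const 1))
       (Query ''y'' (var ''i'') ''X'' ;;
        If (And (Less (Times (Times (Const 2) (var ''n'')) (Cell ''C'' (var ''i''))) (Cell ''R'' (var ''i'')))
                (Not (Less (Times (Times (Const 2) (var ''n'')) (var ''y'')) (Cell ''R'' (var ''i'')))))
          (hand_com ;; Assign ''C'' (var ''i'') (var ''y''))
          Skip)"

definition bag_com :: com where
  "bag_com =
     (For ''g'' 1 (Plus (var ''m'') (Const 1))
        (If (Less (Const 0) (Cell ''owner'' (var ''g'')))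
          (Assign ''X'' (var ''g'') (Const 0)) (Assign ''X'' (var ''g'') (Const 1))) ;;
      For ''i'' 1 (Plus (var ''n'') (Const 1))
        (Query ''y'' (var ''i'') ''X'' ;; Assign ''R'' (var ''i'') (var ''y'')) ;;
      For ''g'' 1 (Plus (var ''m'') (Const 1)) (Assign ''X'' (var ''g'') (Const 0)) ;;
      For ''g'' 1 (Plus (var ''m'') (Const 1))
        (If (Less (Const 0) (Cell ''owner'' (var ''g'')))
          Skip (Assign ''X'' (var ''g'') (Const 1) ;; offer_com)) ;;
      For ''g'' 1 (Plus (var ''m'') (Const 1))
        (If (Less (Const 0) (Cell ''owner'' (var ''g'')))
          Skip (Assign ''owner'' (var ''g'') (Const 1))))"

definition bundle_of :: "nat \<Rightarrow> (nat \<Rightarrow> nat) \<Rightarrow> nat \<Rightarrow> nat set" where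
  "bundle_of m Ow i = {g \<in> {1..m}. Ow g = i}"

lemma bundle_of_subset: "bundle_of m Ow i \<subseteq> {1..m}"
  by (auto simp: bundle_of_def)

locale subadditive_bound = run_bound +
  assumes n: "1 \<le> n"
    and nonneg: "\<And>i S. i \<in> {1..n} \<Longrightarrow> S \<subseteq> {1..m} \<Longrightarrow> 0 \<le> v i S"
    and norm: "\<And>i. i \<in> {1..n} \<Longrightarrow> v i {} = 0"
    and mono: "\<And>i S T. i \<in> {1..n} \<Longrightarrow> S \<subseteq> T \<Longrightarrow>
        T \<subseteq> {1..m} \<Longrightarrow> v i S \<le> v i T"
    and subadd: "\<And>i S T. i \<in> {1..n} \<Longrightarrow> S \<subseteq> {1..m} \<Longrightarrow>
        T \<subseteq> {1..m} \<Longrightarrow> v i (S \<union> T) \<le> v i S + v i T"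
begin

definition rest_value :: "(nat \<Rightarrow> nat) \<Rightarrow> nat \<Rightarrow> rat" where
  "rest_value Ow0 i = v i (free_goods m Ow0)"

definition handed :: "(nat \<Rightarrow> nat) \<Rightarrow> (nat \<Rightarrow> nat) \<Rightarrow> nat set" where
  "handed Ow0 Ow = {g \<in> free_goods m Ow0. Ow g \<noteq> 0}"

text \<open>Since own values are nonnegative, a hungry agent has a positive value for the unmatched
  goods; therefore she declines an empty bag.\<close>

definition hungry :: "(nat \<Rightarrow> nat) \<Rightarrow> (nat \<Rightarrow> rat) \<Rightarrow> nat \<Rightarrow> bool" where
  "hungry Ow0 Cf i \<longleftrightarrow> 2 * of_nat n * Cf i < rest_value Ow0 i"

text \<open>
  Here \<open>T\<close> is the set of agents that have been given a bag, \<open>B\<close> the current bag, and \<open>J\<close> the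
  set of agents that have declined it.
\<close>

definition bag_inv ::
  "(nat \<Rightarrow> nat) \<Rightarrow> (nat \<Rightarrow> rat) \<Rightarrow> nat set \<Rightarrow> nat set \<Rightarrow> (nat \<Rightarrow> nat) \<Rightarrow> nat set \<Rightarrow> nat set \<Rightarrow> (nat \<Rightarrow> rat) \<Rightarrow> bool"
where
  "bag_inv Ow0 C0 D J Ow B T Cf \<longleftrightarrow>
     D \<subseteq> free_goods m Ow0 \<and> T \<subseteq> {1..n} \<and>
     (\<forall>g\<in>{1..m}. Ow g \<le> n \<and> (Ow0 g \<noteq> 0 \<longrightarrow> Ow g = Ow0 g)) \<and>
     B \<inter> handed Ow0 Ow = {} \<and> B \<union> handed Ow0 Ow = D \<and>
     (\<forall>i\<in>{1..n}. C0 i \<le> Cf i \<and> Cf i \<le> v i (bundle_of m Ow i)) \<and>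
     (\<forall>i\<in>{1..n}. hungry Ow0 Cf i \<longrightarrow> i \<notin> T \<and>
        of_nat n * v i (handed Ow0 Ow) \<le> of_nat (card T) * rest_value Ow0 i \<and>
        of_nat n * v i B \<le> rest_value Ow0 i \<and>
        (i \<in> J \<longrightarrow> 2 * of_nat n * v i B < rest_value Ow0 i))"

text \<open>To a hungry agent the declined bag is worth less than
  \<open>rest_value Ow0 i / (2 * n)\<close>, and by stability the new good is worth at most her own
  good, which is below the same bound. So the enlarged bag is worth at most a fraction
  \<open>1 / n\<close> of all unmatched goods. Large unmatched goods would break this, and the swaps
  have excluded them.\<close>

lemma bag_inv_add:
  assumes inv: "bag_inv Ow0 C0 D {1..n} Ow B T Cf" and g: "g \<in> free_goods m Ow0" "g \<notin> D"
    and stable: "\<And>i. i \<in> {1..n} \<Longrightarrow> v i {g} \<le> C0 i"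
  shows "bag_inv Ow0 C0 (insert g D) {} Ow (insert g B) T Cf"
proof -
  have g1: "g \<in> {1..m}" using g unfolding free_goods_def by auto
  have "g \<notin> handed Ow0 Ow" using inv g unfolding bag_inv_def by auto
  moreover have "of_nat n * v i (insert g B) \<le> rest_value Ow0 i"
    if i: "i \<in> {1..n}" and h: "hungry Ow0 Cf i" for i
  proof -
    have B: "B \<subseteq> {1..m}" "2 * of_nat n * v i B < rest_value Ow0 i" "C0 i \<le> Cf i"
      using inv i h unfolding bag_inv_def free_goods_def by auto
    have "v i (insert g B) \<le> v i {g} + v i B" using subadd[of i "{g}" B] i g1 B by simp
    also have "\<dots> \<le> Cf i + v i B" using stable[OF i] B(3) by simp
    finally have "2 * of_nat n * v i (insert g B) \<le> 2 * of_nat n * (Cf i + v i B)"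
      by (intro mult_left_mono) auto
    then show ?thesis using B(2) h unfolding hungry_def by (simp add: algebra_simps)
  qed
  ultimately show ?thesis using inv g unfolding bag_inv_def by auto
qed

lemma bag_inv_decline:
  assumes "bag_inv Ow0 C0 D J Ow B T Cf"
    and "\<not> (hungry Ow0 Cf i \<and> rest_value Ow0 i \<le> 2 * of_nat n * v i B)"
  shows "bag_inv Ow0 C0 D (insert i J) Ow B T Cf"
  using assms unfolding bag_inv_def by auto

text \<open>For the agents that stay hungry the bag is worth at most a fraction \<open>1 / n\<close>
  of the unmatched goods, which the new member of \<open>T\<close> pays for. The next bag is empty,
  of value 0 and hence below every hungry agent's demand, so all agents may count as having declined
  it and \<open>J'\<close> is arbitrary.\<close>

lemma bag_inv_hand:
  assumes inv: "bag_inv Ow0 C0 D J Ow B T Cf" and i: "i \<in> {1..n}"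
    and hi: "hungry Ow0 Cf i" "rest_value Ow0 i \<le> 2 * of_nat n * v i B"
    and C0: "\<And>i. i \<in> {1..n} \<Longrightarrow> 0 \<le> C0 i"
  shows "bag_inv Ow0 C0 D J' (\<lambda>g. if g \<in> B then i else Ow g) {} (insert i T) (Cf(i := v i B))"
proof -
  let ?Ow = "\<lambda>g. if g \<in> B then i else Ow g" and ?Cf = "Cf(i := v i B)"
  have D: "D \<subseteq> free_goods m Ow0" "B \<union> handed Ow0 Ow = D" "B \<inter> handed Ow0 Ow = {}" "T \<subseteq> {1..n}"
    using inv unfolding bag_inv_def by auto
  have fin: "finite T" using D(4) finite_subset by blast
  have BR: "B \<subseteq> free_goods m Ow0" using D by auto
  have Bm: "B \<subseteq> {1..m}" using BR unfolding free_goods_def by auto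
  have Bfree: "Ow g = 0" if "g \<in> B" for g
    using that BR D(3) unfolding handed_def by auto
  have i0: "i \<noteq> 0" using i by auto
  have handed': "handed Ow0 ?Ow = D"
    using D BR i0 unfolding handed_def by auto
  have handed_m: "handed Ow0 Ow \<subseteq> {1..m}" unfolding handed_def free_goods_def by auto
  have npos: "0 < rat_of_nat n" using n by simp
  have iT: "i \<notin> T" using inv i hi unfolding bag_inv_def by auto
  have h': "hungry Ow0 Cf k \<and> k \<noteq> i" if "hungry Ow0 ?Cf k" for k
    using that hi unfolding hungry_def by (auto split: if_splits)
  have rpos: "0 < rest_value Ow0 k" if k: "k \<in> {1..n}" and h: "hungry Ow0 ?Cf k" for k
  proof -
    have "C0 k \<le> Cf k" using inv k unfolding bag_inv_def by blast
    then have "0 \<le> Cf k" using C0[OF k] by linarith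
    then have "0 \<le> 2 * of_nat n * Cf k" by simp
    then show ?thesis using h'[OF h] unfolding hungry_def by linarith
  qed
  have bundle_mono: "v k (bundle_of m Ow k) \<le> v k (bundle_of m ?Ow k)" if "k \<in> {1..n}" for k
    using that Bfree by (intro mono) (auto simp: bundle_of_def)
  show ?thesis unfolding bag_inv_def
  proof (intro conjI ballI impI, goal_cases)
    case 1 then show ?case using D by auto
  next
    case 2 then show ?case using D i by auto
  next
    case (3 g) then show ?case using inv i unfolding bag_inv_def by auto
  next
    case (4 g) then show ?case using inv BR unfolding bag_inv_def free_goods_def by auto
  next
    case 6 then show ?case using handed' by simp
  next
    case (7 k)
    have "Cf i < v i B"
    proof -
      have "2 * of_nat n * Cf i < 2 * of_nat n * v i B" using hi unfolding hungry_def by linarith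
      then show ?thesis using npos by (simp add: mult_less_cancel_left_pos)
    qed
    moreover have "C0 k \<le> Cf k" using inv 7 unfolding bag_inv_def by blast
    ultimately show ?case by (cases "k = i") auto
  next
    case (8 k)
    have "v i B \<le> v i (bundle_of m ?Ow i)" using Bm i by (intro mono) (auto simp: bundle_of_def)
    moreover have "Cf k \<le> v k (bundle_of m Ow k)" using inv 8 unfolding bag_inv_def by blast
    ultimately show ?case using bundle_mono[OF 8] by (cases "k = i") auto
  next
    case (9 k) then show ?case using inv h'[OF 9(2)] unfolding bag_inv_def by auto
  next
    case (10 k)
    have k: "of_nat n * v k (handed Ow0 Ow) \<le> of_nat (card T) * rest_value Ow0 k"
        "of_nat n * v k B \<le> rest_value Ow0 k"
      using inv h'[OF 10(2)] 10(1) unfolding bag_inv_def by auto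
    have "v k D \<le> v k (handed Ow0 Ow) + v k B"
      using subadd[OF 10(1) handed_m Bm] D(2) by (simp add: Un_commute)
    then have "of_nat n * v k D \<le> of_nat n * (v k (handed Ow0 Ow) + v k B)"
      by (intro mult_left_mono) auto
    also have "\<dots> \<le> of_nat (card T) * rest_value Ow0 k + rest_value Ow0 k"
      using k by (simp add: distrib_left)
    finally have le: "of_nat n * v k D \<le> of_nat (card T) * rest_value Ow0 k + rest_value Ow0 k" .
    have "rat_of_nat (card (insert i T)) = of_nat (card T) + 1" using fin iT by simp
    then show ?case using le unfolding handed' by (simp only: distrib_right mult_1)
  next
    case (11 k)
    then show ?case using norm[OF 11(1)] rpos[OF 11] by simp
  next
    case (12 k)
    then show ?case using norm[OF 12(1)] rpos[OF 12(1,2)] by simp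
  qed auto
qed

text \<open>A hungry agent is not in \<open>T\<close>, so at most \<open>n - 1\<close> bags were
  handed out, together worth at most \<open>(n - 1) / n\<close> of her value for all unmatched
  goods, and the last bag is worth less than \<open>1 / (2 * n)\<close> of it. By subadditivity this
  does not add up to the whole.\<close>

lemma bag_inv_final:
  assumes inv: "bag_inv Ow0 C0 (free_goods m Ow0) {1..n} Ow B T Cf" and i: "i \<in> {1..n}"
  shows "\<not> hungry Ow0 Cf i"
proof
  assume h: "hungry Ow0 Cf i"
  have D: "B \<union> handed Ow0 Ow = free_goods m Ow0" "T \<subseteq> {1..n}" "i \<notin> T"
    and k: "of_nat n * v i (handed Ow0 Ow) \<le> of_nat (card T) * rest_value Ow0 i"
      "2 * of_nat n * v i B < rest_value Ow0 i"
    using inv i h unfolding bag_inv_def by auto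
  have "card T < n"
    using psubset_card_mono[of "{1..n}" T] D i by (metis card_atLeastAtMost diff_Suc_1 finite_atLeastAtMost psubsetI)
  then have "rat_of_nat (card T + 1) \<le> of_nat n" by (simp only: of_nat_le_iff)
  then have cT: "rat_of_nat (card T) \<le> of_nat n - 1" by simp
  have sub: "B \<subseteq> {1..m}" "handed Ow0 Ow \<subseteq> {1..m}" using D unfolding free_goods_def by auto
  have r0: "0 \<le> rest_value Ow0 i" unfolding rest_value_def free_goods_def using i by (intro nonneg) auto
  have "rest_value Ow0 i \<le> v i B + v i (handed Ow0 Ow)"
    unfolding rest_value_def using subadd[OF i sub] D(1) by simp
  then have "2 * of_nat n * rest_value Ow0 i \<le> 2 * of_nat n * (v i B + v i (handed Ow0 Ow))"
    by (intro mult_left_mono) auto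
  also have "\<dots> = 2 * of_nat n * v i B + 2 * (of_nat n * v i (handed Ow0 Ow))"
    by (simp add: algebra_simps)
  also have "\<dots> < rest_value Ow0 i + 2 * ((of_nat n - 1) * rest_value Ow0 i)"
    using k mult_right_mono[OF cT r0] by linarith
  finally have "rest_value Ow0 i < 0" by (simp add: algebra_simps)
  then show False using r0 by simp
qed

definition bag_state :: "(nat \<Rightarrow> nat) \<Rightarrow> (nat \<Rightarrow> nat) \<Rightarrow> nat set \<Rightarrow> (nat \<Rightarrow> rat) \<Rightarrow> store \<Rightarrow> bool" where
  "bag_state Ow0 Ow B Cf s \<longleftrightarrow> sizes s \<and>
     (\<forall>g\<in>{1..m}. s ''owner'' (int g) = of_nat (Ow g) \<and> s ''X'' (int g) = (if g \<in> B then 1 else 0)) \<and>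
     (\<forall>i\<in>{1..n}. s ''C'' (int i) = Cf i \<and> s ''R'' (int i) = rest_value Ow0 i)"

lemma bag_state_cong:
  assumes "bag_state Ow0 Ow B Cf s" "\<And>x. x \<in> {''n'', ''m'', ''owner'', ''X'', ''C'', ''R''} \<Longrightarrow> s' x = s x"
  shows "bag_state Ow0 Ow B Cf s'"
proof -
  have "s' ''n'' = s ''n''" "s' ''m'' = s ''m''" "s' ''owner'' = s ''owner''" "s' ''X'' = s ''X''"
    "s' ''C'' = s ''C''" "s' ''R'' = s ''R''"
    by (rule assms(2), simp)+
  then have "bag_state Ow0 Ow B Cf s' = bag_state Ow0 Ow B Cf s" unfolding bag_state_def sizes_def by (simp only:)
  then show ?thesis using assms(1) by simp
qed

lemma wp_hand:
  assumes st: "bag_state Ow0 Ow B Cf s" and i: "s ''i'' 0 = of_nat i" "i \<in> {1..n}"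
  shows "wp hand_com (\<lambda>s'. bag_state Ow0 (\<lambda>g. if g \<in> B then i else Ow g) {} Cf s') s"
  unfolding hand_com_def
proof (rule wp_For[where b = "m + 1" and I = "\<lambda>j s'. \<forall>g\<in>{1..m}.
    s' ''owner'' (int g) = (if g \<in> B \<and> g < j then of_nat i else of_nat (Ow g)) \<and>
    s' ''X'' (int g) = (if g \<in> B \<and> j \<le> g then 1 else 0)"], goal_cases)
  case 1
  show ?case using st unfolding bag_state_def by auto
next
  case (3 s')
  then show ?case using 3[of "''m''"] st by (simp add: bag_state_def sizes_def)
next
  case (7 j s')
  have i': "s' ''i'' 0 = of_nat i" using 7(5)[of "''i''"] i by simp
  have sz: "rat_size (of_nat i) \<le> Y" using rat_size_of_nat[of i] i n_le by simp
  have j: "j \<in> {1..m}" using 7 by auto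
  have X: "s' ''X'' (int j) = (if j \<in> B then 1 else 0)" using 7(3) j by auto
  show ?case
  proof (intro wp_If wp_Seq wp_Assign wp_Skip, goal_cases)
    case 3
    then have "j \<in> B" using X 7(4) by (simp split: if_splits)
    then show ?case using 7(3,4) i' by (auto simp: less_Suc_eq)
  next
    case 4
    then have "j \<notin> B" using X 7(4) by (simp split: if_splits)
    then have "g \<in> B \<and> g < Suc j \<longleftrightarrow> g \<in> B \<and> g < j" "g \<in> B \<and> Suc j \<le>
      g \<longleftrightarrow> g \<in> B \<and> j \<le> g" for g
      by (auto simp: less_Suc_eq) (metis Suc_leI le_neq_implies_less)
    then show ?case using 7(3) by (simp only:)
  qed (use i' sz const_bounds in simp_all)
next
  case (8 s')
  have fr: "s' x = s x" if "x \<in> {''n'', ''m'', ''C'', ''R''}" for x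
    using 8(2)[of x] that by auto
  have "sizes s'" using st fr unfolding bag_state_def sizes_def by simp
  then show ?case using 8(1) st fr[of "''C''"] fr[of "''R''"] unfolding bag_state_def by auto
qed (use m_le in auto)

lemma wp_offer:
  assumes st: "bag_state Ow0 Ow0' B0 Cf0 s" and inv: "bag_inv Ow0 C0 D {} Ow0' B0 T0 Cf0"
    and C0: "\<And>i. i \<in> {1..n} \<Longrightarrow> 0 \<le> C0 i"
  shows "wp offer_com (\<lambda>s'. \<exists>Ow B T Cf. bag_state Ow0 Ow B Cf s' \<and> bag_inv Ow0 C0 D {1..n} Ow B T Cf) s"
  unfolding offer_com_def
proof (rule wp_For[where b = "n + 1" and I = "\<lambda>j s'. \<exists>Ow B T Cf. bag_state Ow0 Ow B Cf s' \<and>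
    bag_inv Ow0 C0 D {1..<j} Ow B T Cf"], goal_cases)
  case 1
  show ?case using st inv by auto
next
  case (2 j s q)
  then obtain Ow B T Cf where "bag_state Ow0 Ow B Cf s" "bag_inv Ow0 C0 D {1..<j} Ow B T Cf" by blast
  moreover from this(1) have "bag_state Ow0 Ow B Cf (store_update s ''i'' 0 q)"
    by (rule bag_state_cong) auto
  ultimately show ?case by blast
next
  case (3 s')
  then show ?case using 3[of "''n''"] st by (simp add: bag_state_def sizes_def hand_com_def)
next
  case (7 i s')
  then obtain Ow B T Cf where st': "bag_state Ow0 Ow B Cf s'" and inv': "bag_inv Ow0 C0 D {1..<i} Ow B T Cf"
    by blast
  have i: "i \<in> {1..n}" using 7 by auto
  have BR: "B \<subseteq> {1..m}" using inv' unfolding bag_inv_def free_goods_def by auto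
  then have goods: "goods_of m (s' ''X'') = B" using st' unfolding bag_state_def goods_of_def
    by (auto split: if_splits)
  then have ans: "answer n v \<lfloor>aval (var ''i'') s'\<rfloor> (goods_of m (s' ''X'')) = v i B"
    using i 7(4) by (simp add: answer_def)
  have Suc: "{1..<Suc i} = insert i {1..<i}" using i by auto
  have sz: "rat_size (v i B) \<le> Y" using answers_bounded i BR by blast
  let ?guard = "And (Less (Times (Times (Const 2) (var ''n'')) (Cell ''C'' (var ''i''))) (Cell ''R'' (var ''i'')))
     (Not (Less (Times (Times (Const 2) (var ''n'')) (var ''y'')) (Cell ''R'' (var ''i''))))"
  let ?Q = "\<lambda>s'. \<exists>Ow B T Cf. bag_state Ow0 Ow B Cf s' \<and> bag_inv Ow0 C0 D {1..<Suc i} Ow B T Cf"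
  define s1 where "s1 = store_update s' ''y'' 0 (v i B)"
  have st1: "bag_state Ow0 Ow B Cf s1" using st' by (rule bag_state_cong) (auto simp: s1_def)
  have s1: "s1 ''n'' 0 = of_nat n" "s1 ''C'' (int i) = Cf i" "s1 ''R'' (int i) = rest_value Ow0 i"
    "s1 ''i'' 0 = of_nat i" "s1 ''y'' 0 = v i B"
    using st1 i 7(4) unfolding bag_state_def sizes_def by (auto simp: s1_def)
  have "wp (If (?guard)
          (hand_com ;; Assign ''C'' (var ''i'') (var ''y''))
          Skip) ?Q s1"
  proof (rule wp_If)
    assume "bval (?guard) s1"
    then have h: "hungry Ow0 Cf i" "rest_value Ow0 i \<le> 2 * of_nat n * v i B"
      using s1 by (simp_all add: hungry_def not_less)
    let ?Ow = "\<lambda>g. if g \<in> B then i else Ow g"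
    have inv'': "bag_inv Ow0 C0 D {1..<Suc i} ?Ow {} (insert i T) (Cf(i := v i B))"
      by (rule bag_inv_hand[OF inv' i h C0])
    show "wp (hand_com ;; Assign ''C'' (var ''i'') (var ''y''))
      ?Q s1"
    proof (rule wp_Seq, rule wp_frame[OF wp_hand[OF st1 s1(4) i]], goal_cases)
      case (1 s2)
      have s2: "s2 ''i'' 0 = of_nat i" "s2 ''y'' 0 = v i B"
        using 1(2)[of "''i''"] 1(2)[of "''y''"] s1 by (simp_all add: hand_com_def)
      have "bag_state Ow0 ?Ow {} (Cf(i := v i B)) (store_update s2 ''C'' (int i) (v i B))"
        using 1(1) unfolding bag_state_def sizes_def by simp
      then show ?case using inv'' sz s2 by (intro wp_Assign) auto
    qed
  next
    assume "\<not> bval (?guard) s1"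
    then have "\<not> (hungry Ow0 Cf i \<and> rest_value Ow0 i \<le> 2 * of_nat n * v i B)"
      using s1 by (simp add: hungry_def not_less)
    then have "bag_inv Ow0 C0 D {1..<Suc i} Ow B T Cf"
      unfolding Suc by (rule bag_inv_decline[OF inv'])
    then show "wp Skip ?Q s1"
      using st1 by (intro wp_Skip) blast
  qed
  then show ?case by (intro wp_Seq wp_Query) (simp only: ans s1_def)
next
  case (8 s')
  have "{1..<n + 1} = {1..n}" by auto
  then show ?case using 8(1) by simp
qed (use n_le in \<open>auto simp: hand_com_def\<close>)

lemma wp_bag:
  assumes sz: "sizes s" and A: "is_matching n m A Ow0" "holds_matching n m v A Ow0 s"
    and stable: "\<forall>i\<in>{1..n}. \<forall>g\<in>free_goods m Ow0. v i {g} \<le> own_value v A i"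
  shows "wp bag_com (\<lambda>s'. \<exists>Ow. (\<forall>g\<in>{1..m}. s' ''owner'' (int g) = of_nat (Ow g) \<and>
      Ow g \<in> {1..n}) \<and>
     (\<forall>i\<in>{1..n}. own_value v A i \<le> v i (bundle_of m Ow i) \<and>
        rest_value Ow0 i \<le> 2 * of_nat n * v i (bundle_of m Ow i))) s"
proof -
  let ?C0 = "own_value v A" and ?R = "free_goods m Ow0"
  have own: "s ''owner'' (int g) = of_nat (Ow0 g)" if "g \<in> {1..m}" for g
    using A(2) that unfolding holds_matching_def by blast
  have C0: "0 \<le> ?C0 i" if "i \<in> {1..n}" for i
    using A(1) that nonneg[OF that, of "{A i}"] unfolding own_value_def is_matching_def by auto
  have w1: "wp (For ''g'' 1 (Plus (var ''m'') (Const 1))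
        (If (Less (Const 0) (Cell ''owner'' (var ''g'')))
          (Assign ''X'' (var ''g'') (Const 0)) (Assign ''X'' (var ''g'') (Const 1))))
      (\<lambda>s'. goods_of m (s' ''X'') = ?R) s"
  proof (rule wp_For[where b = "m + 1" and I = "\<lambda>j s'. \<forall>g\<in>{1..m}. g < j \<longrightarrow>
      s' ''X'' (int g) = (if Ow0 g = 0 then 1 else 0)"], goal_cases)
    case (3 s')
    then show ?case using 3[of "''m''"] sz by (simp add: sizes_def)
  next
    case (7 j s')
    have "s' ''owner'' (int j) = of_nat (Ow0 j)" using 7(5)[of "''owner''"] own[of j] 7(1,2) by simp
    then have b: "bval (Less (Const 0) (Cell ''owner'' (var ''g''))) s' \<longleftrightarrow> Ow0 j \<noteq> 0"
      using 7(4) by simp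
    have X: "s' ''X'' (int g) = (if Ow0 g = 0 then 1 else 0)" if "g \<in> {1..m}" "g < j" for g
      using 7(3) that by blast
    show ?case
    proof (intro wp_If wp_Assign ballI impI, goal_cases)
      case (2 g)
      then show ?case using X[of g] 7(4) unfolding b by (cases "g = j") simp_all
    next
      case (4 g)
      then show ?case using X[of g] 7(4) unfolding b by (cases "g = j") simp_all
    qed (use const_bounds in simp_all)
  next
    case (8 s')
    have "s' ''X'' (int g) \<noteq> 0 \<longleftrightarrow> Ow0 g = 0" if "g \<in> {1..m}" for g
      using 8(1) that by (simp split: if_splits)
    then show ?case unfolding goods_of_def free_goods_def by blast
  qed (use m_le in auto)
  have w2: "wp (For ''i'' 1 (Plus (var ''n'') (Const 1))
        (Query ''y'' (var ''i'') ''X'' ;; Assign ''R'' (var ''i'') (var ''y'')))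
      (\<lambda>s'. \<forall>i\<in>{1..n}. s' ''R'' (int i) = rest_value Ow0 i) s1"
    if s1: "sizes s1" "goods_of m (s1 ''X'') = ?R" for s1
  proof (rule wp_For[where b = "n + 1" and I = "\<lambda>j s'. \<forall>i\<in>{1..n}. i < j \<longrightarrow>
      s' ''R'' (int i) = rest_value Ow0 i"], goal_cases)
    case (3 s')
    then show ?case using 3[of "''n''"] s1 by (simp add: sizes_def)
  next
    case (7 j s')
    have "s' ''X'' = s1 ''X''" using 7(5)[of "''X''"] by simp
    then have ans: "answer n v \<lfloor>aval (var ''i'') s'\<rfloor> (goods_of m (s' ''X'')) = rest_value Ow0 j"
      using 7(1,2,4) s1 by (simp add: answer_def rest_value_def)
    have "rat_size (rest_value Ow0 j) \<le> Y" unfolding rest_value_def free_goods_def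
      using 7(1,2) by (intro answers_bounded) auto
    then show ?case
      by (intro wp_Seq wp_Query wp_Assign) (use ans 7(3,4) in \<open>auto simp: less_Suc_eq\<close>)
  qed (use n_le in auto)
  have w3: "wp (For ''g'' 1 (Plus (var ''m'') (Const 1)) (Assign ''X'' (var ''g'') (Const 0)))
      (\<lambda>s'. \<forall>g\<in>{1..m}. s' ''X'' (int g) = 0) s1" if s1: "sizes s1" for s1
  proof (rule wp_For[where b = "m + 1" and I = "\<lambda>j s'. \<forall>g\<in>{1..m}. g < j \<longrightarrow>
    s' ''X'' (int g) = 0"], goal_cases)
    case (3 s')
    then show ?case using 3[of "''m''"] s1 by (simp add: sizes_def)
  next
    case (7 j s')
    then show ?case by (intro wp_Assign) (use const_bounds in \<open>auto simp: less_Suc_eq\<close>)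
  qed (use m_le in auto)
  let ?D = "\<lambda>j. {g \<in> ?R. g < j}"
  let ?I = "\<lambda>j s. \<exists>Ow B T Cf. bag_state Ow0 Ow B Cf s \<and> bag_inv Ow0 ?C0 (?D j) {1..n} Ow B T Cf"
  have w4: "wp (For ''g'' 1 (Plus (var ''m'') (Const 1))
        (If (Less (Const 0) (Cell ''owner'' (var ''g'')))
          Skip (Assign ''X'' (var ''g'') (Const 1) ;; offer_com))) (?I (m + 1)) s1"
    if s1: "bag_state Ow0 Ow0 {} ?C0 s1" for s1
  proof (rule wp_For[where b = "m + 1" and I = ?I], goal_cases)
    case 1
    have "own_value v A i \<le> v i (bundle_of m Ow0 i)" if i: "i \<in> {1..n}" for i
    proof (cases "A i = 0")
      case True
      then show ?thesis unfolding own_value_def using nonneg[OF i bundle_of_subset] by simp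
    next
      case False
      then have "{A i} \<subseteq> bundle_of m Ow0 i" using A(1) i unfolding is_matching_def bundle_of_def by auto
      then show ?thesis unfolding own_value_def using False mono[OF i _ bundle_of_subset] by simp
    qed
    moreover have "0 < rest_value Ow0 i" if "i \<in> {1..n}" "hungry Ow0 ?C0 i" for i
    proof -
      have "0 \<le> 2 * of_nat n * ?C0 i" using C0[OF that(1)] by simp
      then show ?thesis using that(2) unfolding hungry_def by linarith
    qed
    moreover have "handed Ow0 Ow0 = {}" "?D 1 = {}" unfolding handed_def free_goods_def by auto
    ultimately have "bag_inv Ow0 ?C0 (?D 1) {1..n} Ow0 {} {} ?C0"
      using A(1) norm unfolding bag_inv_def is_matching_def by (auto intro: less_imp_le)
    then show ?case using s1 by blast
  next
    case (2 j s q)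
    then obtain Ow B T Cf where "bag_state Ow0 Ow B Cf s" "bag_inv Ow0 ?C0 (?D j) {1..n} Ow B T Cf" by blast
    moreover from this(1) have "bag_state Ow0 Ow B Cf (store_update s ''g'' 0 q)"
      by (rule bag_state_cong) auto
    ultimately show ?case by blast
  next
    case (3 s')
    then show ?case using 3[of "''m''"] s1 by (simp add: bag_state_def sizes_def offer_com_def hand_com_def)
  next
    case (7 j s')
    then obtain Ow B T Cf where st: "bag_state Ow0 Ow B Cf s'" and inv: "bag_inv Ow0 ?C0 (?D j) {1..n} Ow B T Cf"
      by blast
    have j: "j \<in> {1..m}" using 7 by auto
    have owj: "s' ''owner'' (int j) = of_nat (Ow j)" using st j unfolding bag_state_def by blast
    \<comment> \<open>All goods handed out so far lie in \<open>?D j\<close>, hence before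
      \<open>j\<close>; so the program may test the current owner to recognise the goods that were
      unmatched at the start.\<close>
    have Ow_eq: "Ow j = 0 \<longleftrightarrow> j \<in> ?R"
    proof
      assume "Ow j = 0"
      then show "j \<in> ?R" using inv j unfolding bag_inv_def free_goods_def by force
    next
      assume "j \<in> ?R"
      moreover have "j \<notin> handed Ow0 Ow" using inv unfolding bag_inv_def by auto
      ultimately show "Ow j = 0" unfolding handed_def by auto
    qed
    show ?case
    proof (rule wp_If)
      assume "bval (Less (Const 0) (Cell ''owner'' (var ''g''))) s'"
      then have "j \<notin> ?R" using owj 7(4) Ow_eq by simp
      then have "?D (Suc j) = ?D j" by (auto simp: less_Suc_eq)
      then show "wp Skip (?I (Suc j)) s'" using st inv by (intro wp_Skip) auto
    next
      assume "\<not> bval (Less (Const 0) (Cell ''owner'' (var ''g''))) s'"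
      then have jR: "j \<in> ?R" using owj 7(4) Ow_eq by simp
      have D: "?D (Suc j) = insert j (?D j)" using jR by (auto simp: less_Suc_eq)
      have inv': "bag_inv Ow0 ?C0 (?D (Suc j)) {} Ow (insert j B) T Cf"
        unfolding D by (rule bag_inv_add[OF inv jR]) (use stable jR in auto)
      have st': "bag_state Ow0 Ow (insert j B) Cf (store_update s' ''X'' (int j) 1)"
        using st unfolding bag_state_def sizes_def by auto
      have "wp offer_com (?I (Suc j)) (store_update s' ''X'' (int j) 1)"
        using wp_offer[OF st' inv' C0] by blast
      then show "wp (Assign ''X'' (var ''g'') (Const 1) ;; offer_com) (?I (Suc j)) s'"
        by (intro wp_Seq wp_Assign) (use 7(4) const_bounds in simp_all)
    qed
  qed (use m_le in \<open>auto simp: offer_com_def hand_com_def\<close>)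
  let ?Q = "\<lambda>s'. \<exists>Ow. (\<forall>g\<in>{1..m}. s' ''owner'' (int g) = of_nat (Ow g) \<and>
      Ow g \<in> {1..n}) \<and>
     (\<forall>i\<in>{1..n}. own_value v A i \<le> v i (bundle_of m Ow i) \<and>
        rest_value Ow0 i \<le> 2 * of_nat n * v i (bundle_of m Ow i))"
  have w5: "wp (For ''g'' 1 (Plus (var ''m'') (Const 1))
        (If (Less (Const 0) (Cell ''owner'' (var ''g'')))
          Skip (Assign ''owner'' (var ''g'') (Const 1)))) ?Q s1"
    if I: "?I (m + 1) s1" for s1
  proof -
    have D: "?D (m + 1) = ?R" unfolding free_goods_def by auto
    obtain Ow B T Cf where st: "bag_state Ow0 Ow B Cf s1" and inv: "bag_inv Ow0 ?C0 ?R {1..n} Ow B T Cf"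
      using I unfolding D by blast
    \<comment> \<open>The goods of the last bag go to agent 1; by monotonicity no agent
      loses.\<close>
    let ?Ow = "\<lambda>g. if Ow g = 0 then 1 else Ow g"
    have good: "?C0 i \<le> v i (bundle_of m ?Ow i) \<and> rest_value Ow0 i \<le> 2 * of_nat n * v i (bundle_of m ?Ow i)"
      if i: "i \<in> {1..n}" for i
    proof -
      have C: "?C0 i \<le> Cf i" "Cf i \<le> v i (bundle_of m Ow i)" using inv i unfolding bag_inv_def by auto
      have "v i (bundle_of m Ow i) \<le> v i (bundle_of m ?Ow i)"
        using i by (intro mono) (auto simp: bundle_of_def)
      then have le: "Cf i \<le> v i (bundle_of m ?Ow i)" using C by simp
      have "rest_value Ow0 i \<le> 2 * of_nat n * Cf i"
        using bag_inv_final[OF inv i] unfolding hungry_def by simp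
      also have "\<dots> \<le> 2 * of_nat n * v i (bundle_of m ?Ow i)" using le by (intro mult_left_mono) auto
      finally show ?thesis using le C(1) by simp
    qed
    show ?thesis
    proof (rule wp_For[where b = "m + 1" and I = "\<lambda>j s'. \<forall>g\<in>{1..m}.
        s' ''owner'' (int g) = (if g < j then of_nat (?Ow g) else of_nat (Ow g))"], goal_cases)
      case 1
      show ?case using st unfolding bag_state_def by auto
    next
      case (3 s')
      then show ?case using 3[of "''m''"] st by (simp add: bag_state_def sizes_def)
    next
      case (7 j s')
      have "s' ''owner'' (int j) = of_nat (Ow j)" using 7(1,2,3) by simp
      then show ?case
        by (intro wp_If wp_Assign wp_Skip) (use 7(3,4) const_bounds in \<open>auto simp: less_Suc_eq\<close>)
    next
      case (8 s')
      have "?Ow g \<in> {1..n}" if "g \<in> {1..m}" for g using inv that n unfolding bag_inv_def by auto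
      then show ?case using 8(1) good by (intro exI[of _ ?Ow]) auto
    qed (use m_le in auto)
  qed
  show ?thesis unfolding bag_com_def
  proof (intro wp_Seq, rule wp_frame[OF w1], goal_cases)
    case (1 s1)
    have fr1: "s1 x = s x" if "x \<in> {''n'', ''m'', ''owner'', ''C''}" for x
      using 1(2)[of x] that by auto
    have sz1: "sizes s1" using sz fr1 unfolding sizes_def by simp
    show ?case
    proof (intro wp_Seq, rule wp_frame[OF w2[OF sz1 1(1)]], goal_cases)
      case (1 s2)
      have fr2: "s2 x = s x" if "x \<in> {''n'', ''m'', ''owner'', ''C''}" for x
        using 1(2)[of x] fr1[OF that] that by auto
      have sz2: "sizes s2" using sz fr2 unfolding sizes_def by simp
      show ?case
      proof (intro wp_Seq, rule wp_frame[OF w3[OF sz2]], goal_cases)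
        case (1 s3)
        have fr3: "s3 x = s x" if "x \<in> {''n'', ''m'', ''owner'', ''C''}" for x
          using 1(2)[of x] fr2[OF that] that by auto
        have R3: "s3 ''R'' = s2 ''R''" using 1(2)[of "''R''"] by simp
        have "sizes s3" using sz fr3 unfolding sizes_def by simp
        then have "bag_state Ow0 Ow0 {} ?C0 s3"
          using A(2) fr3[of "''owner''"] fr3[of "''C''"] R3 1(1) \<open>\<forall>i\<in>{1..n}. s2 ''R'' (int i) = rest_value Ow0 i\<close>
          unfolding bag_state_def holds_matching_def by simp
        then show ?case
          by (intro wp_Seq, intro wp_mono[OF w4] w5)
      qed
    qed
  qed
qed

end

section \<open>Approximation guarantee\<close>

lemma rank_less:
  assumes "h \<in> {1..m}" "f g < f h \<or> f g = f h \<and> h < g"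
  shows "rank m f h < rank m f g"
  unfolding rank_def
proof (rule psubset_card_mono)
  let ?S = "\<lambda>g. {h \<in> {1..m}. f g < f h \<or> f g = f h \<and> h < g}"
  have "h \<in> ?S g" "h \<notin> ?S h" using assms by auto
  moreover have "?S h \<subseteq> ?S g" using assms by auto
  ultimately show "?S h \<subset> ?S g" by blast
qed simp

text \<open>With ties broken by index the order is total, so ranks are distinct and inject the top
  goods into the numbers below \<open>n\<close>.\<close>

lemma card_top_goods: "card ({1..m} - low_goods n m f) \<le> n"
proof -
  have "inj_on (rank m f) {1..m}"
  proof (rule inj_onI, rule ccontr)
    fix g h assume gh: "g \<in> {1..m}" "h \<in> {1..m}" "rank m f g = rank m f h" "g \<noteq> h"
    then have "(f g < f h \<or> f g = f h \<and> h < g) \<or> (f h < f g \<or> f h = f g \<and> g < h)" by force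
    then show False using rank_less[of h m f g] rank_less[of g m f h] gh by force
  qed
  then have "inj_on (rank m f) ({1..m} - low_goods n m f)" by (rule inj_on_subset) auto
  moreover have "rank m f ` ({1..m} - low_goods n m f) \<subseteq> {..<n}" unfolding low_goods_def by auto
  ultimately have "card ({1..m} - low_goods n m f) \<le> card {..<n}" by (intro card_inj_on_le) auto
  then show ?thesis by simp
qed

context subadditive_bound
begin

lemma value_le_sum:
  assumes i: "i \<in> {1..n}" and "finite S" "S \<subseteq> {1..m}"
  shows "v i S \<le> (\<Sum>g\<in>S. v i {g})"
  using assms(2,3)
proof (induction S rule: finite_induct)
  case empty
  then show ?case using norm[OF i] by simp
next
  case (insert g S)
  have "v i (insert g S) \<le> v i {g} + v i S" using subadd[OF i, of "{g}" S] insert by simp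
  then show ?case using insert by simp
qed

lemma low_goods_subset: "low_goods n m f \<subseteq> {1..m}"
  by (auto simp: low_goods_def)

text \<open>Split the bundle into top goods and low goods. There are at most \<open>n\<close> top
  goods, each worth at most the best good \<open>g\<close> of the bundle, and the low goods are
  worth at most all low goods together.\<close>

lemma bundle_le_potential:
  assumes i: "i \<in> {1..n}" and S: "S \<subseteq> {1..m}" "S \<noteq> {}"
  obtains g where "g \<in> S" "v i S \<le> potential i g"
proof -
  have fin: "finite S" using S finite_subset by blast
  obtain g where g: "g \<in> S" "\<And>h. h \<in> S \<Longrightarrow> v i {h} \<le> v i {g}"
  proof -
    have "Max ((\<lambda>h. v i {h}) ` S) \<in> (\<lambda>h. v i {h}) ` S" using fin S by (intro Max_in) auto
    then obtain g where "g \<in> S" "v i {g} = Max ((\<lambda>h. v i {h}) ` S)" by auto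
    then show ?thesis using that fin by simp
  qed
  let ?L = "low_goods n m (\<lambda>g. v i {g})"
  have g0: "0 \<le> v i {g}" using nonneg[OF i, of "{g}"] g S by auto
  have "v i S \<le> v i ((S - ?L) \<union> ?L)" using S low_goods_subset by (intro mono[OF i]) blast+
  also have "\<dots> \<le> v i (S - ?L) + v i ?L" using S low_goods_subset by (intro subadd[OF i]) blast+
  also have "v i (S - ?L) \<le> (\<Sum>h\<in>S - ?L. v i {h})" using S fin by (intro value_le_sum[OF i]) auto
  also have "\<dots> \<le> of_nat (card (S - ?L)) * v i {g}" using g by (intro sum_bounded_above) auto
  also have "\<dots> \<le> of_nat n * v i {g}"
  proof (rule mult_right_mono[OF _ g0])
    have "card (S - ?L) \<le> card ({1..m} - ?L)" using S by (intro card_mono) auto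
    also have "\<dots> \<le> n" by (rule card_top_goods)
    finally show "rat_of_nat (card (S - ?L)) \<le> of_nat n" by simp
  qed
  finally have "v i S \<le> potential i g" unfolding potential_def low_value_def by simp
  then show ?thesis using g(1) that by blast
qed

lemma card_matched_goods:
  assumes "is_matching n m A Ow"
  shows "card {g \<in> {1..m}. Ow g \<noteq> 0} \<le> n"
proof -
  have "{g \<in> {1..m}. Ow g \<noteq> 0} \<subseteq> A ` {1..n}"
  proof
    fix g assume "g \<in> {g \<in> {1..m}. Ow g \<noteq> 0}"
    then have "Ow g \<in> {1..n}" "A (Ow g) = g" using assms unfolding is_matching_def by auto
    then show "g \<in> A ` {1..n}" by (metis imageI)
  qed
  then have "card {g \<in> {1..m}. Ow g \<noteq> 0} \<le> card (A ` {1..n})" by (intro card_mono) auto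
  also have "\<dots> \<le> card {1..n}" by (rule card_image_le) simp
  finally show ?thesis by simp
qed

text \<open>A pigeonhole argument on the matched low goods: such a good \<open>g\<close> has at
  least \<open>n\<close> goods ranked before it, but at most \<open>n - 1\<close> goods other than
  \<open>g\<close> are matched. So some good at least as valuable as \<open>g\<close> is unmatched
  and, by stability, worth at most the agent's own good. At most \<open>n\<close> low goods are
  matched, and all others belong to the unmatched goods.\<close>

lemma low_value_le:
  assumes A: "is_matching n m A Ow" and i: "i \<in> {1..n}"
    and stable: "\<And>g. g \<in> free_goods m Ow \<Longrightarrow> v i {g} \<le> own_value v A i"
  shows "low_value i \<le> rest_value Ow i + of_nat n * own_value v A i"
proof -
  let ?L = "low_goods n m (\<lambda>g. v i {g})" and ?R = "free_goods m Ow"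
  let ?M = "{g \<in> {1..m}. Ow g \<noteq> 0}"
  have own0: "0 \<le> own_value v A i"
    using A i nonneg[OF i, of "{A i}"] unfolding own_value_def is_matching_def by auto
  have single: "v i {g} \<le> own_value v A i" if g: "g \<in> ?L - ?R" for g
  proof -
    let ?S = "{h \<in> {1..m}. v i {g} < v i {h} \<or> v i {g} = v i {h} \<and> h < g}"
    have gM: "g \<in> ?M" using g unfolding low_goods_def free_goods_def by auto
    have card: "n \<le> card ?S" using g unfolding low_goods_def rank_def by auto
    have "\<not> ?S \<subseteq> ?M - {g}"
    proof
      assume "?S \<subseteq> ?M - {g}"
      then have "card ?S \<le> card (?M - {g})" by (intro card_mono) auto
      also have "\<dots> < card ?M" using gM by (intro card_Diff1_less) auto
      finally show False using card card_matched_goods[OF A] by linarith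
    qed
    then obtain h where h: "h \<in> ?S" "h \<notin> ?M - {g}" by blast
    then have "h \<in> ?R" unfolding free_goods_def by auto
    then have "v i {h} \<le> own_value v A i" by (rule stable)
    then show ?thesis using h by auto
  qed
  have fin: "finite (?L - ?R)" "?L - ?R \<subseteq> {1..m}" "?R \<subseteq> {1..m}" "?L - ?R \<subseteq> ?M"
    using low_goods_subset[of "\<lambda>g. v i {g}"] finite_subset[OF low_goods_subset]
    by (auto simp: free_goods_def)
  have "v i ?L \<le> v i (?R \<union> (?L - ?R))" using low_goods_subset fin by (intro mono[OF i]) blast+
  also have "\<dots> \<le> v i ?R + v i (?L - ?R)" using fin by (intro subadd[OF i])
  also have "v i (?L - ?R) \<le> (\<Sum>g\<in>?L - ?R. v i {g})" using fin by (intro value_le_sum[OF i])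
  also have "\<dots> \<le> of_nat (card (?L - ?R)) * own_value v A i" using single by (intro sum_bounded_above) auto
  also have "\<dots> \<le> of_nat n * own_value v A i"
  proof (rule mult_right_mono[OF _ own0])
    have "card (?L - ?R) \<le> card ?M" using fin by (intro card_mono) auto
    then show "rat_of_nat (card (?L - ?R)) \<le> of_nat n" using card_matched_goods[OF A] by simp
  qed
  finally show ?thesis unfolding low_value_def rest_value_def by simp
qed

text \<open>The factor 4 adds up as follows: \<open>n * b\<close> for the good from the auction,
  \<open>2 * n * b\<close> for the unmatched goods, and \<open>n * b\<close> for the matched low
  goods.\<close>

lemma potential_le_bundle:
  assumes A: "is_matching n m A Ow" and i: "i \<in> {1..n}"
    and stable: "\<And>g. g \<in> free_goods m Ow \<Longrightarrow> v i {g} \<le> own_value v A i"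
    and A0: "A0 i \<noteq> 0" "own_value v A0 i \<le> own_value v A i"
    and b: "own_value v A i \<le> b" "rest_value Ow i \<le> 2 * of_nat n * b"
  shows "potential i (A0 i) \<le> 4 * of_nat n * b"
proof -
  have "of_nat n * own_value v A0 i \<le> of_nat n * b" "of_nat n * own_value v A i \<le> of_nat n * b"
    using A0 b by (auto intro!: mult_left_mono)
  moreover have "potential i (A0 i) = of_nat n * own_value v A0 i + low_value i"
    using A0 by (simp add: potential_def own_value_def)
  ultimately show ?thesis using low_value_le[OF A i stable] b by (simp add: algebra_simps)
qed

end

lemma of_int_le_two_power_square: "\<bar>real_of_int l\<bar> \<le> 2 ^ nat (l * l)"
proof -
  have "\<bar>l\<bar> \<le> \<bar>l\<bar> * \<bar>l\<bar>"
    by (cases "l = 0") (use mult_mono[of 1 "\<bar>l\<bar>" "\<bar>l\<bar>" "\<bar>l\<bar>"] in auto)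
  then have "\<bar>l\<bar> \<le> l * l" by (simp only: abs_mult_self_eq)
  then have "\<bar>real_of_int l\<bar> \<le> real (nat (l * l))" by linarith
  also have "\<dots> \<le> 2 ^ nat (l * l)" using less_exp[of "nat (l * l)"]
    by (metis less_imp_le of_nat_le_iff of_nat_numeral of_nat_power)
  finally show ?thesis .
qed

text \<open>Three errors: rounding the logarithm costs \<open>abs \<theta>\<close>, truncating
  \<open>p\<close> costs 1 because of the \<open>l * l\<close> digits, and the final floor costs
  1.\<close>

lemma cost_exponent_approx:
  assumes G: "G \<ge> 1" and u: "u > 0" and a: "\<bar>a\<bar> \<le> 1"
    and th: "\<theta> = real_of_rat a * p + real_of_rat b"
  shows "\<bar>real_of_int (cost_exponent p a b (level G u)) - \<theta> * log (real_of_rat (gam G)) (real_of_rat u)\<bar> \<le> \<bar>\<theta>\<bar> + 2"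
proof -
  let ?lu = "log (real_of_rat (gam G)) (real_of_rat u)" and ?l = "level G u"
  let ?t = "truncated p (nat (?l * ?l))"
  have l: "\<bar>real_of_int ?l - ?lu\<bar> \<le> 1" unfolding level_def by linarith
  have t: "\<bar>real_of_rat ?t - p\<bar> \<le> 1 / 2 ^ nat (?l * ?l)"
    using truncated_bounds[where p = p and k = "nat (?l * ?l)"] by linarith
  have "\<bar>(real_of_rat ?t - p) * real_of_int ?l\<bar> \<le> 1 / 2 ^ nat (?l * ?l) * 2 ^ nat (?l * ?l)"
    unfolding abs_mult by (intro mult_mono t of_int_le_two_power_square) auto
  then have 1: "\<bar>(real_of_rat ?t - p) * real_of_int ?l\<bar> \<le> 1" by simp
  have "\<bar>real_of_rat a\<bar> \<le> 1" using a by (metis abs_of_rat of_rat_1 of_rat_less_eq)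
  then have "\<bar>real_of_rat a\<bar> * \<bar>(real_of_rat ?t - p) * real_of_int ?l\<bar> \<le> 1 * 1"
    using 1 by (intro mult_mono) auto
  then have 2: "\<bar>real_of_rat a * ((real_of_rat ?t - p) * real_of_int ?l)\<bar> \<le> 1" by (simp add: abs_mult)
  have 3: "\<bar>\<theta> * (real_of_int ?l - ?lu)\<bar> \<le> \<bar>\<theta>\<bar>"
    unfolding abs_mult using l mult_left_mono[OF l, of "\<bar>\<theta>\<bar>"] by simp
  let ?x = "(a * ?t + b) * of_int ?l"
  have x: "real_of_rat ?x = (real_of_rat a * real_of_rat ?t + real_of_rat b) * real_of_int ?l"
    by (simp add: of_rat_mult of_rat_add)
  have fl: "\<bar>real_of_int \<lfloor>?x\<rfloor> - real_of_rat ?x\<bar> \<le> 1"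
  proof -
    have "of_int \<lfloor>?x\<rfloor> \<le> ?x" "?x < of_int \<lfloor>?x\<rfloor> + 1" by linarith+
    then have "real_of_rat (of_int \<lfloor>?x\<rfloor>) \<le>
      real_of_rat ?x" "real_of_rat ?x < real_of_rat (of_int \<lfloor>?x\<rfloor> + 1)"
      by (simp_all only: of_rat_less_eq of_rat_less)
    then show ?thesis by (simp add: of_rat_add)
  qed
  have "real_of_rat ?x - \<theta> * ?lu =
      real_of_rat a * ((real_of_rat ?t - p) * real_of_int ?l) + \<theta> * (real_of_int ?l - ?lu)"
    unfolding x th by (simp add: algebra_simps)
  then show ?thesis using 2 3 fl unfolding cost_exponent_def by linarith
qed

section \<open>Accuracy of the matching\<close>

text \<open>In \<open>accuracy\<close>, the exponent \<open>2 * (abs \<theta> + 2)\<close> pays for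
  replacing potentials by powers of \<open>gam G\<close> and back, the additional 1 for the loss of
  1 per agent in the auction when \<open>p = 0\<close>, and the factor \<open>1 + 8 / H\<close> for
  auction and rounding when \<open>p\<close> is not 0. The right-hand side is the factor 2 of the
  matching in terms of powers with exponent \<theta>.\<close>

locale matching_analysis = table_bound +
  fixes \<theta> :: real and k D :: nat and l :: int
  assumes theta: "\<theta> = real_of_rat ca * p + real_of_rat cb"
    and H: "4 \<le> H" and n1: "1 \<le> n"
    and accuracy: "real_of_rat (gam G) powr (2 * (\<bar>\<theta>\<bar> + 2) + 1) * (1 + 8 / real H) \<le>
        2 powr \<bar>\<theta>\<bar>"
    and expo_k: "\<And>i g. i \<in> {1..n} \<Longrightarrow> g \<in> {1..m} \<Longrightarrow>
        0 < potential i g \<Longrightarrow> \<bar>expo i g\<bar> \<le> int k"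
    and expo_l: "\<And>i g. i \<in> {1..n} \<Longrightarrow> g \<in> {1..m} \<Longrightarrow>
        0 < potential i g \<Longrightarrow> l \<le> expo i g"
    and l_expo: "\<And>i g. i \<in> {1..n} \<Longrightarrow> g \<in> {1..m} \<Longrightarrow> 0 < potential i g \<Longrightarrow>
      \<exists>i\<in>{1..n}. \<exists>g\<in>{1..m}. 0 < potential i g \<and> expo i g = l"
    and D: "D = depth_of k"
begin

abbreviation \<gamma> :: real where
  "\<gamma> \<equiv> real_of_rat (gam G)"

abbreviation pot :: "nat \<Rightarrow> nat \<Rightarrow> real" where
  "pot i g \<equiv> real_of_rat (potential i g)"

lemma gamma: "1 < \<gamma>" "\<gamma> \<le> 2" "2 \<le> \<gamma> powr real G"
proof -
  show "1 < \<gamma>" using gam_gt_1[OF G] by simp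
  have "gam G \<le> 2" using G by (simp add: gam_def)
  then have "\<gamma> \<le> real_of_rat 2" by (simp only: of_rat_less_eq)
  then show "\<gamma> \<le> 2" by simp
  have "real_of_rat 2 \<le> real_of_rat (gam G ^ G)" using gam_power_ge_2[OF G] by (simp only: of_rat_less_eq)
  then show "2 \<le> \<gamma> powr real G" using \<open>1 < \<gamma>\<close> by (simp add: of_rat_power powr_realpow)
qed

lemma expo_approx:
  assumes "i \<in> {1..n}" "g \<in> {1..m}" "0 < potential i g"
  shows "\<bar>real_of_int (expo i g) - \<theta> * log \<gamma> (pot i g)\<bar> \<le> \<bar>\<theta>\<bar> + 2"
  unfolding expo_def by (rule cost_exponent_approx[OF G assms(3) cab(1) theta])

lemma pot_powr:
  assumes "i \<in> {1..n}" "g \<in> {1..m}" "0 < potential i g" and sigma: "\<sigma> = 1 \<or> \<sigma> = - 1"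
  shows "pot i g powr (\<sigma> * \<theta>) \<le> \<gamma> powr (\<bar>\<theta>\<bar> + 2) * \<gamma> powr (\<sigma> * expo i g)"
    "\<gamma> powr (\<sigma> * expo i g) \<le> \<gamma> powr (\<bar>\<theta>\<bar> + 2) * pot i g powr (\<sigma> * \<theta>)"
proof -
  have eq: "pot i g powr x = \<gamma> powr (x * log \<gamma> (pot i g))" for x
    using assms(3) gamma(1) by (simp add: log_def powr_def)
  show "pot i g powr (\<sigma> * \<theta>) \<le> \<gamma> powr (\<bar>\<theta>\<bar> + 2) * \<gamma> powr (\<sigma> * expo i g)"
    "\<gamma> powr (\<sigma> * expo i g) \<le> \<gamma> powr (\<bar>\<theta>\<bar> + 2) * pot i g powr (\<sigma> * \<theta>)"
    using expo_approx[OF assms(1-3)] gamma(1) sigma unfolding eq powr_add[symmetric] by auto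
qed

lemma depth_ge: "2 * k \<le> D" "2 * n * k + k + (G + 2) * (n + 1) = D"
  using n1 mult_le_mono1[of 1 n "2 * k"] unfolding D depth_of_def by (simp_all add: algebra_simps)

lemma accuracy': "\<gamma> powr (2 * (\<bar>\<theta>\<bar> + 2)) * (1 + 8 / real H) \<le> 2 powr \<bar>\<theta>\<bar>"
proof -
  have "\<gamma> powr (2 * (\<bar>\<theta>\<bar> + 2)) * (1 + 8 / real H) \<le>
      \<gamma> powr (2 * (\<bar>\<theta>\<bar> + 2) + 1) * (1 + 8 / real H)"
    using gamma(1) by (intro mult_right_mono) (auto simp: powr_le_cancel_iff)
  then show ?thesis using accuracy by linarith
qed

text \<open>Approximately the potential to the power \<theta>, in units of
  \<open>\<gamma> powr c\<close>. In these units the additive errors are compared with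
  constants.\<close>

definition rel :: "int \<Rightarrow> nat \<Rightarrow> nat \<Rightarrow> real" where
  "rel c i g = \<gamma> powr (real_of_int (expo i g) - real_of_int c)"

lemma weight_pos: "0 < weight D' c i g \<Longrightarrow> 0 < potential i g"
  by (auto simp: weight_def split: if_splits)

lemma assigned:
  assumes "auction_result D' c A" "i \<in> {1..n}" "A i \<noteq> 0"
  shows "A i \<in> {1..m}" "0 < weight D' c i (A i)" "0 < potential i (A i)"
proof -
  show "A i \<in> {1..m}" "0 < weight D' c i (A i)" using assms unfolding auction_result_def by auto
  then show "0 < potential i (A i)" using weight_pos by blast
qed

text \<open>The sign \<open>\<sigma>\<close> is \<open>1\<close> for \<open>p < 0\<close> and \<open>- 1\<close> for \<open>p > 0\<close>, so that \<open>\<sigma> * \<theta> = p\<close>.\<close>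

lemma sum_pot_le:
  assumes sigma: "\<sigma> = 1 \<or> \<sigma> = - 1"
    and I: "\<And>i. i \<in> I \<Longrightarrow> i \<in> {1..n} \<and> f i \<in> {1..m} \<and> 0 < potential i (f i)"
    and J: "\<And>i. i \<in> J \<Longrightarrow> i \<in> {1..n} \<and> h i \<in> {1..m} \<and> 0 < potential i (h i)"
    and le: "(\<Sum>i\<in>I. rel c i (f i) powr \<sigma>) \<le> (1 + 8 / real H) * (\<Sum>i\<in>J. rel c i (h i) powr \<sigma>)"
  shows "(\<Sum>i\<in>I. pot i (f i) powr (\<sigma> * \<theta>)) \<le>
      2 powr \<bar>\<theta>\<bar> * (\<Sum>i\<in>J. pot i (h i) powr (\<sigma> * \<theta>))"
proof -
  let ?w = "\<gamma> powr (\<bar>\<theta>\<bar> + 2)" and ?c = "\<gamma> powr (\<sigma> * c)"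
  have rel: "\<gamma> powr (\<sigma> * expo i g) = ?c * rel c i g powr \<sigma>" for i g
    unfolding rel_def powr_powr powr_add[symmetric] by (simp add: algebra_simps)
  have up: "pot i g powr (\<sigma> * \<theta>) \<le> ?w * (?c * rel c i g powr \<sigma>)"
    and low: "?c * rel c i g powr \<sigma> \<le> ?w * pot i g powr (\<sigma> * \<theta>)"
    if "i \<in> {1..n} \<and> g \<in> {1..m} \<and> 0 < potential i g" for i g
    using pot_powr[of i g \<sigma>] sigma that unfolding rel[symmetric] by blast+
  have "(\<Sum>i\<in>I. pot i (f i) powr (\<sigma> * \<theta>)) \<le> (\<Sum>i\<in>I. ?w * (?c * rel c i (f i) powr \<sigma>))"
    using I up by (intro sum_mono) blast
  also have "\<dots> = ?w * (?c * (\<Sum>i\<in>I. rel c i (f i) powr \<sigma>))" by (simp add: sum_distrib_left)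
  also have "\<dots> \<le> ?w * (?c * ((1 + 8 / real H) * (\<Sum>i\<in>J. rel c i (h i) powr \<sigma>)))"
    using le by (intro mult_left_mono) auto
  also have "\<dots> = ?w * (1 + 8 / real H) * (\<Sum>i\<in>J. ?c * rel c i (h i) powr \<sigma>)"
    unfolding sum_distrib_left[symmetric] by (simp only: mult_ac)
  also have "\<dots> \<le> ?w * (1 + 8 / real H) * (\<Sum>i\<in>J. ?w * pot i (h i) powr (\<sigma> * \<theta>))"
    using J low by (intro mult_left_mono sum_mono) (blast, simp)
  also have "\<dots> = (?w * ?w) * (1 + 8 / real H) * (\<Sum>i\<in>J. pot i (h i) powr (\<sigma> * \<theta>))"
    unfolding sum_distrib_left[symmetric] by (simp only: mult_ac)
  also have "?w * ?w = \<gamma> powr (2 * (\<bar>\<theta>\<bar> + 2))" by (simp flip: powr_add)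
  also have "\<gamma> powr (2 * (\<bar>\<theta>\<bar> + 2)) * (1 + 8 / real H) * (\<Sum>i\<in>J. pot i (h i) powr (\<sigma> * \<theta>)) \<le>
      2 powr \<bar>\<theta>\<bar> * (\<Sum>i\<in>J. pot i (h i) powr (\<sigma> * \<theta>))"
    by (intro mult_right_mono accuracy' sum_nonneg) auto
  finally show ?thesis .
qed

lemma real_table_entry:
  "real_of_int (table_entry d) \<le> real (H * n) * (real_of_rat al * \<gamma> powr (- real d) + real_of_rat be) + real_of_rat de * real d"
  "real (H * n) * (real_of_rat al * \<gamma> powr (- real d) + real_of_rat be) + real_of_rat de * real d < real_of_int (table_entry d) + 1"
proof -
  let ?x = "of_nat (H * n) * (al * gam G powi (- int d) + be) + de * of_nat d"
  have "\<gamma> powi (- int d) = \<gamma> powr (- real d)"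
    using gamma(1) powr_real_of_int'[of \<gamma> "- int d"] by simp
  then have x: "real_of_rat ?x = real (H * n) * (real_of_rat al * \<gamma> powr (- real d) + real_of_rat be) + real_of_rat de * real d"
    by (simp add: of_rat_add of_rat_mult of_rat_power_int)
  have "of_int (table_entry d) \<le> ?x" "?x < of_int (table_entry d + 1)"
    unfolding table_entry_def by linarith+
  then have "real_of_rat (of_int (table_entry d)) \<le>
    real_of_rat ?x" "real_of_rat ?x < real_of_rat (of_int (table_entry d + 1))"
    by (simp_all only: of_rat_less_eq of_rat_less)
  then show "real_of_int (table_entry d) \<le>
    real (H * n) * (real_of_rat al * \<gamma> powr (- real d) + real_of_rat be) + real_of_rat de * real d"
    "real (H * n) * (real_of_rat al * \<gamma> powr (- real d) + real_of_rat be) + real_of_rat de * real d < real_of_int (table_entry d) + 1"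
    unfolding x by (simp_all add: of_rat_add)
qed

lemma weight_eq:
  assumes "0 < potential i g" "0 \<le> sg * (c - expo i g)" "sg * (c - expo i g) \<le> int D"
  shows "real (weight D c i g) = real_of_int (table_entry (nat (sg * (c - expo i g))))"
  using assms table_entry_bounds(1) by (simp add: weight_def table_def)

lemma auction_optimal:
  assumes "auction_result D c A" "I \<subseteq> {1..n}" "inj_on f I" "f ` I \<subseteq> {1..m}"
  shows "(\<Sum>i\<in>I. real (weight D c i (f i))) \<le> (\<Sum>i | i \<in> {1..n} \<and>
      A i \<noteq> 0. real (weight D c i (A i))) + real n"
proof -
  have "(\<Sum>i\<in>I. weight D c i (f i)) \<le> (\<Sum>i | i \<in> {1..n} \<and> A i \<noteq> 0. weight D c i (A i)) + n"
    using assms unfolding auction_result_def by blast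
  then have "real (\<Sum>i\<in>I. weight D c i (f i)) \<le> real ((\<Sum>i | i \<in> {1..n} \<and>
    A i \<noteq> 0. weight D c i (A i)) + n)"
    by (simp only: of_nat_le_iff)
  then show ?thesis by simp
qed

text \<open>Here a weight is \<open>?N / rel l i g\<close> rounded down, and the threshold
  \<open>l\<close> is the least exponent, so the largest weight is \<open>?N\<close>. The auction
  loses at most \<open>n\<close>, and rounding at most 1 for each agent in \<open>I\<close>.\<close>

lemma welfare_positive:
  assumes par: "sg = - 1" "al = 1" "be = 0" "de = 0" "ch = 0"
    and A: "search_result D l A"
    and I: "I \<subseteq> {1..n}" "inj_on f I" "f ` I \<subseteq> {1..m}" "\<And>i. i \<in> I \<Longrightarrow>
        0 < potential i (f i)"
  shows "(\<Sum>i\<in>I. pot i (f i) powr (- \<theta>)) \<le>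
     2 powr \<bar>\<theta>\<bar> * (\<Sum>i | i \<in> {1..n} \<and> A i \<noteq> 0. pot i (A i) powr (- \<theta>))"
proof (cases "I = {}")
  case True
  then show ?thesis by (auto intro!: sum_nonneg mult_nonneg_nonneg)
next
  case False
  let ?J = "{i \<in> {1..n}. A i \<noteq> 0}" and ?N = "real (H * n)"
  have A': "auction_result D l A" using A par unfolding search_result_def by auto
  have cI: "card I \<le> n" using card_mono[OF _ I(1)] by simp
  note asg = assigned[OF A']
  have w: "real (weight D l i g) \<le> ?N * (1 / rel l i g)" "?N * (1 / rel l i g) - 1 \<le> real (weight D l i g)"
    if ig: "i \<in> {1..n}" "g \<in> {1..m}" "0 < potential i g" for i g
  proof -
    let ?d = "nat (sg * (l - expo i g))"
    have "- int k \<le> l" using l_expo[OF ig] expo_k by force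
    then have d: "0 \<le> sg * (l - expo i g)" "sg * (l - expo i g) \<le> int D"
      using expo_l[OF ig] expo_k[OF ig] depth_ge(1) by (simp_all add: par(1))
    have "1 / rel l i g = \<gamma> powr (- real ?d)"
      using d par unfolding rel_def by (simp add: powr_minus_divide[symmetric])
    then show "real (weight D l i g) \<le> ?N * (1 / rel l i g)" "?N * (1 / rel l i g) - 1 \<le> real (weight D l i g)"
      unfolding weight_eq[OF ig(3) d] using real_table_entry[of ?d] par by simp_all
  qed
  let ?a = "\<Sum>i\<in>?J. 1 / rel l i (A i)" and ?b = "\<Sum>i\<in>I. 1 / rel l i (f i)"
  have up: "(\<Sum>i\<in>?J. real (weight D l i (A i))) \<le> ?N * ?a"
    unfolding sum_distrib_left using asg w(1) by (intro sum_mono) auto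
  have "?N * ?b - real n \<le> ?N * ?b - real (card I)" using cI by simp
  also have "\<dots> = (\<Sum>i\<in>I. ?N * (1 / rel l i (f i)) - 1)" by (simp add: sum_subtractf sum_distrib_left)
  also have "\<dots> \<le> (\<Sum>i\<in>I. real (weight D l i (f i)))"
    using I by (intro sum_mono w(2)) auto
  also have "\<dots> \<le> ?N * ?a + real n"
    using auction_optimal[OF A' I(1-3)] up by linarith
  finally have "real n * (real H * ?b) \<le> real n * (real H * ?a + 2)" by (simp add: algebra_simps)
  then have b: "real H * ?b \<le> real H * ?a + 2" using n1 by (simp add: mult_le_cancel_left)
  \<comment> \<open>The pair of least exponent, taken as a matching of its own, keeps the auction's
    sum \<open>?a\<close> away from 0, so that the loss becomes relative.\<close>
  obtain i g where ig: "i \<in> {1..n}" "g \<in> {1..m}" "0 < potential i g" "expo i g = l"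
    using False I l_expo by blast
  have "?N - real n \<le> ?N * (1 / rel l i g) - 1" using ig n1 gamma(1) by (simp add: rel_def)
  also have "\<dots> \<le> (\<Sum>k\<in>{i}. real (weight D l k g))" using w(2)[OF ig(1-3)] by simp
  also have "\<dots> \<le> ?N * ?a + real n"
    using auction_optimal[OF A', of "{i}" "\<lambda>_. g"] up ig by force
  finally have "real n * (real H) \<le> real n * (real H * ?a + 2)" by (simp add: algebra_simps)
  then have "real H \<le> real H * ?a + 2" using n1 by (simp add: mult_le_cancel_left)
  moreover have "1 / 4 \<le> ?a"
  proof (rule ccontr)
    assume "\<not> 1 / 4 \<le> ?a"
    then have "real H * ?a < real H * (1 / 4)" using H by (intro mult_strict_left_mono) auto
    then show False using calculation H by linarith
  qed
  \<comment> \<open>The additive error 2 is at most \<open>8 * ?a\<close>, as \<open>?a\<close> is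
    at least \<open>1 / 4\<close>.\<close>
  ultimately have "real H * ?b \<le> real H * ((1 + 8 / real H) * ?a)" using b H by (simp add: algebra_simps)
  then have "?b \<le> (1 + 8 / real H) * ?a" using H by (simp add: mult_le_cancel_left)
  then have le: "(\<Sum>i\<in>I. rel l i (f i) powr - 1) \<le> (1 + 8 / real H) * (\<Sum>i\<in>?J. rel l i (A i) powr - 1)"
    by (simp add: powr_minus_divide rel_def)
  have "(\<Sum>i\<in>I. pot i (f i) powr (- 1 * \<theta>)) \<le>
      2 powr \<bar>\<theta>\<bar> * (\<Sum>i\<in>?J. pot i (A i) powr (- 1 * \<theta>))"
    by (rule sum_pot_le[OF _ _ _ le]) (use I asg in auto)
  then show ?thesis by simp
qed

lemma abs_l_le:
  assumes "i \<in> {1..n}" "g \<in> {1..m}" "0 < potential i g"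
  shows "- int k \<le> l"
  using l_expo[OF assms] expo_k by force

lemma perfect_set: "perfect n A \<Longrightarrow> {i \<in> {1..n}. A i \<noteq> 0} = {1..n}"
  by (auto simp: perfect_def)

lemma card_imperfect:
  assumes "\<not> perfect n A"
  shows "real (card {i \<in> {1..n}. A i \<noteq> 0}) \<le> real n - 1"
proof -
  have "card {i \<in> {1..n}. A i \<noteq> 0} < card {1..n}"
    using assms unfolding perfect_def by (intro psubset_card_mono) (simp, blast)
  then show ?thesis by simp
qed

text \<open>A perfect matching of weight close to the maximum has cost close to the minimum, since
  the weights are \<open>?N * (1 - rel c i g)\<close> up to rounding. A threshold far above the
  optimal costs would make the additive error dominate; failure at the previous threshold rules this
  out.\<close>

lemma welfare_negative:
  assumes par: "sg = 1" "al = - 1" "be = 1" "de = 0" "ch = 1"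
    and A: "search_result D l A"
    and f: "inj_on f {1..n}" "f ` {1..n} \<subseteq> {1..m}" "\<And>i. i \<in> {1..n} \<Longrightarrow> 0 < potential i (f i)"
  shows "perfect n A \<and> (\<Sum>i\<in>{1..n}. pot i (A i) powr \<theta>) \<le>
      2 powr \<bar>\<theta>\<bar> * (\<Sum>i\<in>{1..n}. pot i (f i) powr \<theta>)"
proof -
  let ?N = "real (H * n)"
  have fm: "f i \<in> {1..m}" if "i \<in> {1..n}" for i using f(2) that by blast
  have lk: "- int k \<le> l" by (rule abs_l_le[of 1 "f 1"]) (use n1 f(3) fm in auto)
  have w_low: "?N * (1 - rel c i g) - 1 \<le> real (weight D c i g)"
    if ig: "i \<in> {1..n}" "g \<in> {1..m}" "0 < potential i g" and c: "c \<le> l + int D" for c i g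
  proof (cases "expo i g \<le> c")
    case True
    let ?d = "nat (sg * (c - expo i g))"
    have d: "0 \<le> sg * (c - expo i g)" "sg * (c - expo i g) \<le> int D"
      using True expo_l[OF ig] c by (simp_all add: par(1))
    have "rel c i g = \<gamma> powr (- real ?d)" using d par(1) unfolding rel_def by simp
    then show ?thesis unfolding weight_eq[OF ig(3) d] using real_table_entry(2)[of ?d] par(2-4)
      by (simp add: algebra_simps)
  next
    \<comment> \<open>Beyond the threshold the table yields 0, but there
      \<open>1 - rel c i g\<close> is not positive, so the lower bound survives.\<close>
    case False
    then have "1 \<le> rel c i g" unfolding rel_def using gamma(1) by (intro ge_one_powr_ge_zero) auto
    then have "?N * (1 - rel c i g) \<le> 0" by (intro mult_nonneg_nonpos) auto
    then show ?thesis by linarith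
  qed
  have w_up: "real (weight D c i g) \<le> ?N * (1 - rel c i g)" if w: "0 < weight D c i g" for c i g
  proof -
    have pos: "0 < potential i g" using weight_pos[OF w] .
    have d: "0 \<le> sg * (c - expo i g)" "sg * (c - expo i g) \<le> int D"
      using w by (auto simp: weight_def table_def split: if_splits)
    let ?d = "nat (sg * (c - expo i g))"
    have "rel c i g = \<gamma> powr (- real ?d)" using d par(1) unfolding rel_def by simp
    then show ?thesis unfolding weight_eq[OF pos d] using real_table_entry(1)[of ?d] par(2-4)
      by (simp add: algebra_simps)
  qed
  let ?b = "\<lambda>c. \<Sum>i\<in>{1..n}. rel c i (f i)"
  have bpos: "0 \<le> ?b c" for c unfolding rel_def by (intro sum_nonneg) auto
  have opt: "?N * (real n - ?b c) - 2 * real n \<le> (\<Sum>i | i \<in> {1..n} \<and>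
      A' i \<noteq> 0. real (weight D c i (A' i)))"
    if A': "auction_result D c A'" and c: "c \<le> l + int D" for c A'
  proof -
    have "?N * (real n - ?b c) - real n = (\<Sum>i\<in>{1..n}. ?N * (1 - rel c i (f i)) - 1)"
      unfolding sum_subtractf sum_distrib_left[symmetric] by simp
    also have "\<dots> \<le> (\<Sum>i\<in>{1..n}. real (weight D c i (f i)))"
      using fm f(3) c by (intro sum_mono w_low) auto
    finally show ?thesis using auction_optimal[OF A' _ f(1,2)] by force
  qed
  \<comment> \<open>An imperfect matching has weight at most \<open>?N * (n - 1)\<close>, since no
    weight exceeds \<open>?N\<close>. If the relative cost of \<open>f\<close> were below
    \<open>1 / 2\<close>, then \<open>f\<close> would beat it by more than the error
    \<open>2 * n\<close>, because \<open>H\<close> is at least 4.\<close>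
  have imperfect: "1 / 2 \<le> ?b c"
    if A': "auction_result D c A'" and np: "\<not> perfect n A'" and c: "c \<le> l + int D" for c A'
  proof -
    have "(\<Sum>i | i \<in> {1..n} \<and> A' i \<noteq> 0. real (weight D c i (A' i))) \<le>
        (\<Sum>i | i \<in> {1..n} \<and> A' i \<noteq> 0. ?N)"
    proof (intro sum_mono)
      fix i assume i: "i \<in> {i \<in> {1..n}. A' i \<noteq> 0}"
      then have "0 < weight D c i (A' i)" using assigned(2)[OF A'] by blast
      then have "real (weight D c i (A' i)) \<le> ?N * (1 - rel c i (A' i))" by (rule w_up)
      also have "\<dots> \<le> ?N * 1" by (intro mult_left_mono) (auto simp: rel_def)
      finally show "real (weight D c i (A' i)) \<le> ?N" by simp
    qed
    also have "\<dots> = ?N * real (card {i \<in> {1..n}. A' i \<noteq> 0})" by simp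
    also have "\<dots> \<le> ?N * (real n - 1)" using card_imperfect[OF np] by (intro mult_left_mono) auto
    finally have "real n * real H \<le> real n * (real H * ?b c + 2)"
      using opt[OF A' c] by (simp add: algebra_simps)
    then have "real H \<le> real H * ?b c + 2" using n1 by (simp add: mult_le_cancel_left)
    moreover have "real H * (1 / 2) \<le> real H - 2" using H by simp
    ultimately have "real H * (1 / 2) \<le> real H * ?b c" by linarith
    then show ?thesis using H by (simp add: mult_le_cancel_left)
  qed
  obtain c where c: "l \<le> c" "c \<le> l + int D" "auction_result D c A"
    "c = l \<or> (\<exists>A'. auction_result D (c - 1) A' \<and> \<not> perfect n A')" "perfect n A \<or> c = l + int D"
    using A par(5) unfolding search_result_def by auto
  have perf: "perfect n A"
  proof (rule ccontr)
    assume np: "\<not> perfect n A"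
    then have cD: "c = l + int D" using c(5) by blast
    \<comment> \<open>At the last threshold the depth makes the relative cost of \<open>f\<close>
      smaller than \<open>1 / 2\<close>, so imperfection is impossible there.\<close>
    have "rel c i (f i) \<le> (1 / 2) ^ (n + 1)" if i: "i \<in> {1..n}" for i
    proof -
      have "expo i (f i) \<le> int k" using expo_k[OF i fm[OF i] f(3)[OF i]] by linarith
      moreover have "int (G * (n + 1)) + 2 * int k \<le> int D"
      proof -
        have "2 * k \<le> 2 * n * k" using n1 by simp
        moreover have "(G + 2) * (n + 1) = G * (n + 1) + 2 * (n + 1)" by (rule add_mult_distrib)
        ultimately have "G * (n + 1) + 2 * k \<le> D" using depth_ge(2) by linarith
        then have "int (G * (n + 1) + 2 * k) \<le> int D" by (simp only: of_nat_le_iff)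
        then show ?thesis by (simp only: of_nat_add of_nat_mult of_nat_numeral)
      qed
      ultimately have "expo i (f i) - c \<le> - int (G * (n + 1))" using lk unfolding cD by linarith
      then have "real_of_int (expo i (f i)) - real_of_int c \<le> - real (G * (n + 1))" by linarith
      then have e: "real_of_int (expo i (f i)) - real_of_int c \<le> - (real G * real (n + 1))"
        by (simp only: of_nat_mult)
      have "rel c i (f i) \<le> \<gamma> powr (- (real G * real (n + 1)))"
        unfolding rel_def by (rule powr_mono[OF e]) (use gamma(1) in simp)
      also have "\<dots> = inverse ((\<gamma> powr real G) ^ (n + 1))"
      proof -
        have "(\<gamma> powr real G) ^ (n + 1) = (\<gamma> powr real G) powr real (n + 1)"
          using gamma(1) by (intro powr_realpow[symmetric]) auto
        then show ?thesis by (simp only: powr_powr powr_minus)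
      qed
      also have "\<dots> \<le> inverse (2 ^ (n + 1))" using gamma(3) by (intro le_imp_inverse_le power_mono) auto
      finally show ?thesis by (simp add: power_one_over inverse_eq_divide)
    qed
    then have "?b c \<le> (\<Sum>i\<in>{1..n}. (1 / 2) ^ (n + 1))" by (intro sum_mono) auto
    also have "\<dots> = real n / 2 ^ (n + 1)" by (simp add: power_one_over)
    also have "\<dots> < 1 / 2" using less_exp[of n] by (simp add: field_simps)
    finally show False using imperfect[OF c(3) np c(2)] by simp
  qed
  let ?a = "\<Sum>i\<in>{1..n}. rel c i (A i)"
  have "(\<Sum>i\<in>{1..n}. real (weight D c i (A i))) \<le> (\<Sum>i\<in>{1..n}. ?N * (1 - rel c i (A i)))"
    using assigned(2)[OF c(3)] perf by (intro sum_mono w_up) (auto simp: perfect_def)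
  also have "\<dots> = ?N * (real n - ?a)" by (simp add: sum_subtractf sum_distrib_left[symmetric])
  finally have "real n * (real H * ?a) \<le> real n * (real H * ?b c + 2)"
    using opt[OF c(3,2)] unfolding perfect_set[OF perf] by (simp add: algebra_simps)
  then have ab: "real H * ?a \<le> real H * ?b c + 2" using n1 by (simp add: mult_le_cancel_left)
  \<comment> \<open>At the first threshold a single agent already has relative cost at least 1.
    Otherwise the cost was at least \<open>1 / 2\<close> at \<open>c - 1\<close>, and one step
    changes it by the factor \<gamma>, which is at most 2.\<close>
  have "1 / 4 \<le> ?b c"
  proof (cases "c = l")
    case True
    have "1 \<le> rel l 1 (f 1)" unfolding rel_def
      using gamma(1) expo_l[of 1 "f 1"] n1 fm[of 1] f(3)[of 1] by (intro ge_one_powr_ge_zero) auto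
    also have "\<dots> \<le> ?b l" using n1 by (intro member_le_sum) (auto simp: rel_def)
    finally show ?thesis unfolding True by simp
  next
    case False
    then obtain A' where A': "auction_result D (c - 1) A'" "\<not> perfect n A'" using c(4) by blast
    have "1 / 2 \<le> ?b (c - 1)" using imperfect[OF A'] c(2) by simp
    also have "\<dots> = \<gamma> * ?b c" unfolding sum_distrib_left
    proof (rule sum.cong[OF refl])
      fix i
      have "rel (c - 1) i (f i) = \<gamma> powr (1 + (real_of_int (expo i (f i)) - real_of_int c))"
        unfolding rel_def by (simp add: algebra_simps)
      also have "\<dots> = \<gamma> * rel c i (f i)" unfolding rel_def powr_add using gamma(1) by simp
      finally show "rel (c - 1) i (f i) = \<gamma> * rel c i (f i)" .
    qed
    also have "\<dots> \<le> 2 * ?b c" using gamma(2) bpos by (intro mult_right_mono)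
    finally show ?thesis by simp
  qed
  then have "real H * ?a \<le> real H * ((1 + 8 / real H) * ?b c)" using ab H by (simp add: algebra_simps)
  then have "?a \<le> (1 + 8 / real H) * ?b c" using H by (simp add: mult_le_cancel_left)
  then have le: "(\<Sum>i\<in>{1..n}. rel c i (A i) powr 1) \<le> (1 + 8 / real H) * (\<Sum>i\<in>{1..n}. rel c i (f i) powr 1)"
    by (simp add: rel_def)
  have "(\<Sum>i\<in>{1..n}. pot i (A i) powr (1 * \<theta>)) \<le>
      2 powr \<bar>\<theta>\<bar> * (\<Sum>i\<in>{1..n}. pot i (f i) powr (1 * \<theta>))"
  proof (rule sum_pot_le[OF _ _ _ le])
    fix i assume i: "i \<in> {1..n}"
    show "i \<in> {1..n} \<and> A i \<in> {1..m} \<and> 0 < potential i (A i)"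
      using assigned(1,3)[OF c(3) i] perf i unfolding perfect_def by blast
    show "i \<in> {1..n} \<and> f i \<in> {1..m} \<and> 0 < potential i (f i)" using fm f(3) i by blast
  qed simp
  then show ?thesis using perf by simp
qed

text \<open>The weights \<open>c - expo i g\<close> are integers, so there is no rounding loss. For
  two perfect matchings the threshold cancels, and the auction bound compares the sums of exponents,
  that is, the products of the potentials.\<close>

lemma welfare_zero:
  assumes par: "sg = 1" "al = 0" "be = 0" "de = 1" "ch = 1" and th: "\<theta> = - 1"
    and A: "search_result D l A"
    and f: "inj_on f {1..n}" "f ` {1..n} \<subseteq> {1..m}" "\<And>i. i \<in> {1..n} \<Longrightarrow> 0 < potential i (f i)"
  shows "perfect n A \<and> (\<Prod>i\<in>{1..n}. pot i (f i)) \<le> 2 ^ n * (\<Prod>i\<in>{1..n}. pot i (A i))"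
proof -
  have fm: "f i \<in> {1..m}" if "i \<in> {1..n}" for i using f(2) that by blast
  have lk: "- int k \<le> l" by (rule abs_l_le[of 1 "f 1"]) (use n1 f(3) fm in auto)
  have entry: "table_entry d = int d" for d unfolding table_entry_def by (simp add: par(2-4))
  have w_low: "real_of_int (c - expo i g) \<le> real (weight D c i g)"
    if ig: "i \<in> {1..n}" "g \<in> {1..m}" "0 < potential i g" and c: "c \<le> l + int D" for c i g
    unfolding weight_def table_def entry using expo_l[OF ig] c ig(3) by (auto simp: par(1))
  have w_eq: "real (weight D c i g) = real_of_int (c - expo i g)" if "0 < weight D c i g" for c i g
    using that unfolding weight_def table_def entry by (auto simp: par(1) split: if_splits)
  let ?F = "\<Sum>i\<in>{1..n}. real_of_int (expo i (f i))"
  have opt: "real n * real_of_int c - ?F - real n \<le> (\<Sum>i | i \<in> {1..n} \<and>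
      A' i \<noteq> 0. real_of_int (c - expo i (A' i)))"
    if A': "auction_result D c A'" and c: "c \<le> l + int D" for c A'
  proof -
    have "real n * real_of_int c - ?F = (\<Sum>i\<in>{1..n}. real_of_int (c - expo i (f i)))"
      by (simp add: sum_subtractf)
    also have "\<dots> \<le> (\<Sum>i\<in>{1..n}. real (weight D c i (f i)))"
      using fm f(3) c by (intro sum_mono w_low) auto
    also have "\<dots> \<le> (\<Sum>i | i \<in> {1..n} \<and> A' i \<noteq> 0. real (weight D c i (A' i))) + real n"
      by (rule auction_optimal[OF A' _ f(1,2)]) simp
    also have "(\<Sum>i | i \<in> {1..n} \<and> A' i \<noteq> 0. real (weight D c i (A' i))) =
        (\<Sum>i | i \<in> {1..n} \<and> A' i \<noteq> 0. real_of_int (c - expo i (A' i)))"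
      using assigned(2)[OF A'] w_eq by (intro sum.cong) auto
    finally show ?thesis by simp
  qed
  obtain c where c: "l \<le> c" "c \<le> l + int D" "auction_result D c A" "perfect n A \<or> c = l + int D"
    using A par(5) unfolding search_result_def by auto
  note asg = assigned[OF c(3)]
  have perf: "perfect n A"
  proof (rule ccontr)
    assume np: "\<not> perfect n A"
    then have cD: "c = l + int D" using c(4) by blast
    let ?J = "{i \<in> {1..n}. A i \<noteq> 0}"
    have kc: "0 \<le> c + int k" using c(1) lk by linarith
    have "?F \<le> real n * real k"
    proof -
      have "?F \<le> (\<Sum>i\<in>{1..n}. real k)"
      proof (intro sum_mono)
        fix i assume i: "i \<in> {1..n}"
        show "real_of_int (expo i (f i)) \<le> real k" using expo_k[OF i fm[OF i] f(3)[OF i]] by linarith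
      qed
      then show ?thesis by simp
    qed
    moreover have "(\<Sum>i\<in>?J. real_of_int (c - expo i (A i))) \<le> (\<Sum>i\<in>?J. real_of_int (c + int k))"
    proof (intro sum_mono)
      fix i assume "i \<in> ?J"
      then have "- int k \<le> expo i (A i)" using expo_k[of i "A i"] asg[of i] by force
      then show "real_of_int (c - expo i (A i)) \<le> real_of_int (c + int k)" by linarith
    qed
    moreover have "(\<Sum>i\<in>?J. real_of_int (c + int k)) = real (card ?J) * real_of_int (c + int k)" by simp
    moreover have "real (card ?J) * real_of_int (c + int k) \<le> (real n - 1) * real_of_int (c + int k)"
      using card_imperfect[OF np] kc by (intro mult_right_mono) auto
    ultimately have "real n * real_of_int c - real n * real k - real n \<le> (real n - 1) * real_of_int (c + int k)"
      using opt[OF c(3,2)] by linarith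
    \<comment> \<open>The term \<open>n * c\<close> of the perfect matching \<open>f\<close> is
      opposed by at most \<open>(n - 1) * c\<close> for an imperfect one, so \<open>c\<close> cannot
      be large; the depth contradicts this.\<close>
    then have "real_of_int c \<le> 2 * real n * real k + real n" by (simp add: algebra_simps)
    then have "c \<le> int (2 * n * k + n)" by (simp add: of_int_le_iff[symmetric, where 'a = real] del: of_int_le_iff)
    moreover have "int (2 * n * k + k + (G + 2) * (n + 1)) = int D" using depth_ge(2) by simp
    moreover have "2 * n * k + n < 2 * n * k + (G + 2) * (n + 1)" by simp
    then have "int (2 * n * k + n) < int (2 * n * k + (G + 2) * (n + 1))" by (simp only: of_nat_less_iff)
    ultimately show False using lk unfolding cD by simp
  qed
  let ?A = "\<Sum>i\<in>{1..n}. real_of_int (expo i (A i))"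
  have "(\<Sum>i\<in>{1..n}. real_of_int (c - expo i (A i))) = real n * real_of_int c - ?A"
    by (simp add: sum_subtractf)
  then have AF: "?A \<le> ?F + real n" using opt[OF c(3,2)] unfolding perfect_set[OF perf] by linarith
  let ?lf = "\<Sum>i\<in>{1..n}. log \<gamma> (pot i (f i))" and ?lA = "\<Sum>i\<in>{1..n}. log \<gamma> (pot i (A i))"
  have "?lf \<le> (\<Sum>i\<in>{1..n}. 3 - real_of_int (expo i (f i)))"
  proof (intro sum_mono)
    fix i assume i: "i \<in> {1..n}"
    show "log \<gamma> (pot i (f i)) \<le> 3 - real_of_int (expo i (f i))"
      using expo_approx[OF i fm[OF i] f(3)[OF i]] by (simp add: th)
  qed
  moreover have "(\<Sum>i\<in>{1..n}. - 3 - real_of_int (expo i (A i))) \<le> ?lA"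
  proof (intro sum_mono)
    fix i assume i: "i \<in> {1..n}"
    then have "A i \<noteq> 0" using perf by (auto simp: perfect_def)
    then show "- 3 - real_of_int (expo i (A i)) \<le> log \<gamma> (pot i (A i))"
      using expo_approx[OF i asg(1,3)[OF i]] by (simp add: th)
  qed
  \<comment> \<open>For \<theta> equal to -1 each rounded logarithm is off by at most 3; both
    directions and the auction loss give 7 per agent, the exponent in
    \<open>accuracy\<close>.\<close>
  ultimately have le: "?lf \<le> ?lA + 7 * real n" using AF by (simp add: sum_subtractf sum_negf)
  have prod: "(\<Prod>i\<in>{1..n}. pot i (g i)) = \<gamma> powr (\<Sum>i\<in>{1..n}. log \<gamma> (pot i (g i)))"
    if "\<And>i. i \<in> {1..n} \<Longrightarrow> 0 < potential i (g i)" for g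
    using that gamma(1) by (simp add: powr_sum powr_log_cancel)
  have "\<gamma> powr 7 * 1 \<le> \<gamma> powr 7 * (1 + 8 / real H)" by (intro mult_left_mono) auto
  then have g7: "\<gamma> powr 7 \<le> 2" using accuracy th by simp
  have "(\<Prod>i\<in>{1..n}. pot i (f i)) \<le> \<gamma> powr (?lA + 7 * real n)"
    using prod[of f] f(3) le gamma(1) by (simp add: powr_le_cancel_iff)
  also have "\<dots> = (\<gamma> powr 7) ^ n * (\<Prod>i\<in>{1..n}. pot i (A i))"
  proof -
    have "(\<gamma> powr 7) ^ n = (\<gamma> powr 7) powr real n"
      using gamma(1) by (intro powr_realpow[symmetric]) auto
    moreover have "(\<Prod>i\<in>{1..n}. pot i (A i)) = \<gamma> powr ?lA"
      using asg(3) perf by (intro prod) (auto simp: perfect_def)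
    ultimately show ?thesis by (simp only: powr_powr powr_add mult.commute)
  qed
  also have "\<dots> \<le> 2 ^ n * (\<Prod>i\<in>{1..n}. pot i (A i))"
    using g7 asg(3) perf by (intro mult_right_mono power_mono prod_nonneg) (auto simp: perfect_def intro: less_imp_le)
  finally show ?thesis using perf by blast
qed

end

section \<open>The program\<close>

text \<open>The scans always point to an existing good, so the case without goods is split off;
  there every output is the empty allocation.\<close>

definition program :: "nat \<Rightarrow> nat \<Rightarrow> rat \<Rightarrow> rat \<Rightarrow> int \<Rightarrow> rat \<Rightarrow> rat \<Rightarrow> rat \<Rightarrow> nat \<Rightarrow> com" where
  "program G H ca cb sg al be de ch =
     If (Less (Const 0) (var ''m''))
       (values_com ;; exponents_com G ca cb ;; table_com G H sg al be de ;; search_com ch ;;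
        swap_com ;; bag_com)
       Skip"

locale allocation_bound = table_bound + subadditive_bound +
  assumes m1: "1 \<le> m"
    and Y: "3 + (depth_of (max_exponent * max_exponent) + 1) * rat_size (gam G) \<le> Y"
      "H * n + depth_of (max_exponent * max_exponent) + 3 \<le> Y"
      "(n + m) * (H * n + depth_of (max_exponent * max_exponent)) * ((n + 1) * m + 1) + (n + 1) * m + 3 \<le> Y"
      "max_exponent * max_exponent + depth_of (max_exponent * max_exponent) + 5 \<le> Y"
      "n * m * ((n + 1) * m + 1) + (n + 1) * m \<le> Y"
begin

text \<open>The interface between program and analysis: the bound \<open>k\<close> and minimum
  \<open>l\<close> of the exponents with which the search was run, the matching \<open>A0\<close>
  that it found before any swaps, and final bundles worth the matched potentials up to the factor
  \<open>4 * n\<close>.\<close>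

definition good_outcome :: "store \<Rightarrow> bool" where
  "good_outcome s \<longleftrightarrow> (\<exists>k l A0 Ow.
     (\<forall>i\<in>{1..n}. \<forall>g\<in>{1..m}. 0 < potential i g \<longrightarrow> \<bar>expo i g\<bar> \<le>
       int k \<and> l \<le> expo i g \<and>
        (\<exists>i\<in>{1..n}. \<exists>g\<in>{1..m}. 0 < potential i g \<and> expo i g = l)) \<and>
     search_result (depth_of k) l A0 \<and>
     (\<forall>g\<in>{1..m}. s ''owner'' (int g) = of_nat (Ow g) \<and> Ow g \<in> {1..n}) \<and>
     (\<forall>i\<in>{1..n}. A0 i \<noteq> 0 \<longrightarrow> potential i (A0 i) \<le> 4 * of_nat n * v i (bundle_of m Ow i)))"

lemma depth_of_mono: "k \<le> k' \<Longrightarrow> depth_of k \<le> depth_of k'"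
  unfolding depth_of_def by (intro add_mono mult_mono) auto

lemma initial_store_0: "x \<noteq> ''n'' \<Longrightarrow> x \<noteq> ''m'' \<Longrightarrow> initial_store n m x k = 0"
  by (simp add: initial_store_def)

lemma wp_program: "wp (program G H ca cb sg al be de ch) good_outcome (initial_store n m)"
proof -
  let ?s = "initial_store n m"
  have sz: "sizes ?s" by (simp add: sizes_def initial_store_def)
  have "wp (values_com ;; exponents_com G ca cb ;; table_com G H sg al be de ;; search_com ch ;;
      swap_com ;; bag_com) good_outcome ?s"
  proof (rule wp_Seq, rule wp_frame[OF wp_values[OF sz]], goal_cases)
    case 1
    then show ?case by (simp add: initial_store_0)
  next
    case (2 s1)
    have fr1: "s1 x = ?s x" if "x \<in> {''n'', ''m'', ''F'', ''c''}" for x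
      using 2(2)[of x] that by (auto simp: values_com_def singles_com_def rank_com_def)
    have sz1: "sizes s1" using sz fr1 by (simp add: sizes_def)
    have S1: "\<forall>i\<in>{1..n}. (\<forall>g\<in>{1..m}. s1 ''S'' (idx m i g) = v i {g}) \<and> s1 ''V'' (int i) =
        low_value i"
      using 2(1) unfolding low_value_def .
    show ?case
    proof (rule wp_Seq, rule wp_frame[OF wp_exponents[OF sz1 S1]], goal_cases)
      case (1 s2)
      have fr2: "s2 x = s1 x" if "x \<in> {''n'', ''m'', ''F'', ''c'', ''S''}" for x
        using 1(2)[of x] that
        by (auto simp: exponents_com_def exponent_com_def level_com_def record_com_def)
      have sz2: "sizes s2" using sz1 fr2 by (simp add: sizes_def)
      obtain k where k: "s2 ''b'' 0 = of_nat k" "k \<le> max_exponent * max_exponent"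
        and rec: "\<And>i g. i \<in> {1..n} \<Longrightarrow> g \<in> {1..m} \<Longrightarrow> recorded k s2 i g"
        using 1(1) unfolding exponents_inv_def by auto
      obtain l where l: "s2 ''w'' 0 = of_int l"
        "l = 0 \<and> (\<forall>(i, g) \<in> {1..n} \<times> {1..m}. \<not> potential i g > 0) \<or>
          min_expo ({1..n} \<times> {1..m}) l"
        using 1(1) unfolding exponents_inv_def by blast
      have facts: "\<bar>expo i g\<bar> \<le> int k \<and> l \<le> expo i g \<and>
          (\<exists>i\<in>{1..n}. \<exists>g\<in>{1..m}. 0 < potential i g \<and> expo i g = l)"
        if "i \<in> {1..n}" "g \<in> {1..m}" "0 < potential i g" for i g
      proof -
        have "min_expo ({1..n} \<times> {1..m}) l" using l(2) that by blast
        then show ?thesis using rec[OF that(1,2)] that unfolding min_expo_def recorded_def by auto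
      qed
      have l_le: "\<bar>l\<bar> \<le> int (max_exponent * max_exponent)"
      proof (cases "min_expo ({1..n} \<times> {1..m}) l")
        case True
        then obtain i g where "i \<in> {1..n}" "g \<in> {1..m}" "0 < potential i g" "l = expo i g"
          unfolding min_expo_def by auto
        then have "\<bar>l\<bar> \<le> int k" using facts by blast
        then show ?thesis using k(2) by linarith
      next
        case False
        then show ?thesis using l(2) by simp
      qed
      define D where "D = depth_of k"
      have DM: "D \<le> depth_of (max_exponent * max_exponent)" unfolding D_def by (rule depth_of_mono[OF k(2)])
      have Y1: "3 + (D + 1) * rat_size (gam G) \<le> Y"
      proof -
        have "3 + (D + 1) * rat_size (gam G) \<le> 3 + (depth_of (max_exponent * max_exponent) + 1) * rat_size (gam G)"
          using DM by (intro add_mono mult_mono) auto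
        then show ?thesis using Y(1) by linarith
      qed
      have Y2: "H * n + D + 3 \<le> Y" using Y(2) DM by linarith
      have Y3: "(n + m) * (H * n + D) * ((n + 1) * m + 1) + (n + 1) * m + 3 \<le> Y"
      proof -
        have "(n + m) * (H * n + D) * ((n + 1) * m + 1) + (n + 1) * m + 3 \<le>
            (n + m) * (H * n + depth_of (max_exponent * max_exponent)) * ((n + 1) * m + 1) + (n + 1) * m + 3"
          using DM by (intro add_mono mult_mono) auto
        then show ?thesis using Y(3) by linarith
      qed
      have Y4: "nat \<bar>l\<bar> + D + 5 \<le> Y" using Y(4) DM l_le by linarith
      have F2: "s2 ''F'' i = 0" for i using fr1[of "''F''"] fr2[of "''F''"] by (simp add: initial_store_0)
      show ?case
      proof (rule wp_Seq, rule wp_frame[OF wp_table[OF sz2 k(1) F2 D_def Y1 Y2]], goal_cases)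
        case (1 s3)
        have fr3: "s3 x = s2 x" if "x \<in> {''n'', ''m'', ''c'', ''S'', ''G'', ''E'', ''w''}" for x
          using 1(2)[of x] that by (auto simp: table_com_def)
        have r3: "ready D 0 s3"
          unfolding ready_def
        proof (intro conjI ballI, goal_cases)
          case 1 then show ?case using sz2 fr3 by (simp add: sizes_def)
        next
          case 2
          then show ?case using fr1[of "''c''"] fr2[of "''c''"] fr3[of "''c''"] by (simp add: initial_store_0)
        next
          case (6 i g)
          then show ?case using S1 fr2[of "''S''"] fr3[of "''S''"] by simp
        next
          case (7 i g)
          then show ?case using rec[OF 7] fr3[of "''G''"] fr3[of "''E''"] unfolding recorded_def
            by (auto split: if_splits)
        qed (use 1(1) in blast)+
        have w3: "s3 ''w'' 0 = of_int l" using l(1) fr3[of "''w''"] by simp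
        show ?case
        proof (rule wp_Seq, rule wp_frame[OF wp_search[OF r3 m1 w3 Y3 Y2 Y4]], goal_cases)
          case (1 s4)
          have fr4: "s4 x = s3 x" if "x \<in> {''n'', ''m'', ''S''}" for x
            using 1(2)[of x] that
            by (auto simp: search_com_def auction_com_def auction_step_com_def take_com_def check_com_def)
          obtain A0 Ow0 where A0: "is_matching n m A0 Ow0" "holds_matching n m v A0 Ow0 s4" "search_result D l A0"
            using 1(1) by blast
          have sz4: "sizes s4" using r3 fr4 unfolding ready_def by (simp add: sizes_def)
          have S4: "\<forall>i\<in>{1..n}. \<forall>g\<in>{1..m}. s4 ''S'' (idx m i g) = v i {g}"
            using r3 fr4[of "''S''"] unfolding ready_def by simp
          show ?case
          proof (rule wp_Seq, rule wp_frame[OF wp_swap[OF sz4 S4 A0(1,2) m1 Y(5)]], goal_cases)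
            case (1 s5)
            have sz5: "sizes s5" using sz4 1(2)[of "''n''"] 1(2)[of "''m''"]
              by (simp add: sizes_def swap_com_def swap_step_com_def)
            obtain A Ow where A: "is_matching n m A Ow" "holds_matching n m v A Ow s5"
              and better: "\<And>i. i \<in> {1..n} \<Longrightarrow> own_value v A0 i \<le> own_value v A i"
              and stable: "\<forall>i\<in>{1..n}. \<forall>g\<in>free_goods m Ow. v i {g} \<le> own_value v A i"
              using 1(1) by blast
            show ?case
            proof (rule wp_mono[OF wp_bag[OF sz5 A stable]])
              fix s6 :: store
              assume "\<exists>Ow'. (\<forall>g\<in>{1..m}. s6 ''owner'' (int g) = of_nat (Ow' g) \<and>
                  Ow' g \<in> {1..n}) \<and>
                (\<forall>i\<in>{1..n}. own_value v A i \<le> v i (bundle_of m Ow' i) \<and>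
                rest_value Ow i \<le> 2 * of_nat n * v i (bundle_of m Ow' i))"
              then obtain Ow' where Ow': "\<forall>g\<in>{1..m}. s6 ''owner'' (int g) = of_nat (Ow' g) \<and> Ow' g \<in> {1..n}"
                and b: "\<And>i. i \<in> {1..n} \<Longrightarrow> own_value v A i \<le> v i (bundle_of m Ow' i)"
                  "\<And>i. i \<in> {1..n} \<Longrightarrow> rest_value Ow i \<le>
                    2 * of_nat n * v i (bundle_of m Ow' i)" by blast
              have "potential i (A0 i) \<le> 4 * of_nat n * v i (bundle_of m Ow' i)"
                if i: "i \<in> {1..n}" and "A0 i \<noteq> 0" for i
                by (rule potential_le_bundle[OF A(1) i _ that(2) better[OF i] b(1)[OF i] b(2)[OF i]])
                   (use stable i in blast)
              then show "good_outcome s6" unfolding good_outcome_def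
                using facts A0(3) Ow' unfolding D_def by blast
            qed
          qed
        qed
      qed
    qed
  qed
  then show ?thesis unfolding program_def using sz m1
    by (intro wp_If) (simp_all add: sizes_def)
qed

end

section \<open>Comparison of p-means under scaling\<close>

lemma pmean_nonneg: "0 \<le> pmean p n V A"
  by (simp add: pmean_def)

lemma pmean_le_positive:
  assumes p: "0 < p" and c: "0 < c" and x: "\<And>i. i \<in> {1..n} \<Longrightarrow> 0 \<le> V i (B i)"
    and le: "(\<Sum>i = 1..n. V i (A i) powr p) \<le> (\<Sum>i = 1..n. (c * V i (B i)) powr p)"
  shows "pmean p n V A \<le> c * pmean p n V B"
proof -
  have "(\<Sum>i = 1..n. (c * V i (B i)) powr p) = (\<Sum>i = 1..n. c powr p * V i (B i) powr p)"
    using c x by (intro sum.cong) (auto simp: powr_mult)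
  then have eq: "1 / real n * (\<Sum>i = 1..n. (c * V i (B i)) powr p) =
      c powr p * (1 / real n * (\<Sum>i = 1..n. V i (B i) powr p))"
    by (simp add: sum_distrib_left[symmetric])
  have "(1 / real n * (\<Sum>i = 1..n. V i (A i) powr p)) powr (1 / p) \<le>
      (1 / real n * (\<Sum>i = 1..n. (c * V i (B i)) powr p)) powr (1 / p)"
    using p le by (intro powr_mono2 mult_left_mono mult_nonneg_nonneg sum_nonneg) auto
  also have "\<dots> = c * (1 / real n * (\<Sum>i = 1..n. V i (B i) powr p)) powr (1 / p)"
    unfolding eq using c p by (subst powr_mult) (auto simp: powr_powr intro: sum_nonneg)
  finally show ?thesis using p by (simp add: pmean_def)
qed

text \<open>Both \<open>x powr p\<close> and \<open>x powr (1 / p)\<close> are decreasing here, so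
  the allocation with the larger sum has the smaller mean. Positivity of all values avoids the
  special case in \<open>pmean\<close>.\<close>

lemma pmean_le_negative:
  assumes p: "p < 0" and c: "0 < c" and n: "1 \<le> n"
    and A: "\<And>i. i \<in> {1..n} \<Longrightarrow> 0 < V i (A i)" and B: "\<And>i. i \<in> {1..n} \<Longrightarrow>
        0 < V i (B i)"
    and le: "(\<Sum>i = 1..n. (c * V i (B i)) powr p) \<le> (\<Sum>i = 1..n. V i (A i) powr p)"
  shows "pmean p n V A \<le> c * pmean p n V B"
proof -
  have "(\<Sum>i = 1..n. (c * V i (B i)) powr p) = (\<Sum>i = 1..n. c powr p * V i (B i) powr p)"
    using c B by (intro sum.cong) (auto simp: powr_mult less_imp_le)
  then have eq: "1 / real n * (\<Sum>i = 1..n. (c * V i (B i)) powr p) =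
      c powr p * (1 / real n * (\<Sum>i = 1..n. V i (B i) powr p))"
    by (simp add: sum_distrib_left[symmetric])
  have pos: "0 < (\<Sum>i = 1..n. (c * V i (B i)) powr p)"
  proof (rule sum_pos)
    fix i assume "i \<in> {1..n}"
    then show "0 < (c * V i (B i)) powr p" using B[of i] c by simp
  qed (use n in auto)
  have "(1 / real n * (\<Sum>i = 1..n. V i (A i) powr p)) powr (1 / p) \<le>
      (1 / real n * (\<Sum>i = 1..n. (c * V i (B i)) powr p)) powr (1 / p)"
    using p le pos n by (intro powr_mono2' mult_left_mono mult_pos_pos) auto
  also have "\<dots> = c * (1 / real n * (\<Sum>i = 1..n. V i (B i) powr p)) powr (1 / p)"
    unfolding eq using c p by (subst powr_mult) (auto simp: powr_powr intro: sum_nonneg)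
  finally have "(1 / real n * (\<Sum>i = 1..n. V i (A i) powr p)) powr (1 / p) \<le>
      c * (1 / real n * (\<Sum>i = 1..n. V i (B i) powr p)) powr (1 / p)" .
  moreover have "\<not> (\<exists>i\<in>{1..n}. V i (A i) = 0)" using A by (metis less_irrefl)
  moreover have "\<not> (\<exists>i\<in>{1..n}. V i (B i) = 0)" using B by (metis less_irrefl)
  ultimately show ?thesis using p unfolding pmean_def by simp
qed

lemma pmean_le_zero:
  assumes c: "0 < c" and n: "1 \<le> n"
    and A: "\<And>i. i \<in> {1..n} \<Longrightarrow> 0 \<le> V i (A i)" and B: "\<And>i. i \<in> {1..n} \<Longrightarrow>
        0 \<le> V i (B i)"
    and le: "(\<Prod>i = 1..n. V i (A i)) \<le> (\<Prod>i = 1..n. c * V i (B i))"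
  shows "pmean 0 n V A \<le> c * pmean 0 n V B"
proof -
  have eq: "(\<Prod>i = 1..n. c * V i (B i)) = c ^ n * (\<Prod>i = 1..n. V i (B i))"
    by (simp add: prod.distrib)
  have "(\<Prod>i = 1..n. V i (A i)) powr (1 / real n) \<le> (\<Prod>i = 1..n. c * V i (B i)) powr (1 / real n)"
    using le A by (intro powr_mono2 prod_nonneg) auto
  also have "\<dots> = c * (\<Prod>i = 1..n. V i (B i)) powr (1 / real n)"
  proof -
    have "(c ^ n) powr (1 / real n) = c" using c n by (simp add: powr_realpow[symmetric] powr_powr)
    then show ?thesis unfolding eq using c B by (subst powr_mult) (auto intro: prod_nonneg)
  qed
  finally show ?thesis by (simp add: pmean_def)
qed

lemma pmean_eq_0:
  assumes "p \<le> 0" "i \<in> {1..n}" "V i (A i) = 0"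
  shows "pmean p n V A = 0"
proof (cases "p = 0")
  case True
  then show ?thesis using assms by (auto simp: pmean_def)
next
  case False
  then show ?thesis using assms by (auto simp: pmean_def)
qed

text \<open>
  The cost exponents approximate \<open>\<theta> * log \<gamma> u\<close> with \<open>\<theta> = coeff_a p * p + coeff_b p\<close>; \<open>\<theta>\<close> is negative also for
  \<open>p = 0\<close>, where the sum of logarithms is maximised. With \<open>d\<close> the distance between the exponent and the threshold,
  the weight is \<open>N * \<gamma> powr - d\<close> for \<open>p > 0\<close>, \<open>N * (1 - \<gamma> powr - d)\<close> for \<open>p < 0\<close>, and \<open>d\<close> for \<open>p = 0\<close>, rounded down.
\<close>

definition theta_of :: "real \<Rightarrow> real" where
  "theta_of p = (if p = 0 then - 1 else - \<bar>p\<bar>)"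

definition coeff_a :: "real \<Rightarrow> rat" where
  "coeff_a p = (if 0 < p then - 1 else 1)"

definition coeff_b :: "real \<Rightarrow> rat" where
  "coeff_b p = (if p = 0 then - 1 else 0)"

definition sign_of :: "real \<Rightarrow> int" where
  "sign_of p = (if 0 < p then - 1 else 1)"

definition alpha_of :: "real \<Rightarrow> rat" where
  "alpha_of p = (if 0 < p then 1 else if p = 0 then 0 else - 1)"

definition beta_of :: "real \<Rightarrow> rat" where
  "beta_of p = (if p < 0 then 1 else 0)"

definition delta_of :: "real \<Rightarrow> rat" where
  "delta_of p = (if p = 0 then 1 else 0)"

definition choice_of :: "real \<Rightarrow> nat" where
  "choice_of p = (if 0 < p then 0 else 1)"

abbreviation program_for :: "real \<Rightarrow> nat \<Rightarrow> nat \<Rightarrow> com" where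
  "program_for p G H \<equiv> program G H (coeff_a p) (coeff_b p) (sign_of p) (alpha_of p) (beta_of p) (delta_of p) (choice_of p)"

text \<open>By \<open>1 + x <= exp x\<close>, each of the two factors on the left can be pushed
  below \<open>exp ?e\<close>, the square root of the right-hand side, by taking \<open>G\<close>
  and \<open>H\<close> large.\<close>

lemma exists_accuracy:
  assumes "\<theta> \<noteq> (0::real)"
  shows "\<exists>G H. 1 \<le> G \<and> 4 \<le> H \<and>
    real_of_rat (gam G) powr (2 * (\<bar>\<theta>\<bar> + 2) + 1) * (1 + 8 / real H) \<le> 2 powr \<bar>\<theta>\<bar>"
proof -
  let ?w = "2 * (\<bar>\<theta>\<bar> + 2) + 1" and ?e = "\<bar>\<theta>\<bar> * ln 2 / 2"
  have e: "0 < ?e" using assms by simp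
  obtain G :: nat where G: "?w / ?e < real G" using reals_Archimedean2 by blast
  obtain H :: nat where H: "8 / ?e < real H" using reals_Archimedean2 by blast
  have w: "0 < ?w" by simp
  have G1: "1 \<le> G" using G w e by (cases G) (auto simp: field_simps)
  have "real_of_rat (gam G) = 1 + 1 / real G" by (simp add: gam_def of_rat_add of_rat_divide)
  also have "\<dots> \<le> exp (1 / real G)" by (rule exp_ge_add_one_self)
  finally have "real_of_rat (gam G) powr ?w \<le> exp (1 / real G) powr ?w"
    using gam_gt_1[OF G1] w by (intro powr_mono2) auto
  also have "\<dots> = exp (?w / real G)" by (simp add: powr_def)
  also have "\<dots> \<le> exp ?e"
  proof -
    have "?w / real G \<le> ?e" using G G1 e by (simp add: field_simps)
    then show ?thesis by simp
  qed
  finally have 1: "real_of_rat (gam G) powr ?w \<le> exp ?e" .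
  have "1 + 8 / real (max 4 H) \<le> exp (8 / real (max 4 H))" by (rule exp_ge_add_one_self)
  also have "\<dots> \<le> exp ?e"
  proof -
    have "8 / ?e < real (max 4 H)" using H by simp
    then have "8 / real (max 4 H) \<le> ?e" using e by (simp add: field_simps)
    then show ?thesis by simp
  qed
  finally have "real_of_rat (gam G) powr ?w * (1 + 8 / real (max 4 H)) \<le> exp ?e * exp ?e"
    using 1 by (intro mult_mono) auto
  also have "\<dots> = 2 powr \<bar>\<theta>\<bar>" by (simp add: powr_def exp_add[symmetric])
  finally show ?thesis using G1 by (intro exI[of _ G] exI[of _ "max 4 H"]) simp
qed

section \<open>A polynomial size bound in terms of the input size\<close>

definition is_poly :: "(nat \<Rightarrow> nat) \<Rightarrow> bool" where
  "is_poly f \<longleftrightarrow> (\<exists>q. \<forall>x. f x = poly q x)"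

lemma is_poly_const: "is_poly (\<lambda>_. c)"
  unfolding is_poly_def by (intro exI[of _ "[:c:]"]) simp

lemma is_poly_id: "is_poly (\<lambda>x. x)"
  unfolding is_poly_def by (intro exI[of _ "[:0, 1:]"]) simp

lemma is_poly_add: "is_poly f \<Longrightarrow> is_poly g \<Longrightarrow> is_poly (\<lambda>x. f x + g x)"
  unfolding is_poly_def by (metis poly_add)

lemma is_poly_mult: "is_poly f \<Longrightarrow> is_poly g \<Longrightarrow> is_poly (\<lambda>x. f x * g x)"
  unfolding is_poly_def by (metis poly_mult)

text \<open>Dominates the bound \<open>2 * n + 4 * L + 4\<close> of
  \<open>rat_size_potential\<close> when \<open>n\<close> and \<open>L\<close> add up to at most
  \<open>X\<close>.\<close>

definition bits_of :: "nat \<Rightarrow> nat" where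
  "bits_of X = 6 * X + 4"

definition exponent_of :: "nat \<Rightarrow> nat \<Rightarrow> nat \<Rightarrow> nat" where
  "exponent_of G j X = (2 ^ j + 1) * (G * bits_of X) + 1"

definition depth_bound :: "nat \<Rightarrow> nat \<Rightarrow> nat \<Rightarrow> nat" where
  "depth_bound G j X = (2 * X + 1) * (exponent_of G j X * exponent_of G j X) + (G + 2) * (X + 1)"

text \<open>The sum of everything that the locales require of \<open>Y\<close>, with
  \<open>n\<close> and \<open>m\<close> replaced by \<open>X\<close>; each requirement then follows
  by dropping summands.\<close>

definition resource_bound :: "nat \<Rightarrow> nat \<Rightarrow> nat \<Rightarrow> nat \<Rightarrow> nat" where
  "resource_bound G H j X =
     (G * bits_of X * rat_size (gam G) + 2 * ((G * bits_of X) * (G * bits_of X)) + j + 2 * (G * bits_of X)) +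
     exponent_of G j X * exponent_of G j X +
     (depth_bound G j X + 1) * rat_size (gam G) + H * X + depth_bound G j X +
     (X + X) * (H * X + depth_bound G j X) * ((X + 1) * X + 1) + (X + 1) * X +
     X * X * ((X + 1) * X + 1) + X + 10"

lemma is_poly_resource_bound: "is_poly (resource_bound G H j)"
  unfolding resource_bound_def depth_bound_def exponent_of_def bits_of_def
  by (intro is_poly_add is_poly_mult is_poly_const is_poly_id)

context allocation_bound
begin

lemma output_bundle:
  assumes "\<forall>g\<in>{1..m}. s ''owner'' (int g) = of_nat (Ow g) \<and> Ow g \<in> {1..n}" "i \<in> {1..n}"
  shows "output_bundles n m s i = bundle_of m Ow i"
  using assms by (auto simp: output_bundles_def bundle_of_def)

lemma output_allocation:
  assumes "\<forall>g\<in>{1..m}. s ''owner'' (int g) = of_nat (Ow g) \<and> Ow g \<in> {1..n}"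
  shows "output_bundles n m s \<in> allocations n m"
proof -
  have "output_bundles n m s \<in> {1..n} \<rightarrow>\<^sub>E Pow {1..m}" by (auto simp: output_bundles_def)
  moreover have "disjoint_family_on (output_bundles n m s) {1..n}"
    unfolding disjoint_family_on_def using output_bundle[of s Ow, OF assms] by (auto simp: bundle_of_def)
  moreover have "(\<Union>i\<in>{1..n}. output_bundles n m s i) = {1..m}"
    using output_bundle[of s Ow, OF assms] assms by (auto simp: bundle_of_def)
  ultimately show ?thesis unfolding allocations_def by blast
qed

text \<open>Each agent with positive value in \<open>A\<close> is matched to a good of her bundle
  whose potential dominates that value; disjointness of the bundles makes this a matching. The
  factor 2 of the welfare lemmas times \<open>4 * n\<close> gives \<open>8 * n\<close>.\<close>

lemma outcome_approximation:
  assumes par: "ca = coeff_a p" "cb = coeff_b p" "sg = sign_of p" "al = alpha_of p" "be = beta_of p"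
      "de = delta_of p" "ch = choice_of p" and H4: "4 \<le> H"
    and acc: "real_of_rat (gam G) powr (2 * (\<bar>theta_of p\<bar> + 2) + 1) * (1 + 8 / real H) \<le>
        2 powr \<bar>theta_of p\<bar>"
    and good: "good_outcome s" and A: "A \<in> allocations n m"
  shows "pmean p n (\<lambda>i S. real_of_rat (v i S)) A \<le>
    8 * real n * pmean p n (\<lambda>i S. real_of_rat (v i S)) (output_bundles n m s)"
proof -
  let ?V = "\<lambda>i S. real_of_rat (v i S)" and ?B = "output_bundles n m s"
  obtain k l A0 Ow where
    facts: "\<And>i g. i \<in> {1..n} \<Longrightarrow> g \<in> {1..m} \<Longrightarrow> 0 < potential i g \<Longrightarrow>
      \<bar>expo i g\<bar> \<le> int k \<and> l \<le> expo i g \<and>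
        (\<exists>i\<in>{1..n}. \<exists>g\<in>{1..m}. 0 < potential i g \<and> expo i g = l)"
    and A0: "search_result (depth_of k) l A0"
    and Ow: "\<forall>g\<in>{1..m}. s ''owner'' (int g) = of_nat (Ow g) \<and> Ow g \<in> {1..n}"
    and pot_le: "\<And>i. i \<in> {1..n} \<Longrightarrow> A0 i \<noteq> 0 \<Longrightarrow> potential i (A0 i) \<le>
        4 * of_nat n * v i (bundle_of m Ow i)"
    using good unfolding good_outcome_def by blast
  interpret matching_analysis p n m v Y G H j bits ca cb sg al be de ch "theta_of p" k "depth_of k" l
  proof
    show "theta_of p = real_of_rat ca * p + real_of_rat cb"
      unfolding par theta_of_def coeff_a_def coeff_b_def by simp
  qed (use facts H4 acc n in blast)+
  have B: "?B i = bundle_of m Ow i" if "i \<in> {1..n}" for i by (rule output_bundle[of s Ow, OF Ow that])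
  have Bm: "?B i \<subseteq> {1..m}" if "i \<in> {1..n}" for i unfolding B[OF that] by (rule bundle_of_subset)
  have VB0: "0 \<le> ?V i (?B i)" if "i \<in> {1..n}" for i using nonneg[OF that Bm[OF that]] by simp
  have Am: "A i \<subseteq> {1..m}" if "i \<in> {1..n}" for i using A that unfolding allocations_def by auto
  have VA0: "0 \<le> ?V i (A i)" if "i \<in> {1..n}" for i using nonneg[OF that Am[OF that]] by simp
  have pot_B: "pot i (A0 i) \<le> 4 * real n * ?V i (?B i)" if "i \<in> {1..n}" "A0 i \<noteq> 0" for i
  proof -
    have "pot i (A0 i) \<le> real_of_rat (4 * of_nat n * v i (bundle_of m Ow i))"
      using pot_le[OF that] by (simp only: of_rat_less_eq)
    then show ?thesis unfolding B[OF that(1)] by (simp add: of_rat_mult)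
  qed
  obtain c where "auction_result (depth_of k) c A0" using A0 unfolding search_result_def by blast
  note asg = assigned[OF this]
  \<comment> \<open>For \<open>p > 0\<close> the other agents contribute nothing to the sum. For
    \<open>p <= 0\<close> either some agent has value 0 and the mean of \<open>A\<close> is 0, or
    this set contains all agents.\<close>
  let ?I = "{i \<in> {1..n}. 0 < v i (A i)}"
  have "\<exists>g. g \<in> A i \<and> v i (A i) \<le> potential i g" if "i \<in> ?I" for i
  proof -
    have i: "i \<in> {1..n}" using that by simp
    have "A i \<noteq> {}" using that norm[OF i] by auto
    then obtain g where "g \<in> A i" "v i (A i) \<le> potential i g"
      using bundle_le_potential[OF i Am[OF i]] by metis
    then show ?thesis by blast
  qed
  then obtain f where f: "\<And>i. i \<in> ?I \<Longrightarrow> f i \<in> A i" "\<And>i. i \<in> ?I \<Longrightarrow>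
    v i (A i) \<le> potential i (f i)"
    by metis
  have f_inj: "inj_on f ?I"
  proof (rule inj_onI, rule ccontr)
    fix i i' assume ii: "i \<in> ?I" "i' \<in> ?I" "f i = f i'" "i \<noteq> i'"
    then have "A i \<inter> A i' = {}" using A unfolding allocations_def disjoint_family_on_def by blast
    then show False using f(1)[OF ii(1)] f(1)[OF ii(2)] ii(3) by auto
  qed
  have I_sub: "?I \<subseteq> {1..n}" by blast
  have f_img: "f ` ?I \<subseteq> {1..m}" using f(1) Am by blast
  have f_pos: "0 < potential i (f i)" if "i \<in> ?I" for i using f(2)[OF that] that by auto
  have V_f: "?V i (A i) \<le> pot i (f i)" if "i \<in> ?I" for i
    using f(2)[OF that] by (simp only: of_rat_less_eq)
  have n_pos: "0 < 8 * real n" using n by simp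
  consider "0 < p" | "p < 0" | "p = 0" by linarith
  then show ?thesis
  proof cases
    case 1
    have th: "- theta_of p = p" "\<bar>theta_of p\<bar> = p" using 1 by (simp_all add: theta_of_def)
    let ?J = "{i \<in> {1..n}. A0 i \<noteq> 0}"
    have "(\<Sum>i\<in>?I. pot i (f i) powr p) \<le> 2 powr p * (\<Sum>i\<in>?J. pot i (A0 i) powr p)"
      using welfare_positive[OF _ _ _ _ _ A0 I_sub f_inj f_img f_pos] 1 unfolding th
      by (simp add: par sign_of_def alpha_of_def beta_of_def delta_of_def choice_of_def)
    moreover have "(\<Sum>i = 1..n. ?V i (A i) powr p) = (\<Sum>i\<in>?I. ?V i (A i) powr p)"
    proof (rule sum.mono_neutral_right)
      show "\<forall>i\<in>{1..n} - ?I. ?V i (A i) powr p = 0"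
      proof
        fix i assume i: "i \<in> {1..n} - ?I"
        then have "0 \<le> v i (A i)" "\<not> 0 < v i (A i)" using VA0[of i] by auto
        then have "v i (A i) = 0" by linarith
        then show "?V i (A i) powr p = 0" by simp
      qed
    qed auto
    moreover have "(\<Sum>i\<in>?I. ?V i (A i) powr p) \<le> (\<Sum>i\<in>?I. pot i (f i) powr p)"
      using V_f VA0 1 by (intro sum_mono powr_mono2) auto
    moreover have "2 powr p * (\<Sum>i\<in>?J. pot i (A0 i) powr p) \<le> (\<Sum>i\<in>?J. (8 * real n * ?V i (?B i)) powr p)"
      unfolding sum_distrib_left
    proof (rule sum_mono)
      fix i assume i: "i \<in> ?J"
      have pos: "0 < pot i (A0 i)" using asg(3)[of i] i by simp
      have "2 powr p * pot i (A0 i) powr p = (2 * pot i (A0 i)) powr p" using pos by (simp add: powr_mult)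
      also have "\<dots> \<le> (8 * real n * ?V i (?B i)) powr p"
        using pot_B[of i] i pos 1 by (intro powr_mono2) auto
      finally show "2 powr p * pot i (A0 i) powr p \<le> (8 * real n * ?V i (?B i)) powr p" .
    qed
    moreover have "(\<Sum>i\<in>?J. (8 * real n * ?V i (?B i)) powr p) \<le> (\<Sum>i = 1..n. (8 * real n * ?V i (?B i)) powr p)"
      by (intro sum_mono2) auto
    ultimately show ?thesis using VB0 by (intro pmean_le_positive[OF 1 n_pos]) auto
  next
    case 2
    show ?thesis
    proof (cases "\<exists>i\<in>{1..n}. ?V i (A i) = 0")
      case True
      then have "pmean p n ?V A = 0" using pmean_eq_0[of p _ n ?V A] 2 by auto
      then show ?thesis using n_pos pmean_nonneg[of p n ?V ?B] by simp
    next
      case False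
      have I: "?I = {1..n}" using False VA0 by (auto simp: less_le)
      have th: "theta_of p = p" "\<bar>theta_of p\<bar> = - p" using 2 by (simp_all add: theta_of_def)
      have w: "perfect n A0 \<and> (\<Sum>i\<in>{1..n}. pot i (A0 i) powr p) \<le>
          2 powr (- p) * (\<Sum>i\<in>{1..n}. pot i (f i) powr p)"
        using welfare_negative[OF _ _ _ _ _ A0, of f] f_inj f_img f_pos 2 unfolding th I
        by (simp add: par sign_of_def alpha_of_def beta_of_def delta_of_def choice_of_def)
      have A00: "A0 i \<noteq> 0" if "i \<in> {1..n}" for i using w that unfolding perfect_def by blast
      have pos: "0 < pot i (A0 i)" if "i \<in> {1..n}" for i using asg(3)[OF that A00[OF that]] by simp
      have VA: "0 < ?V i (A i)" if "i \<in> {1..n}" for i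
        using False VA0[OF that] that by (metis less_le)
      have VB: "0 < ?V i (?B i)" if "i \<in> {1..n}" for i
        using pot_B[OF that A00[OF that]] pos[OF that] VB0[OF that] by (cases "?V i (?B i) = 0") auto
      have "(\<Sum>i = 1..n. (8 * real n * ?V i (?B i)) powr p) \<le> (\<Sum>i = 1..n. 2 powr p * pot i (A0 i) powr p)"
      proof (rule sum_mono)
        fix i assume i: "i \<in> {1..n}"
        have "(8 * real n * ?V i (?B i)) powr p \<le> (2 * pot i (A0 i)) powr p"
          using pot_B[OF i A00[OF i]] pos[OF i] 2 by (intro powr_mono2') auto
        then show "(8 * real n * ?V i (?B i)) powr p \<le> 2 powr p * pot i (A0 i) powr p"
          using pos[OF i] by (simp add: powr_mult)
      qed
      also have "\<dots> \<le> 2 powr p * (2 powr (- p) * (\<Sum>i\<in>{1..n}. pot i (f i) powr p))"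
        unfolding sum_distrib_left[symmetric] using w by (intro mult_left_mono) auto
      also have "\<dots> = (\<Sum>i\<in>{1..n}. pot i (f i) powr p)" by (simp add: powr_minus)
      also have "\<dots> \<le> (\<Sum>i\<in>{1..n}. ?V i (A i) powr p)"
      proof (rule sum_mono)
        fix i assume i: "i \<in> {1..n}"
        show "pot i (f i) powr p \<le> ?V i (A i) powr p"
          using V_f[unfolded I, OF i] VA[OF i] 2 by (intro powr_mono2') auto
      qed
      finally show ?thesis using VA VB by (intro pmean_le_negative[OF 2 n_pos n]) auto
    qed
  next
    case 3
    show ?thesis
    proof (cases "\<exists>i\<in>{1..n}. ?V i (A i) = 0")
      case True
      then have "pmean p n ?V A = 0" using pmean_eq_0[of p _ n ?V A] 3 by auto
      then show ?thesis using n_pos pmean_nonneg[of p n ?V ?B] by simp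
    next
      case False
      have I: "?I = {1..n}" using False VA0 by (auto simp: less_le)
      have th: "theta_of p = - 1" using 3 by (simp add: theta_of_def)
      have w: "perfect n A0 \<and> (\<Prod>i\<in>{1..n}. pot i (f i)) \<le> 2 ^ n * (\<Prod>i\<in>{1..n}. pot i (A0 i))"
        using welfare_zero[OF _ _ _ _ _ th A0, of f] f_inj f_img f_pos 3 unfolding I
        by (simp add: par sign_of_def alpha_of_def beta_of_def delta_of_def choice_of_def)
      have A00: "A0 i \<noteq> 0" if "i \<in> {1..n}" for i using w that unfolding perfect_def by blast
      have pos: "0 < pot i (A0 i)" if "i \<in> {1..n}" for i using asg(3)[OF that A00[OF that]] by simp
      have "(\<Prod>i = 1..n. ?V i (A i)) \<le> (\<Prod>i = 1..n. pot i (f i))"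
      proof (rule prod_mono)
        fix i assume "i \<in> {1..n}"
        then show "0 \<le> ?V i (A i) \<and> ?V i (A i) \<le> pot i (f i)"
          using VA0 V_f[unfolded I] by blast
      qed
      also have "\<dots> \<le> 2 ^ n * (\<Prod>i = 1..n. pot i (A0 i))" using w by simp
      also have "\<dots> = (\<Prod>i = 1..n. 2 * pot i (A0 i))" by (simp add: prod.distrib)
      also have "\<dots> \<le> (\<Prod>i = 1..n. 8 * real n * ?V i (?B i))"
      proof (rule prod_mono)
        fix i assume i: "i \<in> {1..n}"
        show "0 \<le> 2 * pot i (A0 i) \<and> 2 * pot i (A0 i) \<le> 8 * real n * ?V i (?B i)"
          using pot_B[OF i A00[OF i]] pos[OF i] by linarith
      qed
      finally show ?thesis using VA0 VB0 unfolding 3 by (intro pmean_le_zero[OF n_pos n]) auto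
    qed
  qed
qed

end

theorem theorem9:
  fixes p :: real
  assumes "p \<le> 1"
  shows "\<exists>(c :: com) (q :: nat poly). \<forall>(n :: nat) (m :: nat) (v :: nat \<Rightarrow> nat set \<Rightarrow> rat).
    let V = (\<lambda>i S. real_of_rat (v i S)) in
    n \<ge> 1 \<and>
    (\<forall>i\<in>{1..n}. nonneg_val m (V i) \<and> normalized_val (V i) \<and>
       monotone_val m (V i) \<and> subadditive_val m (V i))
    \<longrightarrow> (\<exists>t s. exec p n m v c (initial_store n m) t s \<and>
          t \<le> poly q (n + m + value_bits n m v) \<and>
          output_bundles n m s \<in> allocations n m \<and>
          pmean p n V (output_bundles n m s)
            \<ge> 1 / (8 * real n) * Max (pmean p n V ` allocations n m))"
proof -
  have "theta_of p \<noteq> 0" by (simp add: theta_of_def)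
  then obtain G H where GH: "1 \<le> G" "4 \<le> H"
    "real_of_rat (gam G) powr (2 * (\<bar>theta_of p\<bar> + 2) + 1) * (1 + 8 / real H) \<le> 2 powr \<bar>theta_of p\<bar>"
    using exists_accuracy by blast
  obtain j :: nat where j: "\<bar>p\<bar> + 1 \<le> 2 ^ j"
    using real_arch_pow[of 2 "\<bar>p\<bar> + 1"] by (auto intro: less_imp_le)
  obtain qY where qY: "\<And>X. resource_bound G H j X = poly qY X"
    using is_poly_resource_bound unfolding is_poly_def by blast
  let ?c = "program_for p G H"
  \<comment> \<open>The running time is polynomial in \<open>Y\<close>, and \<open>Y\<close> is
    polynomial in the input size. Both polynomials depend on \<open>p\<close> only, through the
    constants \<open>G\<close>, \<open>H\<close>, \<open>j\<close> and the choice of signs.\<close>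
  let ?q = "pcompose (time_bound ?c) qY"
  show ?thesis
  proof (intro exI[of _ ?c] exI[of _ ?q] allI, unfold Let_def, intro impI)
    fix n m :: nat and v :: "nat \<Rightarrow> nat set \<Rightarrow> rat"
    let ?V = "\<lambda>i S. real_of_rat (v i S)"
    assume asm: "n \<ge> 1 \<and> (\<forall>i\<in>{1..n}. nonneg_val m (?V i) \<and> normalized_val (?V i) \<and>
       monotone_val m (?V i) \<and> subadditive_val m (?V i))"
    define L where "L = value_bits n m v"
    define X where "X = n + m + L"
    define Y where "Y = resource_bound G H j X"
    have L: "rat_size (v i S) \<le> L" if "i \<in> {1..n}" "S \<subseteq> {1..m}" for i S
    proof -
      have "rat_size (v i S) \<in> (\<lambda>(i, S). rat_size (v i S)) ` ({1..n} \<times> Pow {1..m})" using that by force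
      then show ?thesis unfolding L_def value_bits_def by (intro Max_ge) auto
    qed
    have XY: "X + 10 \<le> Y" unfolding Y_def resource_bound_def by linarith
    interpret run_bound p n m v Y
    proof
      show "rat_size (v i S) \<le> Y" if "i \<in> {1..n}" "S \<subseteq> {1..m}" for i S
        using L[OF that] XY unfolding X_def by linarith
    qed (use XY in \<open>simp_all add: X_def\<close>)
    have init: "bounded_store Y (initial_store n m)"
    proof -
      have "rat_size (of_nat n) \<le> Y" "rat_size (of_nat m) \<le> Y"
        using rat_size_of_nat[of n] rat_size_of_nat[of m] n_le m_le by linarith+
      then show ?thesis using const_bounds by (auto simp: bounded_store_def initial_store_def)
    qed
    have result: "\<exists>t s. exec p n m v ?c (initial_store n m) t s \<and> t \<le> poly ?q X \<and>
       output_bundles n m s \<in> allocations n m \<and>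
       (\<forall>A\<in>allocations n m. pmean p n ?V A \<le> 8 * real n * pmean p n ?V (output_bundles n m s))"
    \<comment> \<open>Without goods there is only one allocation, so the program's output is
      trivially optimal.\<close>
    proof (cases "m = 0")
      case True
      have "wp ?c (\<lambda>_. True) (initial_store n m)"
        unfolding program_def by (intro wp_If wp_Skip) (auto simp: True initial_store_def)
      then obtain t s where ts: "exec p n m v ?c (initial_store n m) t s" "t \<le> poly (time_bound ?c) Y"
        using init by (rule wpD)
      have out: "output_bundles n m s = (\<lambda>i\<in>{1..n}. {})"
        unfolding output_bundles_def True by (auto simp: restrict_def)
      have "output_bundles n m s \<in> allocations n m"
        unfolding out allocations_def using True by (auto simp: disjoint_family_on_def)
      moreover have "A = output_bundles n m s" if "A \<in> allocations n m" for A
        using that True unfolding out allocations_def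
        by (intro extensionalityI[of _ "{1..n}"]) (auto simp: PiE_def Pi_def)
      moreover have "pmean p n ?V B \<le> 8 * real n * pmean p n ?V B" for B
        using asm pmean_nonneg[of p n ?V B] mult_right_mono[of 1 "8 * real n" "pmean p n ?V B"] by simp
      ultimately show ?thesis using ts by (metis Y_def poly_pcompose qY)
    next
      case False
      have vals: "0 \<le> v i S" "v i {} = 0" "S \<subseteq> T \<Longrightarrow> T \<subseteq> {1..m} \<Longrightarrow>
          v i S \<le> v i T"
        "T \<subseteq> {1..m} \<Longrightarrow> v i (S \<union> T) \<le> v i S + v i T"
        if i: "i \<in> {1..n}" and S: "S \<subseteq> {1..m}" for i S T
      proof -
        have a: "nonneg_val m (?V i)" "normalized_val (?V i)" "monotone_val m (?V i)" "subadditive_val m (?V i)"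
          using asm i by auto
        have "0 \<le> ?V i S" using a(1) S unfolding nonneg_val_def by blast
        then show "0 \<le> v i S" by simp
        show "v i {} = 0" using a(2) unfolding normalized_val_def by simp
        show "v i S \<le> v i T" if "S \<subseteq> T" "T \<subseteq> {1..m}"
        proof -
          have "?V i S \<le> ?V i T" using a(3) that unfolding monotone_val_def by blast
          then show ?thesis by (simp only: of_rat_less_eq)
        qed
        show "v i (S \<union> T) \<le> v i S + v i T" if "T \<subseteq> {1..m}"
        proof -
          have "?V i (S \<union> T) \<le> ?V i S + ?V i T" using a(4) S that unfolding subadditive_val_def by blast
          then show ?thesis by (simp only: of_rat_add[symmetric] of_rat_less_eq)
        qed
      qed
      have XX: "n \<le> X" "m \<le> X" unfolding X_def by simp_all
      let ?M = "exponent_of G j X"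
      have Mb: "(2 ^ j + 1) * (G * bits_of X) + 1 = ?M" by (simp add: exponent_of_def)
      interpret table_bound p n m v Y G H j "bits_of X" "coeff_a p" "coeff_b p" "sign_of p" "alpha_of p"
        "beta_of p" "delta_of p" "choice_of p"
      proof (unfold_locales, goal_cases)
        case (5 i g)
        have "rat_size (potential i g) \<le> 2 * n + 4 * L + 4" by (rule rat_size_potential[OF L 5])
        also have "\<dots> \<le> bits_of X" unfolding bits_of_def X_def by simp
        finally show ?case .
      next
        case 6
        show ?case unfolding Y_def resource_bound_def by linarith
      next
        case 7
        show ?case unfolding Y_def resource_bound_def by linarith
      next
        case 8
        show ?case unfolding Mb Y_def resource_bound_def by linarith
      qed (use GH j in \<open>auto simp: coeff_a_def coeff_b_def sign_of_def alpha_of_def beta_of_def delta_of_def choice_of_def\<close>)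
      have M: "max_exponent = ?M" unfolding max_exponent_def exponent_of_def ..
      have DX: "depth_of (max_exponent * max_exponent) \<le> depth_bound G j X"
        unfolding M depth_of_def depth_bound_def using XX by (intro add_mono mult_mono) auto
      have Hn: "H * n \<le> H * X" using XX by simp
      have nm: "(n + 1) * m \<le> (X + 1) * X" using XX by (intro mult_mono) auto
      have nmD: "(n + m) * (H * n + depth_of (max_exponent * max_exponent)) * ((n + 1) * m + 1) \<le>
          (X + X) * (H * X + depth_bound G j X) * ((X + 1) * X + 1)"
        using XX DX Hn nm by (intro mult_mono add_mono) auto
      have nmn: "n * m * ((n + 1) * m + 1) \<le> X * X * ((X + 1) * X + 1)"
        using XX nm by (intro mult_mono add_mono) auto
      have Dr: "(depth_of (max_exponent * max_exponent) + 1) * rat_size (gam G) \<le> (depth_bound G j X + 1) * rat_size (gam G)"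
        using DX by (intro mult_mono) auto
      interpret allocation_bound p n m v Y G H j "bits_of X" "coeff_a p" "coeff_b p" "sign_of p" "alpha_of p"
        "beta_of p" "delta_of p" "choice_of p"
      proof (unfold_locales, goal_cases)
        case 7
        show ?case using Dr unfolding Y_def resource_bound_def by linarith
      next
        case 8
        show ?case using Hn DX unfolding Y_def resource_bound_def by linarith
      next
        case 9
        show ?case using nmD nm unfolding Y_def resource_bound_def by linarith
      next
        case 10
        show ?case using DX unfolding M Y_def resource_bound_def by linarith
      next
        case 11
        show ?case using nmn nm unfolding Y_def resource_bound_def by linarith
      qed (use vals asm False in auto)
      obtain t s where ts: "exec p n m v ?c (initial_store n m) t s" "t \<le> poly (time_bound ?c) Y" "good_outcome s"
        using wp_program init by (rule wpD)
      have "output_bundles n m s \<in> allocations n m"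
        using ts(3) output_allocation unfolding good_outcome_def by blast
      moreover have "pmean p n ?V A \<le> 8 * real n * pmean p n ?V (output_bundles n m s)"
        if "A \<in> allocations n m" for A
        by (rule outcome_approximation[OF _ _ _ _ _ _ _ GH(2,3) ts(3) that]) simp_all
      moreover have "t \<le> poly ?q X" using ts(2) by (simp add: Y_def poly_pcompose qY)
      ultimately show ?thesis using ts(1) by blast
    qed
    then obtain t s where ts: "exec p n m v ?c (initial_store n m) t s" "t \<le> poly ?q X"
      "output_bundles n m s \<in> allocations n m"
      "\<forall>A\<in>allocations n m. pmean p n ?V A \<le> 8 * real n * pmean p n ?V (output_bundles n m s)" by blast
    have "Max (pmean p n ?V ` allocations n m) \<le> 8 * real n * pmean p n ?V (output_bundles n m s)"
      using ts(4) asm finite_allocations allocations_nonempty by (subst Max_le_iff) auto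
    then have "1 / (8 * real n) * Max (pmean p n ?V ` allocations n m) \<le> pmean p n ?V (output_bundles n m s)"
      using asm by (simp add: field_simps)
    then show "\<exists>t s. exec p n m v ?c (initial_store n m) t s \<and>
          t \<le> poly ?q (n + m + value_bits n m v) \<and>
          output_bundles n m s \<in> allocations n m \<and>
          pmean p n ?V (output_bundles n m s) \<ge> 1 / (8 * real n) * Max (pmean p n ?V ` allocations n m)"
      using ts unfolding X_def L_def by blast
  qed
qed

end
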